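(* Let $1\le k\le n$, let $\mathbb{H}^n=\mathbb{W}\rtimes\mathbb{V}$ be a semidirect factorization of the Heisenberg group with $\mathbb{W}$ a vertical subgroup and $\mathbb{V}$ a $k$-dimensional horizontal subgroup, and let $d$ be a homogeneous distance on $\mathbb{H}^n$. Let $\Sigma\subset\mathbb{H}^n$ be a parametrized $\mathbb{H}$-regular surface with respect to $(\mathbb{W},\mathbb{V})$, with parametrization $\phi:U\to\mathbb{V}$ ($U\subset\mathbb{W}$ open), graph map $\Phi(n)=n\phi(n)$ and defining function $f\in C^1_h(\Omega,\mathbb{R}^k)$. Let $(v_1,\dots,v_k)$ and $(w_{k+1},\dots,w_{2n},e_{2n+1})$ be orthonormal bases of $\mathbb{V}$ and $\mathbb{W}$, and put $V=v_1\wedge\cdots\wedge v_k$, $N=w_{k+1}\wedge\cdots\wedge w_{2n}\wedge e_{2n+1}$. Define, for Borel sets $B$, $$\mu(B)=\|V\wedge N\|_g\int_{\Phi^{-1}(B)}\frac{J_Hf(\Phi(n))}{J_{\mathbb{V}}f(\Phi(n))}\,d\mathcal{H}^{2n+1-k}_E(n).$$ Then for every Borel set $B\subset\Sigma$ $$\mu(B)=\int_B\beta_d(\mathrm{Tan}(\Sigma,x))\,d\mathcal{S}^{2n+2-k}(x).$$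
   Context: Heisenberg group: $\mathbb{H}^n=H_1\oplus H_2$ is a real vector space, $\dim H_1=2n$, $\dim H_2=1$, with a symplectic form $\omega$ on $H_1$ and a fixed $0\ne e_{2n+1}\in H_2$; $\pi_{H_1}$ is the projection on $H_1$, $[p,q]=\omega(\pi_{H_1}p,\pi_{H_1}q)e_{2n+1}$ and $pq=p+q+\frac12[p,q]$ (identity $0$). Dilations: $\delta_t$ is linear with $\delta_t w=t^iw$ for $w\in H_i$, $t>0$. Fix a basis $(e_1,\dots,e_{2n})$ of $H_1$ with $\omega(e_i,e_{n+j})=\delta_{ij}$, $\omega(e_i,e_j)=\omega(e_{n+i},e_{n+j})=0$ for $1\le i,j\le n$, and the scalar product $\langle\cdot,\cdot\rangle$ making $(e_1,\dots,e_{2n+1})$ orthonormal; this identifies $\mathbb{H}^n$ with $\mathbb{R}^{2n+1}$. $\|\cdot\|_g$ on multivectors is the norm induced by $\langle\cdot,\cdot\rangle$. $\mathcal{H}^p_E$ is the $p$-dimensional Hausdorff measure for the Euclidean distance (normalized to agree with Lebesgue measure on $p$-dimensional subspaces). A homogeneous distance $d$ is a distance with $d(zx,zy)=d(x,y)$ and $d(\delta_tx,\delta_ty)=t\,d(x,y)$; $\|x\|=d(x,0)$; $\mathbb{B}(x,r)=\{y:d(x,y)\le r\}$. Homogeneous subgroups are Lie subgroups closed under all $\delta_t$; vertical ones contain $H_2$, horizontal ones are contained in $H_1$. $\mathbb{H}^n=\mathbb{W}\rtimes\mathbb{V}$ means $\mathbb{W}$ vertical, $\mathbb{V}$ horizontal,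 $\mathbb{H}^n=\mathbb{W}\mathbb{V}$, $\mathbb{W}\cap\mathbb{V}=\{0\}$; then $x=\pi_{\mathbb{W}}(x)\pi_{\mathbb{V}}(x)$ uniquely. An h-homomorphism is a homogeneous (commuting with dilations) group homomorphism; on $\mathbb{R}^k$ dilations are $y\mapsto ty$. For $\Omega\subset\mathbb{H}^n$ open, $f:\Omega\to\mathbb{R}^k$ is h-differentiable (Pansu differentiable) at $x$ if there is an h-homomorphism $Df(x):\mathbb{H}^n\to\mathbb{R}^k$ with $|f(xw)-f(x)-Df(x)(w)|=o(\|w\|)$ as $w\to0$; $f\in C^1_h(\Omega,\mathbb{R}^k)$ if this holds everywhere and $x\mapsto Df(x)$ is continuous. For scalar $f_i$, $\nabla_Hf_i(x)\in H_1$ is given by $Df_i(x)(z)=\langle\nabla_Hf_i(x),z\rangle$ for all $z$, and $\nabla_{\mathbb{V}}f_i(x)\in\mathbb{V}$ by the same identity for $z\in\mathbb{V}$. $J_Hf(x)=\|\nabla_Hf_1(x)\wedge\cdots\wedge\nabla_Hf_k(x)\|_g$, $J_{\mathbb{V}}f(x)=\|\nabla_{\mathbb{V}}f_1(x)\wedge\cdots\wedge\nabla_{\mathbb{V}}f_k(x)\|_g$. $\Sigma$ is a ($k$-codimensional) $\mathbb{H}$-regular surface if each $x\in\Sigma$ has an open neighbourhood $\Omega_x$ and $h\in C^1_h(\Omega_x,\mathbb{R}^k)$ with $\Sigma\cap\Omega_x=\{h=0\}$ and $\nabla_Hh_1\wedge\cdots\wedge\nabla_Hh_k\neq0$ on $\Omega_x$.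 For $\phi:U\to\mathbb{V}$, $U\subset\mathbb{W}$ open, $x\in\mathbb{H}^n$: $\sigma_x(w)=xw\,\pi_{\mathbb{V}}(x)^{-1}$ on $\mathbb{W}$, and $\phi_x(w)=\pi_{\mathbb{V}}(x)\phi(\sigma_{x^{-1}}(w))$ for $w\in\sigma_x(U)$. With $\Phi(w)=w\phi(w)$, $\phi$ is uniformly intrinsic differentiable on $U$ if for each $\bar w\in U$ there is an h-homomorphism $d\phi_{\bar w}:\mathbb{W}\to\mathbb{V}$ with $\lim_{\delta\to0}\sup_{\|\bar w^{-1}w'\|<\delta}\sup_{0<\|w\|<\delta}d(d\phi_{\bar w}(w),\phi_{\Phi(w')^{-1}}(w))/\|w\|=0$. An $\mathbb{H}$-regular surface $\Sigma$ is a parametrized $\mathbb{H}$-regular surface with respect to $(\mathbb{W},\mathbb{V})$, with parametrization $\phi$, if $\mathbb{H}^n=\mathbb{W}\rtimes\mathbb{V}$ and $\Sigma=\{u\phi(u):u\in U\}$ with $U\subset\mathbb{W}$ open and $\phi:U\to\mathbb{V}$ uniformly intrinsic differentiable. A function $f\in C^1_h(\Omega,\mathbb{R}^k)$, $\Omega$ open, $\Sigma\subset\Omega$, is a defining function of $\Sigma$ if $f^{-1}(f(x_0))\cap U\mathbb{V}=\Sigma$ for some $x_0\in\Sigma$ and $Df(x)$ is surjective for all $x\in\Sigma$. Tangent cone: $\mathrm{Tan}(\Sigma,x)$ is the set of limits $\lim_h\delta_{r_h}(x^{-1}x_h)$ with $r_h>0$, $x_h\in\Sigma$, $x_h\to x$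 (for these surfaces it is a $(2n+1-k)$-dimensional vertical subgroup). Spherical factor of a $p$-dimensional linear subspace $\Pi$: $\beta_d(\Pi)=\max_{z\in\mathbb{B}(0,1)}\mathcal{H}^p_E(\Pi\cap\mathbb{B}(z,1))$. Spherical measure: $\mathcal{S}^\alpha(A)=\sup_{\delta>0}\inf\{\sum_j2^{-\alpha}\mathrm{diam}(B_j)^\alpha: A\subset\bigcup_jB_j,\ B_j\text{ closed }d\text{-balls},\ \mathrm{diam}(B_j)\le\delta\}$ (one has $\mathrm{diam}\,\mathbb{B}(x,r)=2r$). *)

theory Defs
  imports "HOL-Analysis.Analysis" "HOL-Algebra.Group"
begin

section \<open>The Heisenberg group\<close>

text \<open>
  The Heisenberg group of dimension \<open>2n+1\<close>, \<open>n = CARD('n)\<close>, in the coordinates of the fixed symplectic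
  basis: \<open>((a, b), s)\<close> stands for \<open>\<Sum>i. a$i e_i + \<Sum>i. b$i e_{n+i} + s e_{2n+1}\<close>. The product inner
  product, norm and topology of this type are then the Euclidean ones for which the basis
  \<open>e_1, \<dots>, e_{2n+1}\<close> is orthonormal.
\<close>

type_synonym 'n heis = "((real^'n) \<times> (real^'n)) \<times> real"

definition symp :: "(real^'n) \<times> (real^'n) \<Rightarrow> (real^'n) \<times> (real^'n) \<Rightarrow> real" where
  "symp p q = fst p \<bullet> snd q - snd p \<bullet> fst q"

definition H1 :: "'n::finite heis set" where
  "H1 = {x. snd x = 0}"

definition H2 :: "'n::finite heis set" where
  "H2 = {x. fst x = 0}"

definition e_top :: "'n::finite heis" where
  "e_top = (0, 1)"

definition bracket :: "'n::finite heis \<Rightarrow> 'n heis \<Rightarrow> 'n heis" where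
  "bracket x y = symp (fst x) (fst y) *\<^sub>R e_top"

definition hmul :: "'n::finite heis \<Rightarrow> 'n heis \<Rightarrow> 'n heis" (infixl "\<odot>" 70) where
  "x \<odot> y = x + y + (1/2) *\<^sub>R bracket x y"

definition hinv :: "'n::finite heis \<Rightarrow> 'n heis" where
  "hinv x = - x"

definition dil :: "real \<Rightarrow> 'n::finite heis \<Rightarrow> 'n heis" where
  "dil t x = (t *\<^sub>R fst x, t^2 * snd x)"

definition heis_group :: "'n::finite heis monoid" where
  "heis_group = \<lparr>carrier = UNIV, monoid.mult = hmul, one = 0\<rparr>"

lemma group_heis_group: "group (heis_group :: 'n::finite heis monoid)"
proof (rule groupI)
  fix x y z :: "'n heis"
  show "x \<otimes>\<^bsub>heis_group\<^esub> y \<otimes>\<^bsub>heis_group\<^esub> z = x \<otimes>\<^bsub>heis_group\<^esub> (y \<otimes>\<^bsub>heis_group\<^esub> z)"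
    by (simp add: heis_group_def hmul_def bracket_def symp_def e_top_def prod_eq_iff
        inner_add_left inner_add_right algebra_simps)
next
  fix x :: "'n heis"
  have "(- x) \<otimes>\<^bsub>heis_group\<^esub> x = \<one>\<^bsub>heis_group\<^esub>"
    by (simp add: heis_group_def hmul_def bracket_def symp_def inner_commute)
  then show "\<exists>y\<in>carrier heis_group. y \<otimes>\<^bsub>heis_group\<^esub> x = \<one>\<^bsub>heis_group\<^esub>"
    by (intro bexI[of _ "- x"]) (simp_all add: heis_group_def)
qed (simp_all add: heis_group_def hmul_def bracket_def symp_def)

lemma hinv_eq_m_inv: "hinv x = inv\<^bsub>heis_group\<^esub> x"
proof -
  interpret group "heis_group :: 'a heis monoid" by (rule group_heis_group)
  have "hinv x \<otimes>\<^bsub>heis_group\<^esub> x = \<one>\<^bsub>heis_group\<^esub>"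
    by (simp add: heis_group_def hmul_def bracket_def symp_def hinv_def inner_commute)
  moreover have "y \<in> carrier heis_group" for y :: "'a heis"
    by (simp add: heis_group_def)
  ultimately show ?thesis
    by (metis inv_equality)
qed

text \<open>The additive group of a real vector space, with dilations \<open>y \<mapsto> t y\<close>.\<close>

definition vec_group :: "'b::real_vector monoid" where
  "vec_group = \<lparr>carrier = UNIV, monoid.mult = (+), one = 0\<rparr>"


section \<open>Homogeneous distances and subgroups\<close>

text \<open>
  No compatibility of \<open>d\<close> with the topology is required: a homogeneous distance on the Heisenberg group
  automatically induces the Euclidean topology.
\<close>

definition homogeneous_distance :: "('n::finite heis \<Rightarrow> 'n heis \<Rightarrow> real) \<Rightarrow> bool" where
  "homogeneous_distance d \<longleftrightarrow> Metric_space UNIV d \<and>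
     (\<forall>x y z. d (z \<odot> x) (z \<odot> y) = d x y) \<and>
     (\<forall>t>0. \<forall>x y. d (dil t x) (dil t y) = t * d x y)"

definition hnorm :: "('n::finite heis \<Rightarrow> 'n heis \<Rightarrow> real) \<Rightarrow> 'n heis \<Rightarrow> real" where
  "hnorm d x = d x 0"

definition hball :: "('n::finite heis \<Rightarrow> 'n heis \<Rightarrow> real) \<Rightarrow> 'n heis \<Rightarrow> real \<Rightarrow> 'n heis set" where
  "hball d x r = {y. d x y \<le> r}"

text \<open>Lie subgroups are rendered as topologically closed subgroups.\<close>

definition homogeneous_subgroup :: "'n::finite heis set \<Rightarrow> bool" where
  "homogeneous_subgroup S \<longleftrightarrow>
     subgroup S heis_group \<and> closed S \<and> (\<forall>t>0. \<forall>x\<in>S. dil t x \<in> S)"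

definition vertical_subgroup :: "'n::finite heis set \<Rightarrow> bool" where
  "vertical_subgroup W \<longleftrightarrow> homogeneous_subgroup W \<and> H2 \<subseteq> W"

definition horizontal_subgroup :: "'n::finite heis set \<Rightarrow> bool" where
  "horizontal_subgroup V \<longleftrightarrow> homogeneous_subgroup V \<and> V \<subseteq> H1"

definition semidirect_factorization :: "'n::finite heis set \<Rightarrow> 'n heis set \<Rightarrow> bool" where
  "semidirect_factorization W V \<longleftrightarrow>
     vertical_subgroup W \<and> horizontal_subgroup V \<and>
     {w \<odot> v |w v. w \<in> W \<and> v \<in> V} = UNIV \<and> W \<inter> V = {0}"

definition projV :: "'n::finite heis set \<Rightarrow> 'n heis set \<Rightarrow> 'n heis \<Rightarrow> 'n heis" where
  "projV W V x = (THE v. v \<in> V \<and> (\<exists>w\<in>W. x = w \<odot> v))"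


section \<open>Pansu differentiability\<close>

definition h_homomorphism ::
  "'a monoid \<Rightarrow> (real \<Rightarrow> 'a \<Rightarrow> 'a) \<Rightarrow> 'b monoid \<Rightarrow> (real \<Rightarrow> 'b \<Rightarrow> 'b) \<Rightarrow> ('a \<Rightarrow> 'b) \<Rightarrow> bool" where
  "h_homomorphism G dG H dH L \<longleftrightarrow>
     L \<in> hom G H \<and> (\<forall>t>0. \<forall>x\<in>carrier G. L (dG t x) = dH t (L x))"

definition has_h_derivative ::
  "('n::finite heis \<Rightarrow> 'n heis \<Rightarrow> real) \<Rightarrow> ('n heis \<Rightarrow> 'b::real_normed_vector) \<Rightarrow> 'n heis \<Rightarrow>
   ('n heis \<Rightarrow> 'b) \<Rightarrow> bool" where
  "has_h_derivative d f x L \<longleftrightarrow>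
     h_homomorphism heis_group dil vec_group (*\<^sub>R) L \<and>
     ((\<lambda>w. norm (f (x \<odot> w) - f x - L w) / hnorm d w) \<longlongrightarrow> 0) (at 0)"

definition h_deriv ::
  "('n::finite heis \<Rightarrow> 'n heis \<Rightarrow> real) \<Rightarrow> ('n heis \<Rightarrow> 'b::real_normed_vector) \<Rightarrow> 'n heis \<Rightarrow>
   'n heis \<Rightarrow> 'b" where
  "h_deriv d f x = (THE L. has_h_derivative d f x L)"

text \<open>
  Continuity of \<open>x \<mapsto> Df(x)\<close> is with respect to the product topology on functions, that is, pointwise
  convergence; on the finite-dimensional space of h-homomorphisms this is the norm topology.
\<close>

definition C1_h ::
  "('n::finite heis \<Rightarrow> 'n heis \<Rightarrow> real) \<Rightarrow> 'n heis set \<Rightarrow> ('n heis \<Rightarrow> 'b::real_normed_vector) \<Rightarrow> bool" where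
  "C1_h d \<Omega> f \<longleftrightarrow> open \<Omega> \<and> (\<forall>x\<in>\<Omega>. \<exists>L. has_h_derivative d f x L) \<and> continuous_on \<Omega> (h_deriv d f)"

definition grad_H ::
  "('n::finite heis \<Rightarrow> 'n heis \<Rightarrow> real) \<Rightarrow> ('n heis \<Rightarrow> real) \<Rightarrow> 'n heis \<Rightarrow> 'n heis" where
  "grad_H d g x = (THE v. v \<in> H1 \<and> (\<forall>z. h_deriv d g x z = v \<bullet> z))"

definition grad_V ::
  "('n::finite heis \<Rightarrow> 'n heis \<Rightarrow> real) \<Rightarrow> 'n heis set \<Rightarrow> ('n heis \<Rightarrow> real) \<Rightarrow> 'n heis \<Rightarrow> 'n heis" where
  "grad_V d V g x = (THE v. v \<in> V \<and> (\<forall>z\<in>V. h_deriv d g x z = v \<bullet> z))"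


section \<open>Multivectors\<close>

text \<open>
  A \<open>k\<close>-vector, \<open>k = CARD('i)\<close>, is represented by its components: through the inner product it is the
  alternating \<open>k\<close>-linear form pairing it with \<open>u_1 \<and> \<dots> \<and> u_k\<close>. In \<open>multivector_norm\<close> the simple vectors
  \<open>b_1 \<and> \<dots> \<and> b_k\<close> of distinct basis vectors are orthonormal; the sum runs over all \<open>k\<close>-tuples of basis
  vectors, so each of them is counted \<open>k!\<close> times (and tuples with repetitions contribute \<open>0\<close>).
\<close>

definition wedge :: "('i::finite \<Rightarrow> 'a::euclidean_space) \<Rightarrow> ('i \<Rightarrow> 'a) \<Rightarrow> real" where
  "wedge v = (\<lambda>u. det (\<chi> i j. v i \<bullet> u j))"

definition multivector_norm :: "(('i::finite \<Rightarrow> 'a::euclidean_space) \<Rightarrow> real) \<Rightarrow> real" where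
  "multivector_norm \<xi> = sqrt ((\<Sum>b\<in>UNIV \<rightarrow>\<^sub>E Basis. (\<xi> b)\<^sup>2) / fact CARD('i))"

lemma multivector_norm_wedge:
  fixes v :: "'i::finite \<Rightarrow> 'a::euclidean_space"
  shows "multivector_norm (wedge v) = sqrt (det (\<chi> i j. v i \<bullet> v j))"
proof -
  let ?P = "{p. p permutes (UNIV :: 'i set)}"
  let ?s = "\<lambda>p. of_int (sign p) :: real"
  have w: "wedge v b = (\<Sum>p\<in>?P. ?s p * (\<Prod>j\<in>UNIV. v (p j) \<bullet> b j))" for b
    unfolding wedge_def by (subst det_transpose[symmetric]) (simp add: det_def transpose_def)
  have "(\<Sum>b\<in>UNIV \<rightarrow>\<^sub>E Basis. (wedge v b)\<^sup>2)
      = (\<Sum>b\<in>UNIV \<rightarrow>\<^sub>E Basis. \<Sum>p\<in>?P. \<Sum>q\<in>?P. ?s p * ?s q * (\<Prod>j\<in>UNIV. (v (p j) \<bullet> b j) * (v (q j) \<bullet> b j)))"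
    by (simp add: w power2_eq_square sum_product prod.distrib mult_ac)
  also have "\<dots> = (\<Sum>p\<in>?P. \<Sum>q\<in>?P. ?s p * ?s q *
      (\<Sum>b\<in>UNIV \<rightarrow>\<^sub>E Basis. \<Prod>j\<in>UNIV. (v (p j) \<bullet> b j) * (v (q j) \<bullet> b j)))"
    by (subst sum.swap, rule sum.cong[OF refl], subst sum.swap) (simp add: sum_distrib_left)
  also have "\<dots> = (\<Sum>p\<in>?P. \<Sum>q\<in>?P. ?s p * ?s q * (\<Prod>j\<in>UNIV. v (p j) \<bullet> v (q j)))"
    by (subst prod_sum_PiE[symmetric]) (simp_all flip: euclidean_inner)
  also have "\<dots> = (\<Sum>p\<in>?P. ?s p * det (\<chi> i j. v (p i) \<bullet> v j))"
    by (simp add: det_def sum_distrib_left mult_ac)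
  also have "\<dots> = (\<Sum>p\<in>?P. det (\<chi> i j. v i \<bullet> v j))"
  proof (rule sum.cong[OF refl])
    fix p assume "p \<in> ?P"
    then have "det (\<chi> i j. v (p i) \<bullet> v j) = ?s p * det (\<chi> i j. v i \<bullet> v j)"
      using det_permute_rows[of p "\<chi> i j. v i \<bullet> v j"] by simp
    moreover have "?s p * ?s p = 1"
      by (metis of_int_1 of_int_mult sign_idempotent)
    ultimately show "?s p * det (\<chi> i j. v (p i) \<bullet> v j) = det (\<chi> i j. v i \<bullet> v j)"
      by (simp flip: mult.assoc)
  qed
  also have "\<dots> = fact CARD('i) * det (\<chi> i j. v i \<bullet> v j)"
    by (simp add: card_permutations)
  finally show ?thesis
    by (simp add: multivector_norm_def)
qed

definition J_H :: "('n::finite heis \<Rightarrow> 'n heis \<Rightarrow> real) \<Rightarrow> ('n heis \<Rightarrow> real^'k::finite) \<Rightarrow> 'n heis \<Rightarrow> real" where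
  "J_H d f x = multivector_norm (wedge (\<lambda>i. grad_H d (\<lambda>y. f y $ i) x))"

definition J_V ::
  "('n::finite heis \<Rightarrow> 'n heis \<Rightarrow> real) \<Rightarrow> 'n heis set \<Rightarrow> ('n heis \<Rightarrow> real^'k::finite) \<Rightarrow> 'n heis \<Rightarrow> real" where
  "J_V d V f x = multivector_norm (wedge (\<lambda>i. grad_V d V (\<lambda>y. f y $ i) x))"

definition orthonormal_basis_of :: "('i \<Rightarrow> 'a::euclidean_space) \<Rightarrow> 'a set \<Rightarrow> bool" where
  "orthonormal_basis_of b S \<longleftrightarrow>
     (\<forall>i j. b i \<bullet> b j = (if i = j then 1 else 0)) \<and> span (range b) = S"


section \<open>Parametrized H-regular surfaces\<close>

definition H_regular_surface ::
  "'k::finite itself \<Rightarrow> ('n::finite heis \<Rightarrow> 'n heis \<Rightarrow> real) \<Rightarrow> 'n heis set \<Rightarrow> bool" where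
  "H_regular_surface _ d \<Sigma> \<longleftrightarrow>
     (\<forall>x\<in>\<Sigma>. \<exists>\<Omega> (h :: 'n heis \<Rightarrow> real^'k). open \<Omega> \<and> x \<in> \<Omega> \<and> C1_h d \<Omega> h \<and>
        \<Sigma> \<inter> \<Omega> = {y \<in> \<Omega>. h y = 0} \<and>
        (\<forall>y\<in>\<Omega>. wedge (\<lambda>i. grad_H d (\<lambda>z. h z $ i) y) \<noteq> (\<lambda>_. 0)))"

definition sigma_tr :: "'n::finite heis set \<Rightarrow> 'n heis set \<Rightarrow> 'n heis \<Rightarrow> 'n heis \<Rightarrow> 'n heis" where
  "sigma_tr W V x w = x \<odot> w \<odot> hinv (projV W V x)"

text \<open>The translated map \<open>\<phi>_x\<close>, meaningful on \<open>sigma_tr W V x ` U\<close>.\<close>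

definition phi_tr ::
  "'n::finite heis set \<Rightarrow> 'n heis set \<Rightarrow> ('n heis \<Rightarrow> 'n heis) \<Rightarrow> 'n heis \<Rightarrow> 'n heis \<Rightarrow> 'n heis" where
  "phi_tr W V \<phi> x w = projV W V x \<odot> \<phi> (sigma_tr W V (hinv x) w)"

definition graph_map :: "('n::finite heis \<Rightarrow> 'n heis) \<Rightarrow> 'n heis \<Rightarrow> 'n heis" where
  "graph_map \<phi> w = w \<odot> \<phi> w"

definition unif_intrinsic_differentiable ::
  "('n::finite heis \<Rightarrow> 'n heis \<Rightarrow> real) \<Rightarrow> 'n heis set \<Rightarrow> 'n heis set \<Rightarrow> 'n heis set \<Rightarrow>
   ('n heis \<Rightarrow> 'n heis) \<Rightarrow> bool" where
  "unif_intrinsic_differentiable d W V U \<phi> \<longleftrightarrow>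
     (\<forall>wb\<in>U. \<exists>L. h_homomorphism (heis_group\<lparr>carrier := W\<rparr>) dil (heis_group\<lparr>carrier := V\<rparr>) dil L \<and>
       ((\<lambda>\<delta>. SUP w'\<in>{w' \<in> U. hnorm d (hinv wb \<odot> w') < \<delta>}.
              SUP w\<in>{w \<in> sigma_tr W V (hinv (graph_map \<phi> w')) ` U. 0 < hnorm d w \<and> hnorm d w < \<delta>}.
                ennreal (d (L w) (phi_tr W V \<phi> (hinv (graph_map \<phi> w')) w) / hnorm d w))
        \<longlongrightarrow> 0) (at_right 0))"

definition parametrized_H_regular_surface ::
  "'k::finite itself \<Rightarrow> ('n::finite heis \<Rightarrow> 'n heis \<Rightarrow> real) \<Rightarrow> 'n heis set \<Rightarrow> 'n heis set \<Rightarrow>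
   'n heis set \<Rightarrow> ('n heis \<Rightarrow> 'n heis) \<Rightarrow> 'n heis set \<Rightarrow> bool" where
  "parametrized_H_regular_surface k d W V U \<phi> \<Sigma> \<longleftrightarrow>
     H_regular_surface k d \<Sigma> \<and> semidirect_factorization W V \<and>
     openin (top_of_set W) U \<and> \<phi> ` U \<subseteq> V \<and> \<Sigma> = graph_map \<phi> ` U \<and>
     unif_intrinsic_differentiable d W V U \<phi>"

definition defining_function ::
  "('n::finite heis \<Rightarrow> 'n heis \<Rightarrow> real) \<Rightarrow> 'n heis set \<Rightarrow> 'n heis set \<Rightarrow> 'n heis set \<Rightarrow>
   'n heis set \<Rightarrow> ('n heis \<Rightarrow> real^'k::finite) \<Rightarrow> bool" where
  "defining_function d V U \<Sigma> \<Omega> f \<longleftrightarrow>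
     open \<Omega> \<and> C1_h d \<Omega> f \<and> \<Sigma> \<subseteq> \<Omega> \<and>
     (\<exists>x0\<in>\<Sigma>. {y \<in> \<Omega>. f y = f x0} \<inter> {u \<odot> v |u v. u \<in> U \<and> v \<in> V} = \<Sigma>) \<and>
     (\<forall>x\<in>\<Sigma>. surj (h_deriv d f x))"

definition tangent_cone :: "'n::finite heis set \<Rightarrow> 'n heis \<Rightarrow> 'n heis set" where
  "tangent_cone \<Sigma> x =
     {v. \<exists>(r :: nat \<Rightarrow> real) X. (\<forall>h. r h > 0 \<and> X h \<in> \<Sigma>) \<and> X \<longlonglongrightarrow> x \<and>
           (\<lambda>h. dil (r h) (hinv x \<odot> X h)) \<longlonglongrightarrow> v}"


section \<open>Hausdorff and spherical measures\<close>

definition ediam :: "('a \<Rightarrow> 'a \<Rightarrow> real) \<Rightarrow> 'a set \<Rightarrow> ennreal" where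
  "ediam d S = (SUP x\<in>S. SUP y\<in>S. ennreal (d x y))"

text \<open>
  The Caratheodory construction with covering family \<open>F\<close> and gauge \<open>c diam(E)^p\<close>, for \<open>p > 0\<close> (for
  \<open>p = 0\<close> the value \<open>0 ^ 0 = 1\<close> on the empty set would spoil it).
\<close>

definition caratheodory_outer ::
  "('a \<Rightarrow> 'a \<Rightarrow> real) \<Rightarrow> 'a set set \<Rightarrow> real \<Rightarrow> nat \<Rightarrow> 'a set \<Rightarrow> ennreal" where
  "caratheodory_outer d F c p A =
     (SUP \<delta>\<in>{0<..}. INF E\<in>{E :: nat \<Rightarrow> 'a set.
          range E \<subseteq> F \<and> A \<subseteq> (\<Union>j. E j) \<and> (\<forall>j. ediam d (E j) \<le> ennreal \<delta>)}.
        \<Sum>j. ennreal c * ediam d (E j) ^ p)"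

text \<open>
  Both outer measures below are metric outer measures, hence countably additive on Borel sets. The
  constant \<open>unit_ball_vol p / 2 ^ p\<close> normalizes the Hausdorff measure to agree with Lebesgue measure on
  \<open>p\<close>-dimensional subspaces.
\<close>

definition hausdorff_measure :: "nat \<Rightarrow> 'a::euclidean_space measure" where
  "hausdorff_measure p =
     measure_of UNIV (sets borel) (caratheodory_outer dist UNIV (unit_ball_vol (real p) / 2 ^ p) p)"

definition spherical_measure ::
  "('n::finite heis \<Rightarrow> 'n heis \<Rightarrow> real) \<Rightarrow> nat \<Rightarrow> 'n heis measure" where
  "spherical_measure d \<alpha> =
     measure_of UNIV (sets borel)
       (caratheodory_outer d {hball d x r |x r. r > 0} (1 / 2 ^ \<alpha>) \<alpha>)"

definition spherical_factor ::
  "('n::finite heis \<Rightarrow> 'n heis \<Rightarrow> real) \<Rightarrow> 'n heis set \<Rightarrow> ennreal" where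
  "spherical_factor d P =
     (SUP z\<in>hball d 0 1. emeasure (hausdorff_measure (dim P)) (P \<inter> hball d z 1))"

end

theory Submission
  imports Defs
begin

text \<open>
  The measure on the left is the image under the graph map of a measure with continuous density on an open
  subset of \<open>W\<close>. By differentiation of measures it suffices to show that its upper density with respect to all
  small closed balls \<open>B(y, r)\<close> containing \<open>x\<close>, normalized by \<open>r\<close> to the power \<open>2n + 2 - k\<close>, is the spherical
  factor of the tangent cone. Translating \<open>x\<close> to the origin and applying the dilation by \<open>1/r\<close> preserves Lebesgue
  measure on \<open>W\<close> up to exactly this power of \<open>r\<close>, and turns the graph of \<open>\<phi>\<close> into a graph that converges pointwise
  to the graph of the intrinsic derivative of \<open>\<phi>\<close>, that is, to the kernel of \<open>Df(x)\<close>. The two Fatou lemmas then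
  give the density, and a determinant computation identifies the weight
  \<open>\<parallel>V \<and> N\<parallel> J\<^sub>H f / J\<^sub>V f\<close> with the Jacobian of the projection of \<open>W\<close> onto this kernel along \<open>V\<close>. Only
  finiteness and translation invariance of the Hausdorff measure on subspaces are used, since its
  normalization enters both sides in the same way.
\<close>

hide_const (open) Order.top

section \<open>Caratheodory construction for metric outer measures\<close>

text \<open>The balls that compete in the spherical measure need not be centred on the set they
  cover, so densities must run over all small balls containing a point; this is why the spherical
  factor maximizes over centres in the unit ball. Lower density bounds go through a Vitali selection
  with enlarged balls, and since the enlarged balls are not controlled by the measure, they are
  charged to a tail of the series of r^p over the selected balls. The blow-up is parametrized by
  left translations acting on W, so the change of variables is exact at every scale, and only the
  weight and the V-factor of the graph vary. The two Fatou arguments are not symmetric. The upper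
  one needs a common majorant and a convergent subsequence of rescaled centres. In the lower one,
  boundary points of the limit ball may be approached from outside, so slightly larger balls are
  used and the excess is absorbed by a strict inequality. The premeasure at a fixed size is
  separated from its supremum because covering arguments take place at one size at a time.\<close>

definition caratheodory_pre ::
  "('a \<Rightarrow> 'a \<Rightarrow> real) \<Rightarrow> 'a set set \<Rightarrow> real \<Rightarrow> nat \<Rightarrow> real \<Rightarrow> 'a set \<Rightarrow> ennreal" where
  "caratheodory_pre d F c p \<delta> A =
     (INF E\<in>{E :: nat \<Rightarrow> 'a set. range E \<subseteq> F \<and> A \<subseteq> (\<Union>j. E j) \<and> (\<forall>j. ediam d (E j) \<le> ennreal \<delta>)}.
        \<Sum>j. ennreal c * ediam d (E j) ^ p)"

lemma caratheodory_outer_eq_SUP_pre: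
  "caratheodory_outer d F c p A = (SUP \<delta>\<in>{0<..}. caratheodory_pre d F c p \<delta> A)"
  by (simp add: caratheodory_outer_def caratheodory_pre_def)

lemma caratheodory_pre_le_outer:
  "\<delta> > 0 \<Longrightarrow> caratheodory_pre d F c p \<delta> A \<le> caratheodory_outer d F c p A"
  unfolding caratheodory_outer_eq_SUP_pre by (rule SUP_upper) simp

lemma caratheodory_pre_mono:
  "A \<subseteq> B \<Longrightarrow> caratheodory_pre d F c p \<delta> A \<le> caratheodory_pre d F c p \<delta> B"
  unfolding caratheodory_pre_def by (rule INF_superset_mono) auto

lemma caratheodory_pre_antimono:
  assumes "\<delta> \<le> \<delta>'"
  shows "caratheodory_pre d F c p \<delta>' A \<le> caratheodory_pre d F c p \<delta> A"
  unfolding caratheodory_pre_def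
  using ennreal_leI[OF assms] by (intro INF_superset_mono) (auto intro: order_trans)

lemma caratheodory_outer_mono:
  "A \<subseteq> B \<Longrightarrow> caratheodory_outer d F c p A \<le> caratheodory_outer d F c p B"
  unfolding caratheodory_outer_eq_SUP_pre by (intro SUP_mono) (auto intro: caratheodory_pre_mono)

lemma caratheodory_pre_lessD:
  assumes "caratheodory_pre d F c p \<delta> A < t"
  obtains E :: "nat \<Rightarrow> 'a set" where "range E \<subseteq> F" "A \<subseteq> (\<Union>j. E j)"
    "\<And>j. ediam d (E j) \<le> ennreal \<delta>" "(\<Sum>j. ennreal c * ediam d (E j) ^ p) < t"
  using assms unfolding caratheodory_pre_def INF_less_iff by auto

lemma ennreal_suminf_tail_less:
  fixes f :: "nat \<Rightarrow> ennreal"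
  assumes "(\<Sum>k. f k) \<noteq> top" "e > 0"
  shows "\<exists>n. (\<Sum>k. f (k + n)) < ennreal e"
proof -
  have "f k \<noteq> top" for k
    using ennreal_suminf_lessD[of f top k] assms(1) by (auto simp: less_top)
  define g where "g = (\<lambda>k. enn2real (f k))"
  have g: "\<And>k. g k \<ge> 0" "f = (\<lambda>k. ennreal (g k))"
    using \<open>\<And>k. f k \<noteq> top\<close> by (auto simp: g_def less_top)
  have "summable g" using assms g by (auto intro: summable_suminf_not_top)
  then obtain n where n: "\<bar>\<Sum>k. g (k + n)\<bar> < e"
    using suminf_exist_split[OF assms(2), of g] by (auto simp: real_norm_def)
  have "(\<Sum>k. f (k + n)) = ennreal (\<Sum>k. g (k + n))"
    using g \<open>summable g\<close> by (simp add: suminf_ennreal2 summable_ignore_initial_segment)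
  then show ?thesis using n by (auto intro!: exI[of _ n] ennreal_lessI simp: assms)
qed

lemma ediam_le: "(\<And>x y. x \<in> S \<Longrightarrow> y \<in> S \<Longrightarrow> ennreal (d x y) \<le> t) \<Longrightarrow> ediam d S \<le> t"
  by (simp add: ediam_def SUP_le_iff)

lemma le_ediam: "x \<in> S \<Longrightarrow> y \<in> S \<Longrightarrow> ennreal (d x y) \<le> ediam d S"
  unfolding ediam_def by (rule SUP_upper2[of x], assumption, rule SUP_upper)

lemma ediam_empty [simp]: "ediam d {} = 0"
  by (simp add: ediam_def bot_ennreal)

text \<open>Covers both the Hausdorff measure, where every set is admissible, and the spherical
  measure, where only balls are. Covers are sequences, so finite and countable families have to be
  padded; \<open>small_members\<close> supplies the padding when the empty set is not in
  \<open>F\<close>. Borel sets refer to the topology of the type, and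
  \<open>open_contains_ball\<close> ties it to \<open>d\<close>: a point outside a closed set has
  positive \<open>d\<close>-distance from it.\<close>

locale gauge =
  fixes d :: "'a::topological_space \<Rightarrow> 'a \<Rightarrow> real" and F :: "'a set set" and c :: real and p :: nat
  assumes metric: "Metric_space UNIV d"
    and p_pos: "p > 0"
    and small_members: "\<And>e. e > 0 \<Longrightarrow> \<exists>E\<in>F. ediam d E \<le> ennreal e"
    and open_contains_ball: "\<And>S x. open S \<Longrightarrow> x \<in> S \<Longrightarrow> \<exists>e>0. \<forall>y. d x y < e \<longrightarrow> y \<in> S"
begin

sublocale Metric_space UNIV d by (rule metric)

abbreviation "pre \<equiv> caratheodory_pre d F c p"
abbreviation "outer \<equiv> caratheodory_outer d F c p"
abbreviation "cost E \<equiv> ennreal c * ediam d E ^ p"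

lemma cheap_members:
  assumes "e > 0" "\<delta> > 0"
  shows "\<exists>E\<in>F. ediam d E \<le> ennreal \<delta> \<and> cost E \<le> ennreal e"
proof -
  \<comment> \<open>The cap r \<le> 1 gives r^p \<le> r, because p > 0.\<close>
  define r where "r = min \<delta> (min 1 (e / (\<bar>c\<bar> + 1)))"
  have r: "r > 0" "r \<le> \<delta>" "r \<le> 1" "r \<le> e / (\<bar>c\<bar> + 1)" using assms by (auto simp: r_def)
  obtain E where E: "E \<in> F" "ediam d E \<le> ennreal r" using small_members r(1) by blast
  have "r ^ p \<le> r" using r p_pos power_decreasing[of 1 p r] by simp
  have "cost E \<le> ennreal \<bar>c\<bar> * ennreal r ^ p"
    using E(2) by (intro mult_mono power_mono ennreal_leI) auto
  also have "\<dots> = ennreal (\<bar>c\<bar> * r ^ p)" using r by (simp add: ennreal_mult ennreal_power)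
  also have "\<dots> \<le> ennreal e"
  proof (rule ennreal_leI)
    have "\<bar>c\<bar> * r ^ p \<le> (\<bar>c\<bar> + 1) * r" using \<open>r ^ p \<le> r\<close> r by (intro mult_mono) auto
    also have "\<dots> \<le> e" using r(4) by (simp add: field_simps)
    finally show "\<bar>c\<bar> * r ^ p \<le> e" .
  qed
  finally show ?thesis using E r by (meson ennreal_leI order_trans)
qed

text \<open>Any countable index set may replace the natural numbers: the missing indices are filled
  with members whose total cost is at most e, by a geometric series.\<close>

lemma pre_le_count_space:
  assumes I: "countable I" and E: "\<And>i. i \<in> I \<Longrightarrow> E i \<in> F" "A \<subseteq> (\<Union>i\<in>I. E i)"
    "\<And>i. i \<in> I \<Longrightarrow> ediam d (E i) \<le> ennreal \<delta>" and \<delta>: "\<delta> > 0"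
  shows "pre \<delta> A \<le> (\<integral>\<^sup>+i. cost (E i) \<partial>count_space I)"
proof (rule ennreal_le_epsilon)
  fix e :: real assume e: "e > 0"
  have "\<exists>T\<in>F. ediam d T \<le> ennreal \<delta> \<and> cost T \<le> ennreal (e * (1/2)^(Suc j))" for j
    using e \<delta> by (intro cheap_members) auto
  then obtain T where T: "\<And>j. T j \<in> F" "\<And>j. ediam d (T j) \<le> ennreal \<delta>"
      "\<And>j. cost (T j) \<le> ennreal (e * (1/2)^(Suc j))" by metis
  let ?N = "to_nat_on I ` I"
  define E' where "E' j = (if j \<in> ?N then E (from_nat_into I j) else T j)" for j
  have fn: "from_nat_into I j \<in> I" if "j \<in> ?N" for j using that I by auto
  have "range E' \<subseteq> F" using fn E T by (auto simp: E'_def)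
  moreover have "A \<subseteq> (\<Union>j. E' j)"
  proof
    fix x assume "x \<in> A"
    then obtain i where "i \<in> I" "x \<in> E i" using E by auto
    then have "x \<in> E' (to_nat_on I i)" using I by (simp add: E'_def)
    then show "x \<in> (\<Union>j. E' j)" by blast
  qed
  moreover have "\<forall>j. ediam d (E' j) \<le> ennreal \<delta>" using fn E T by (auto simp: E'_def)
  ultimately have "pre \<delta> A \<le> (\<Sum>j. cost (E' j))"
    unfolding caratheodory_pre_def by (intro INF_lower) auto
  also have "\<dots> \<le> (\<Sum>j. cost (E (from_nat_into I j)) * indicator ?N j + ennreal (e * (1/2)^(Suc j)))"
    using T by (intro suminf_le) (auto simp: E'_def)
  also have "\<dots> = (\<Sum>j. cost (E (from_nat_into I j)) * indicator ?N j) + (\<Sum>j. ennreal (e * (1/2)^(Suc j)))"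
    by (rule suminf_add[symmetric]) auto
  also have "(\<Sum>j. ennreal (e * (1/2)^(Suc j))) = ennreal e"
    using sums_mult[OF power_half_series, of e] e by (intro suminf_ennreal_eq) auto
  also have "(\<Sum>j. cost (E (from_nat_into I j)) * indicator ?N j)
      = (\<integral>\<^sup>+j. cost (E (from_nat_into I j)) \<partial>count_space ?N)"
    by (simp add: nn_integral_count_space_nat[symmetric] nn_integral_count_space_indicator)
  also have "\<dots> = (\<integral>\<^sup>+i. cost (E (from_nat_into I (to_nat_on I i))) \<partial>count_space I)"
    using I by (intro nn_integral_bij_count_space[symmetric]) (simp add: inj_on_imp_bij_betw inj_on_to_nat_on)
  also have "\<dots> = (\<integral>\<^sup>+i. cost (E i) \<partial>count_space I)"
    using I by (intro nn_integral_cong) simp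
  finally show "pre \<delta> A \<le> (\<integral>\<^sup>+i. cost (E i) \<partial>count_space I) + ennreal e" .
qed

lemma pre_empty: "\<delta> > 0 \<Longrightarrow> pre \<delta> {} = 0"
  using pre_le_count_space[of "{} :: nat set" "\<lambda>_. {}" "{}" \<delta>] by simp

lemma outer_empty: "outer {} = 0"
  unfolding caratheodory_outer_eq_SUP_pre using pre_empty
  by (metis SUP_least greaterThan_iff le_zero_eq order_refl)

lemma pre_countably_subadditive:
  assumes \<delta>: "\<delta> > 0"
  shows "pre \<delta> (\<Union>i. A i) \<le> (\<Sum>i. pre \<delta> (A i))"
proof (cases "(\<Sum>i. pre \<delta> (A i)) = top")
  case False
  then have fin: "pre \<delta> (A i) < top" for i
    using sum_le_suminf[of "\<lambda>i. pre \<delta> (A i)" "{i}"] by (auto simp: less_top top_unique)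
  show ?thesis
  proof (rule ennreal_le_epsilon)
    fix e :: real assume e: "e > 0"
    have "\<exists>E :: nat \<Rightarrow> 'a set. range E \<subseteq> F \<and> A i \<subseteq> (\<Union>j. E j) \<and> (\<forall>j. ediam d (E j) \<le> ennreal \<delta>) \<and>
      (\<Sum>j. cost (E j)) < pre \<delta> (A i) + ennreal (e * (1/2)^(Suc i))" for i
    proof -
      have "pre \<delta> (A i) + 0 < pre \<delta> (A i) + ennreal (e * (1/2)^(Suc i))"
        using fin[of i] e by (subst ennreal_add_left_cancel_less) auto
      then have "pre \<delta> (A i) < pre \<delta> (A i) + ennreal (e * (1/2)^(Suc i))" by simp
      from caratheodory_pre_lessD[OF this] show ?thesis by metis
    qed
    then obtain E :: "nat \<Rightarrow> nat \<Rightarrow> 'a set" where E: "\<And>i. range (E i) \<subseteq> F" "\<And>i. A i \<subseteq> (\<Union>j. E i j)"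
      "\<And>i j. ediam d (E i j) \<le> ennreal \<delta>"
      "\<And>i. (\<Sum>j. cost (E i j)) < pre \<delta> (A i) + ennreal (e * (1/2)^(Suc i))" by metis
    have "pre \<delta> (\<Union>i. A i) \<le> (\<integral>\<^sup>+ij. cost (E (fst ij) (snd ij)) \<partial>count_space UNIV)"
    proof (rule pre_le_count_space)
      show "(\<Union>i. A i) \<subseteq> (\<Union>ij. E (fst ij) (snd ij))" using E(2) by fastforce
    qed (use E(1,3) \<delta> in auto)
    also have "\<dots> = (\<Sum>i. \<Sum>j. cost (E i j))"
      using nn_integral_fst_count_space[of "\<lambda>ij. cost (E (fst ij) (snd ij))"]
      by (simp add: nn_integral_count_space_nat)
    also have "\<dots> \<le> (\<Sum>i. pre \<delta> (A i) + ennreal (e * (1/2)^(Suc i)))"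
      using E by (intro suminf_le) (auto intro: less_imp_le)
    also have "\<dots> = (\<Sum>i. pre \<delta> (A i)) + (\<Sum>i. ennreal (e * (1/2)^(Suc i)))"
      by (rule suminf_add[symmetric]) auto
    also have "(\<Sum>j. ennreal (e * (1/2)^(Suc j))) = ennreal e"
      using sums_mult[OF power_half_series, of e] e by (intro suminf_ennreal_eq) auto
    finally show "pre \<delta> (\<Union>i. A i) \<le> (\<Sum>i. pre \<delta> (A i)) + ennreal e" .
  qed
qed simp

lemma outer_countably_subadditive: "outer (\<Union>i. A i) \<le> (\<Sum>i. outer (A i))"
proof -
  have "pre \<delta> (\<Union>i. A i) \<le> (\<Sum>i. outer (A i))" if "\<delta> > 0" for \<delta>
    using pre_countably_subadditive[OF that, of A] caratheodory_pre_le_outer[OF that]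
    by (meson order_trans suminf_le summableI)
  then show ?thesis by (auto simp: caratheodory_outer_eq_SUP_pre SUP_le_iff)
qed

lemma outer_measure_space_outer: "outer_measure_space (Pow UNIV) outer"
  unfolding outer_measure_space_def
proof (intro conjI)
  show "positive (Pow UNIV) outer" by (simp add: positive_def outer_empty)
  show "increasing (Pow UNIV) outer" by (simp add: increasing_def caratheodory_outer_mono)
  show "countably_subadditive (Pow UNIV) outer"
    by (simp add: countably_subadditive_def outer_countably_subadditive)
qed

lemma outer_Un_le: "outer (A \<union> B) \<le> outer A + outer B"
proof -
  let ?S = "\<lambda>i::nat. if i = 0 then A else if i = 1 then B else {}"
  have "(\<Union>i. ?S i) = A \<union> B" by (auto split: if_splits)
  moreover have "(\<Sum>i. outer (?S i)) = outer A + outer B"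
    by (subst suminf_finite[of "{0,1}"]) (auto simp: outer_empty)
  ultimately show ?thesis using outer_countably_subadditive[of ?S] by simp
qed

text \<open>Covering sets of diameter below \<eta> meet at most one of \<open>A\<close> and
  \<open>B\<close>, so a cover of the union splits into two covers with disjoint sets of
  indices.\<close>

lemma outer_Un_separated:
  assumes \<eta>: "\<eta> > 0" and sep: "\<And>a b. a \<in> A \<Longrightarrow> b \<in> B \<Longrightarrow> \<eta> \<le> d a b"
  shows "outer A + outer B \<le> outer (A \<union> B)"
proof -
  have le: "pre \<delta> A + pre \<delta> B \<le> outer (A \<union> B)" if \<delta>: "0 < \<delta>" "\<delta> < \<eta>" for \<delta>
  proof -
    have "pre \<delta> A + pre \<delta> B \<le> pre \<delta> (A \<union> B)"
      unfolding caratheodory_pre_def[of _ _ _ _ _ "A \<union> B"]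
    proof (intro INF_greatest)
      fix E :: "nat \<Rightarrow> 'a set"
      assume "E \<in> {E. range E \<subseteq> F \<and> A \<union> B \<subseteq> (\<Union>j. E j) \<and> (\<forall>j. ediam d (E j) \<le> ennreal \<delta>)}"
      then have E: "\<And>j. E j \<in> F" "A \<union> B \<subseteq> (\<Union>j. E j)" "\<And>j. ediam d (E j) \<le> ennreal \<delta>" by auto
      define IA where "IA = {j. E j \<inter> A \<noteq> {}}"
      define IB where "IB = {j. E j \<inter> B \<noteq> {}}"
      have "IA \<inter> IB = {}"
      proof (rule ccontr)
        assume "IA \<inter> IB \<noteq> {}"
        then obtain j a b where "a \<in> E j" "a \<in> A" "b \<in> E j" "b \<in> B" by (auto simp: IA_def IB_def)
        then have "ennreal \<eta> \<le> ennreal \<delta>"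
          using sep[of a b] le_ediam[of a "E j" b d] E(3)[of j] by (meson ennreal_leI order_trans)
        then show False using \<delta> by (simp add: ennreal_le_iff)
      qed
      have "pre \<delta> A \<le> (\<integral>\<^sup>+i. cost (E i) \<partial>count_space IA)"
        using E \<delta> by (intro pre_le_count_space) (auto simp: IA_def, blast)
      moreover have "pre \<delta> B \<le> (\<integral>\<^sup>+i. cost (E i) \<partial>count_space IB)"
        using E \<delta> by (intro pre_le_count_space) (auto simp: IB_def, blast)
      ultimately have "pre \<delta> A + pre \<delta> B \<le>
          (\<Sum>j. cost (E j) * indicator IA j) + (\<Sum>j. cost (E j) * indicator IB j)"
        by (simp add: nn_integral_count_space_nat[symmetric] nn_integral_count_space_indicator add_mono)
      also have "\<dots> = (\<Sum>j. cost (E j) * indicator IA j + cost (E j) * indicator IB j)"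
        by (rule suminf_add) auto
      also have "\<dots> \<le> (\<Sum>j. cost (E j))"
        using \<open>IA \<inter> IB = {}\<close> by (intro suminf_le) (auto simp: indicator_def)
      finally show "pre \<delta> A + pre \<delta> B \<le> (\<Sum>j. cost (E j))" .
    qed
    also have "\<dots> \<le> outer (A \<union> B)" by (rule caratheodory_pre_le_outer[OF \<delta>(1)])
    finally show ?thesis .
  qed
  \<comment> \<open>The two suprema over sizes are taken one after the other, so the sizes must be
    independent; both are lowered to a common one below \<eta>.\<close>
  have le2: "pre \<delta>1 A + pre \<delta>2 B \<le> outer (A \<union> B)" if "\<delta>1 > 0" "\<delta>2 > 0" for \<delta>1 \<delta>2
  proof -
    let ?m = "min (min \<delta>1 \<delta>2) (\<eta>/2)"
    have "pre \<delta>1 A + pre \<delta>2 B \<le> pre ?m A + pre ?m B"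
      by (intro add_mono caratheodory_pre_antimono) auto
    also have "\<dots> \<le> outer (A \<union> B)" using that \<eta> by (intro le) auto
    finally show ?thesis .
  qed
  have "pre \<delta>1 A + outer B \<le> outer (A \<union> B)" if "\<delta>1 > 0" for \<delta>1
    unfolding caratheodory_outer_eq_SUP_pre[of _ _ _ _ B]
    using le2[OF that] by (subst ennreal_SUP_add_right) (auto intro!: SUP_least)
  then have "(SUP \<delta>1\<in>{0<..}. pre \<delta>1 A + outer B) \<le> outer (A \<union> B)"
    by (auto intro!: SUP_least)
  then show ?thesis
    unfolding caratheodory_outer_eq_SUP_pre[of _ _ _ _ A]
    by (subst (asm) ennreal_SUP_add_left) auto
qed

text \<open>Caratheodory's criterion. \<open>X - C\<close> is exhausted by the sets
  \<open>Y n\<close> of points at distance at least 1/(n+1) from \<open>C\<close>, which are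
  separated from \<open>C\<close>. The layers \<open>R n\<close> between consecutive sets have
  summable outer measure, because layers of equal parity are separated from one another; a small
  tail of that series bounds what \<open>Y n\<close> leaves out.\<close>

lemma closed_in_lambda_system:
  assumes C: "closed C"
  shows "C \<in> lambda_system UNIV (Pow UNIV) outer"
proof -
  interpret P: algebra UNIV "Pow UNIV :: 'a set set" by (rule algebra_Pow)
  have "outer (X \<inter> C) + outer (X - C) = outer X" for X
  proof (rule antisym)
    show "outer X \<le> outer (X \<inter> C) + outer (X - C)"
      using outer_Un_le[of "X \<inter> C" "X - C"] by (simp add: Int_Diff_Un)
    show "outer (X \<inter> C) + outer (X - C) \<le> outer X"
    proof (cases "outer X = top")
      case False
      define Y where "Y n = {x \<in> X. \<forall>c\<in>C. 1 / real (Suc n) \<le> d x c}" for n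
      have YC: "Y n \<subseteq> X - C" for n by (force simp: Y_def)
      have Ymono: "Y n \<subseteq> Y (Suc n)" for n
      proof -
        have "1 / real (Suc (Suc n)) \<le> 1 / real (Suc n)" by (simp add: field_simps)
        then show ?thesis by (force simp: Y_def)
      qed
      have Yall: "X - C \<subseteq> (\<Union>n. Y n)"
      proof
        fix x assume x: "x \<in> X - C"
        then obtain e where e: "e > 0" "\<And>y. d x y < e \<Longrightarrow> y \<in> - C"
          using open_contains_ball[of "- C" x] C by auto
        obtain n where "inverse (real (Suc n)) < e" using reals_Archimedean[OF e(1)] by blast
        moreover have "e \<le> d x c" if "c \<in> C" for c using e(2)[of c] that by force
        ultimately have "x \<in> Y n" using x by (force simp: Y_def inverse_eq_divide)
        then show "x \<in> (\<Union>n. Y n)" by blast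
      qed
      define R where "R n = Y (Suc n) - Y n" for n
      \<comment> \<open>A point outside \<open>Y l\<close> has a point of \<open>C\<close> within
        1/(l+1), while x stays 1/(k+2) away from \<open>C\<close>. The bound is positive once l > k
        + 1, which is why every second layer is used.\<close>
      have sep: "1 / real (k+2) - 1 / real (l+1) \<le> d x y" if xy: "x \<in> Y (Suc k)" "y \<in> X - Y l" for x y k l
      proof -
        obtain c where "c \<in> C" "d y c < 1 / real (l+1)" using xy by (auto simp: Y_def not_le add.commute)
        moreover from this xy have "1 / real (k+2) \<le> d x c" by (auto simp: Y_def)
        ultimately show ?thesis using triangle[of x y c] by simp
      qed
      have RX: "R n \<subseteq> X" for n by (auto simp: R_def Y_def)
      have Ym: "Y a \<subseteq> Y b" if "a \<le> b" for a b using lift_Suc_mono_le[of Y, OF Ymono that] .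
      have sum_le: "(\<Sum>k<N. outer (R (2*k+s))) \<le> outer (\<Union>k<N. R (2*k+s))" for N s
      proof (induction N)
        case (Suc N)
        have "outer (\<Union>k<N. R (2*k+s)) + outer (R (2*N+s)) \<le> outer ((\<Union>k<N. R (2*k+s)) \<union> R (2*N+s))"
        proof (rule outer_Un_separated)
          \<comment> \<open>For N = 0 the union is empty and the formula need not be positive (it
            contains 1/0 when s = 0), so 1 stands in for it.\<close>
          let ?\<eta> = "1 / real (2*N+s) - 1 / real (2*N+s+1)"
          have "1 / real (a + 1) < 1 / real a" if "a > 0" for a :: nat
            using that by (simp add: field_simps)
          from this[of "2*N+s"] show "(if N = 0 then 1 else ?\<eta>) > 0" by auto
          fix a b assume a: "a \<in> (\<Union>k<N. R (2*k+s))" and b: "b \<in> R (2*N+s)"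
          from a have N: "N > 0" by auto
          from a obtain k where "k < N" "a \<in> Y (Suc (2*k+s))" by (auto simp: R_def)
          moreover have "Suc (2*k+s) \<le> Suc (2*N+s-2)" using \<open>k < N\<close> by auto
          ultimately have "a \<in> Y (Suc (2*N+s-2))" using Ym by blast
          moreover have "b \<in> X - Y (2*N+s)" using b RX by (auto simp: R_def)
          moreover have "2*N+s-2+2 = 2*N+s" using N by simp
          ultimately have "?\<eta> \<le> d a b" using sep by metis
          then show "(if N = 0 then 1 else ?\<eta>) \<le> d a b" using N by simp
        qed
        then show ?case using Suc
          by (simp add: lessThan_Suc Un_commute add.commute) (meson add_mono order_refl order_trans)
      qed (simp add: outer_empty)
      have sum_le': "(\<Sum>k<N. outer (R (2*k+s))) \<le> outer X" for N s
      proof -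
        have "(\<Sum>k<N. outer (R (2*k+s))) \<le> outer (\<Union>k<N. R (2*k+s))" by (rule sum_le)
        also have "\<dots> \<le> outer X" using RX by (intro caratheodory_outer_mono) auto
        finally show ?thesis .
      qed
      have "(\<Sum>k. outer (R k)) \<le> 2 * outer X"
      proof (rule suminf_le_const[OF summableI])
        fix N
        have "(\<Sum>k<N. outer (R k)) \<le> (\<Sum>k<2*N. outer (R k))" by (rule sum_mono2) auto
        also have "\<dots> = (\<Sum>k<N. outer (R (2*k+0))) + (\<Sum>k<N. outer (R (2*k+1)))"
          by (induction N) (auto simp: algebra_simps)
        also have "\<dots> \<le> outer X + outer X" by (intro add_mono sum_le')
        finally show "(\<Sum>k<N. outer (R k)) \<le> 2 * outer X" by (simp add: mult_2)
      qed
      also have "\<dots> < top" using False by (simp add: ennreal_mult_less_top less_top)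
      finally have sumfin: "(\<Sum>k. outer (R k)) \<noteq> top" by simp
      show ?thesis
      proof (rule ennreal_le_epsilon)
        fix e :: real assume "e > 0"
        then obtain n where n: "(\<Sum>k. outer (R (k + n))) < ennreal e"
          using ennreal_suminf_tail_less[OF sumfin] by blast
        have sub: "X - C \<subseteq> Y n \<union> (\<Union>k. R (k + n))"
        proof
          fix x assume "x \<in> X - C"
          then obtain m where "x \<in> Y m" using Yall by auto
          then show "x \<in> Y n \<union> (\<Union>k. R (k + n))"
          proof (induction m)
            case 0 then show ?case using Ym[of 0 n] by auto
          next
            case (Suc m)
            show ?case
            proof (cases "Suc m \<le> n")
              case True then show ?thesis using Suc.prems Ym by blast
            next
              case False
              then have "m = (m - n) + n" by simp
              then show ?thesis using Suc by (cases "x \<in> Y m") (auto simp: R_def, metis)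
            qed
          qed
        qed
        have "outer (X - C) \<le> outer (Y n) + outer (\<Union>k. R (k + n))"
          using caratheodory_outer_mono[OF sub, of d F c p] outer_Un_le order_trans by blast
        also have "outer (\<Union>k. R (k + n)) \<le> ennreal e"
          using outer_countably_subadditive[of "\<lambda>k. R (k + n)"] n by auto
        finally have "outer (X \<inter> C) + outer (X - C) \<le> (outer (X \<inter> C) + outer (Y n)) + ennreal e"
          by (simp add: add.assoc add_mono)
        also have "outer (X \<inter> C) + outer (Y n) \<le> outer ((X \<inter> C) \<union> Y n)"
          by (rule outer_Un_separated[of "1 / real (Suc n)"]) (auto simp: Y_def commute)
        also have "\<dots> \<le> outer X" by (rule caratheodory_outer_mono) (auto simp: Y_def)
        finally show "outer (X \<inter> C) + outer (X - C) \<le> outer X + ennreal e" by simp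
      qed
    qed simp
  qed
  then show ?thesis unfolding P.lambda_system_eq by simp
qed

text \<open>\<open>measure_of\<close> yields the zero measure unless its set function is a measure
  on the given sigma-algebra. Here it is one, because the measurable sets in the sense of
  Caratheodory contain the closed sets and hence the Borel sets.\<close>

lemma emeasure_caratheodory:
  assumes "B \<in> sets borel"
  shows "emeasure (measure_of UNIV (sets borel) outer) B = outer B"
proof -
  interpret P: sigma_algebra UNIV "Pow UNIV :: 'a set set" by (rule sigma_algebra_Pow)
  let ?L = "lambda_system UNIV (Pow UNIV) outer"
  have L: "measure_space UNIV ?L outer"
    by (rule P.caratheodory_lemma[OF outer_measure_space_outer])
  then interpret L: sigma_algebra UNIV ?L by (simp add: measure_space_def)
  have "sigma_sets UNIV (Collect closed) \<subseteq> ?L"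
    by (rule L.sigma_sets_subset) (use closed_in_lambda_system in auto)
  then have "sets (borel :: 'a measure) \<subseteq> ?L"
    unfolding borel_eq_closed by simp
  then have "measure_space UNIV (sets borel) outer"
    using L sets.sigma_algebra_axioms[of "borel :: 'a measure"] by (auto intro: measure_down)
  then show ?thesis
    using assms sets.sigma_sets_eq[of "borel :: 'a measure"]
    by (subst emeasure_measure_of_sigma) (auto simp: measure_space_def)
qed

end

section \<open>Hausdorff outer measures: isometry invariance and finiteness on the unit cube\<close>

lemma gauge_dist:
  assumes "p > 0"
  shows "gauge (dist :: 'a::metric_space \<Rightarrow> 'a \<Rightarrow> real) UNIV p"
proof
  show "\<exists>E\<in>UNIV. ediam dist E \<le> ennreal e" for e :: real
    by (rule bexI[of _ "{}"]) auto
  show "\<exists>e>0. \<forall>y. dist x y < e \<longrightarrow> y \<in> S" if "open S" "x \<in> S" for S and x :: 'a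
    using that unfolding open_dist by (metis dist_commute)
qed (use assms in \<open>auto simp: dist_commute dist_triangle\<close>)

text \<open>Covers are carried along by \<open>g\<close>. Their sets are first cut down to
  \<open>S\<close>, because \<open>g\<close> is controlled only there, and the images are admissible
  because every set is. The two types may differ, which later moves measures from coordinate spaces
  to subspaces.\<close>

lemma caratheodory_outer_isometric_image_le:
  fixes g :: "'a::metric_space \<Rightarrow> 'b::metric_space"
  assumes "\<And>x y. x \<in> S \<Longrightarrow> y \<in> S \<Longrightarrow> dist (g x) (g y) \<le> dist x y"
  shows "caratheodory_outer dist UNIV c p (g ` S) \<le> caratheodory_outer dist UNIV c p S"
  unfolding caratheodory_outer_eq_SUP_pre
proof (rule SUP_mono, rule bexI)
  fix \<delta> :: real
  show "caratheodory_pre dist UNIV c p \<delta> (g ` S) \<le> caratheodory_pre dist UNIV c p \<delta> S"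
    unfolding caratheodory_pre_def
  proof (rule INF_mono)
    fix E :: "nat \<Rightarrow> 'a set"
    assume "E \<in> {E. range E \<subseteq> UNIV \<and> S \<subseteq> (\<Union>j. E j) \<and> (\<forall>j. ediam dist (E j) \<le> ennreal \<delta>)}"
    then have E: "S \<subseteq> (\<Union>j. E j)" "\<And>j. ediam dist (E j) \<le> ennreal \<delta>" by auto
    define E' where "E' j = g ` (E j \<inter> S)" for j
    have le: "ediam dist (E' j) \<le> ediam dist (E j)" for j
    proof (rule ediam_le)
      fix x y assume "x \<in> E' j" "y \<in> E' j"
      then obtain a b where ab: "a \<in> E j" "b \<in> E j" "a \<in> S" "b \<in> S" "x = g a" "y = g b"
        by (auto simp: E'_def)
      have "ennreal (dist x y) \<le> ennreal (dist a b)" unfolding ab(5,6) by (intro ennreal_leI assms ab)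
      also have "\<dots> \<le> ediam dist (E j)" by (intro le_ediam ab)
      finally show "ennreal (dist x y) \<le> ediam dist (E j)" .
    qed
    show "\<exists>E'\<in>{E. range E \<subseteq> UNIV \<and> g ` S \<subseteq> (\<Union>j. E j) \<and> (\<forall>j. ediam dist (E j) \<le> ennreal \<delta>)}.
       (\<Sum>j. ennreal c * ediam dist (E' j) ^ p) \<le> (\<Sum>j. ennreal c * ediam dist (E j) ^ p)"
    proof (rule bexI)
      show "E' \<in> {E. range E \<subseteq> UNIV \<and> g ` S \<subseteq> (\<Union>j. E j) \<and> (\<forall>j. ediam dist (E j) \<le> ennreal \<delta>)}"
        using E le by (fastforce simp: E'_def intro: order_trans)
      show "(\<Sum>j. ennreal c * ediam dist (E' j) ^ p) \<le> (\<Sum>j. ennreal c * ediam dist (E j) ^ p)"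
        using le by (intro suminf_le mult_left_mono power_mono) auto
    qed
  qed
qed

lemma caratheodory_outer_isometric_image:
  fixes g :: "'a::metric_space \<Rightarrow> 'b::metric_space"
  assumes iso: "\<And>x y. x \<in> S \<Longrightarrow> y \<in> S \<Longrightarrow> dist (g x) (g y) = dist x y"
  shows "caratheodory_outer dist UNIV c p (g ` S) = caratheodory_outer dist UNIV c p S"
proof (rule antisym)
  have inj: "inj_on g S"
    by (rule inj_onI) (metis iso dist_eq_0_iff)
  have "caratheodory_outer dist UNIV c p (inv_into S g ` g ` S) \<le> caratheodory_outer dist UNIV c p (g ` S)"
    using inj iso by (intro caratheodory_outer_isometric_image_le) auto
  also have "inv_into S g ` g ` S = S" using inj by auto
  finally show "caratheodory_outer dist UNIV c p S \<le> caratheodory_outer dist UNIV c p (g ` S)" .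
qed (use iso in \<open>auto intro: caratheodory_outer_isometric_image_le\<close>)

text \<open>With p the dimension, a grid of N^p closed cubes of diameter at most p/N costs at most
  |c| p^p in total, whatever N is.\<close>

lemma caratheodory_outer_box_finite:
  fixes c :: real
  shows "caratheodory_outer dist UNIV c DIM('a) (box 0 (One :: 'a::euclidean_space)) < top"
proof -
  let ?p = "DIM('a)"
  interpret gauge "dist :: 'a \<Rightarrow> 'a \<Rightarrow> real" UNIV c ?p by (rule gauge_dist) simp
  have "pre \<delta> (box 0 One) \<le> ennreal \<bar>c\<bar> * ennreal (real ?p ^ ?p)" if \<delta>: "\<delta> > 0" for \<delta>
  proof -
    obtain N :: nat where N: "real ?p / \<delta> < real N" using reals_Archimedean2 by blast
    have N0: "real N > 0" using N \<delta> by (smt (verit) divide_nonneg_pos of_nat_0_le_iff)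
    have pN: "real ?p / real N \<le> \<delta>" using N \<delta> N0 by (simp add: field_simps)
    let ?I = "Basis \<rightarrow>\<^sub>E {..<N} :: ('a \<Rightarrow> nat) set"
    define E where "E k = {x::'a. \<forall>b\<in>Basis. real (k b) / N \<le> x \<bullet> b \<and> x \<bullet> b \<le> (real (k b) + 1) / N}" for k
    have dE: "ediam dist (E k) \<le> ennreal (?p / N)" for k
    proof (rule ediam_le, rule ennreal_leI)
      fix x y assume xy: "x \<in> E k" "y \<in> E k"
      have "dist x y \<le> (\<Sum>b\<in>Basis. \<bar>(x - y) \<bullet> b\<bar>)" unfolding dist_norm by (rule norm_le_l1)
      also have "\<dots> \<le> (\<Sum>b\<in>(Basis::'a set). 1 / N)"
      proof (rule sum_mono)
        fix b :: 'a assume "b \<in> Basis"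
        with xy have "real (k b) / N \<le> x \<bullet> b" "x \<bullet> b \<le> (real (k b) + 1) / N"
           "real (k b) / N \<le> y \<bullet> b" "y \<bullet> b \<le> (real (k b) + 1) / N" by (auto simp: E_def)
        then show "\<bar>(x - y) \<bullet> b\<bar> \<le> 1 / N" by (simp add: inner_diff_left add_divide_distrib)
      qed
      finally show "dist x y \<le> ?p / N" by simp
    qed
    have cov: "box 0 One \<subseteq> (\<Union>k\<in>?I. E k)"
    proof
      fix x :: 'a assume x: "x \<in> box 0 One"
      define k where "k = (\<lambda>b\<in>Basis. nat \<lfloor>N * (x \<bullet> b)\<rfloor>)"
      have xb: "0 < x \<bullet> b" "x \<bullet> b < 1" if "b \<in> Basis" for b using x that by (auto simp: box_def)
      have "x \<in> E k" unfolding E_def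
      proof (clarify, intro conjI)
        fix b :: 'a assume b: "b \<in> Basis"
        have "0 \<le> N * (x \<bullet> b)" using xb[OF b] by simp
        then have "real (k b) \<le> N * (x \<bullet> b)" "N * (x \<bullet> b) \<le> real (k b) + 1"
          using b by (auto simp: k_def)
        then show "real (k b) / N \<le> x \<bullet> b" "x \<bullet> b \<le> (real (k b) + 1) / N"
          using N0 by (auto simp: field_simps)
      qed
      moreover have "k \<in> ?I"
      proof (rule PiE_I)
        fix b :: 'a assume b: "b \<in> Basis"
        have "N * (x \<bullet> b) < N" "0 \<le> N * (x \<bullet> b)" using xb[OF b] N0 by auto
        then show "k b \<in> {..<N}" using b by (simp add: k_def nat_less_iff floor_less_iff)
      qed (simp add: k_def)
      ultimately show "x \<in> (\<Union>k\<in>?I. E k)" by blast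
    qed
    have fin: "finite ?I" by (intro finite_PiE) auto
    have "pre \<delta> (box 0 One) \<le> (\<integral>\<^sup>+k. cost (E k) \<partial>count_space ?I)"
      using cov fin \<delta> order_trans[OF dE ennreal_leI[OF pN]]
      by (intro pre_le_count_space) (auto intro: countable_finite)
    also have "\<dots> \<le> (\<integral>\<^sup>+k. ennreal \<bar>c\<bar> * ennreal (?p / N) ^ ?p \<partial>count_space ?I)"
      using dE by (intro nn_integral_mono mult_mono power_mono ennreal_leI) auto
    also have "\<dots> = of_nat (card ?I) * (ennreal \<bar>c\<bar> * ennreal (?p / N) ^ ?p)"
      using fin by (simp add: nn_integral_count_space_finite mult.commute)
    also have "card ?I = N ^ ?p" by (simp add: card_PiE)
    also have "of_nat (N ^ ?p) * (ennreal \<bar>c\<bar> * ennreal (?p / N) ^ ?p) = ennreal \<bar>c\<bar> * ennreal (real ?p ^ ?p)"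
      using N0 by (simp add: ennreal_of_nat_eq_real_of_nat ennreal_power power_divide flip: ennreal_mult)
    finally show ?thesis .
  qed
  then have "outer (box 0 (One::'a)) \<le> ennreal \<bar>c\<bar> * ennreal (real ?p ^ ?p)"
    unfolding caratheodory_outer_eq_SUP_pre by (auto intro: SUP_least)
  also have "\<dots> < top" by (simp add: ennreal_mult_less_top)
  finally show ?thesis .
qed

section \<open>A measure and its spherical density\<close>

text \<open>The diameter law \<open>ediam_ball\<close> turns the gauge 2^-p diam^p into r^p.
  Continuity of \<open>d y\<close> makes closed balls Borel and the sets d < r open; the sort of the
  type gives outer regularity of finite Borel measures.\<close>

locale ball_metric = Metric_space "UNIV :: 'a set" d
  for d :: "'a::{second_countable_topology, complete_space} \<Rightarrow> 'a \<Rightarrow> real" +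
  fixes p :: nat
  assumes p_pos: "p > 0"
    and open_contains_ball: "\<And>S x. open S \<Longrightarrow> x \<in> S \<Longrightarrow> \<exists>e>0. \<forall>y. d x y < e \<longrightarrow> y \<in> S"
    and continuous_dist_from: "\<And>y. continuous_on UNIV (d y)"
    and ediam_ball: "\<And>x r. r > 0 \<Longrightarrow> ediam d {y. d x y \<le> r} = ennreal (2 * r)"
begin

abbreviation cb :: "'a \<Rightarrow> real \<Rightarrow> 'a set" where "cb x r \<equiv> {y. d x y \<le> r}"

abbreviation "balls \<equiv> {cb x r |x r. r > 0}"

lemma open_mball: "open {x. d y x < r}"
  using continuous_dist_from by (intro open_Collect_less) auto

lemma closed_cb: "closed (cb y r)"
  using continuous_dist_from by (intro closed_Collect_le) auto

lemma cb_borel [measurable]: "cb y r \<in> sets borel"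
  using closed_cb by auto

sublocale gauge d balls "1 / 2 ^ p" p
proof
  show "\<exists>E\<in>balls. ediam d E \<le> ennreal e" if "e > 0" for e :: real
  proof
    show "ediam d (cb undefined (e / 2)) \<le> ennreal e" using that by (subst ediam_ball) auto
    show "cb undefined (e / 2) \<in> balls" using that by (auto intro!: exI[of _ undefined] exI[of _ "e / 2"])
  qed
qed (use p_pos open_contains_ball in \<open>auto intro: commute triangle\<close>)

lemma cost_cb: "r > 0 \<Longrightarrow> cost (cb y r) = ennreal (r ^ p)"
  by (simp add: ediam_ball ennreal_power power_mult_distrib flip: ennreal_mult)

section \<open>Comparison with the outer measure from upper density bounds\<close>

lemma enlarge_ball:
  assumes "ennreal (t * r ^ p) < m" "r < R"
  obtains r' where "r < r'" "r' < R" "ennreal (t * r' ^ p) < m"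
proof -
  have "((\<lambda>s. ennreal (t * s ^ p)) \<longlongrightarrow> ennreal (t * r ^ p)) (at_right r)"
    by (intro tendsto_intros)
  then have "\<forall>\<^sub>F s in at_right r. ennreal (t * s ^ p) < m"
    using assms by (intro order_tendstoD)
  moreover have "\<forall>\<^sub>F s in at_right r. r < s \<and> s < R"
    using assms by (auto simp: eventually_at_right[OF assms(2)])
  ultimately have "\<forall>\<^sub>F s in at_right r. r < s \<and> s < R \<and> ennreal (t * s ^ p) < m"
    by eventually_elim auto
  then show ?thesis using that eventually_happens'[OF trivial_limit_at_right_real] by blast
qed

text \<open>A point of a closed ball may lie on its boundary; a slightly larger radius makes it an
  interior point without losing the strict inequality.\<close>

lemma open_points_of_large_balls:
  assumes M: "sets M = sets borel"
  shows "open {x. \<exists>y r. 0 < r \<and> r < R \<and> d y x \<le> r \<and> ennreal (t * r ^ p) < emeasure M (cb y r)}"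
    (is "open ?G")
proof (rule Topological_Spaces.openI)
  fix x assume "x \<in> ?G"
  then obtain y r where yr: "0 < r" "r < R" "d y x \<le> r" "ennreal (t * r ^ p) < emeasure M (cb y r)"
    by auto
  obtain r' where r': "r < r'" "r' < R" "ennreal (t * r' ^ p) < emeasure M (cb y r)"
    using enlarge_ball yr by blast
  have "emeasure M (cb y r) \<le> emeasure M (cb y r')"
    using r' M by (intro emeasure_mono) auto
  then have big: "ennreal (t * r' ^ p) < emeasure M (cb y r')" using r'(3) by simp
  show "\<exists>T. open T \<and> x \<in> T \<and> T \<subseteq> ?G"
  proof (intro exI[of _ "{x. d y x < r'}"] conjI)
    show "open {x. d y x < r'}" by (rule open_mball)
    show "x \<in> {x. d y x < r'}" using yr r' by simp
    show "{x. d y x < r'} \<subseteq> ?G"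
      using yr r' big by (auto intro!: exI[of _ y] exI[of _ r'])
  qed
qed

text \<open>\<open>C m\<close> collects the points at which the bound holds for all radii below
  1/(m+1), and these sets exhaust \<open>A\<close>. Every ball of a sufficiently fine cover that
  meets A \<inter> C m obeys the bound itself, so summing over the cover is enough.\<close>

lemma measure_le_outer:
  assumes M: "sets M = sets borel" and A: "A \<in> sets borel" and t: "t > 0"
    and upper: "\<And>x. x \<in> A \<Longrightarrow> \<exists>\<delta>>0. \<forall>y r. 0 < r \<and> r < \<delta> \<and> d y x \<le> r \<longrightarrow>
        emeasure M (cb y r) \<le> ennreal (t * r ^ p)"
  shows "emeasure M A \<le> ennreal t * outer A"
proof -
  define C where "C m = - {x. \<exists>y r. 0 < r \<and> r < 1 / real (Suc m) \<and> d y x \<le> r \<and>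
      ennreal (t * r ^ p) < emeasure M (cb y r)}" for m
  have C: "closed (C m)" for m
    unfolding C_def using open_points_of_large_balls[OF M] by (simp add: closed_def)
  have ACm: "A \<inter> C m \<in> sets M" for m using A C M by auto
  have "mono C"
  proof (rule monoI)
    fix m n :: nat assume "m \<le> n"
    then have "1 / real (Suc n) \<le> 1 / real (Suc m)" by (simp add: field_simps)
    then show "C m \<subseteq> C n" unfolding C_def by fastforce
  qed
  then have inc: "incseq (\<lambda>m. A \<inter> C m)" unfolding mono_def by blast
  have A_eq: "A = (\<Union>m. A \<inter> C m)"
  proof
    show "A \<subseteq> (\<Union>m. A \<inter> C m)"
    proof
      fix x assume x: "x \<in> A"
      then obtain \<delta> where \<delta>: "\<delta> > 0" "\<And>y r. 0 < r \<Longrightarrow> r < \<delta> \<Longrightarrow> d y x \<le> r \<Longrightarrow>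
          emeasure M (cb y r) \<le> ennreal (t * r ^ p)" using upper by metis
      obtain m where "inverse (real (Suc m)) < \<delta>" using reals_Archimedean[OF \<delta>(1)] by blast
      then have m: "1 / real (Suc m) < \<delta>" by (simp add: inverse_eq_divide)
      have "\<not> ennreal (t * r ^ p) < emeasure M (cb y r)"
        if "0 < r" "r < 1 / real (Suc m)" "d y x \<le> r" for y r
        using \<delta>(2)[OF that(1) less_trans[OF that(2) m] that(3)] by simp
      then have "x \<in> C m" unfolding C_def by blast
      then show "x \<in> (\<Union>m. A \<inter> C m)" using x by blast
    qed
  qed auto
  have le: "emeasure M (A \<inter> C m) \<le> ennreal t * outer A" for m
  proof -
    let ?\<delta> = "1 / real (Suc m)"
    have "ennreal (1 / t) * emeasure M (A \<inter> C m) \<le> caratheodory_pre d balls (1 / 2 ^ p) p ?\<delta> (A \<inter> C m)"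
      unfolding caratheodory_pre_def
    proof (rule INF_greatest)
      fix E :: "nat \<Rightarrow> 'a set"
      assume "E \<in> {E. range E \<subseteq> balls \<and> A \<inter> C m \<subseteq> (\<Union>j. E j) \<and> (\<forall>j. ediam d (E j) \<le> ennreal ?\<delta>)}"
      then have E: "\<And>j. E j \<in> balls" "A \<inter> C m \<subseteq> (\<Union>j. E j)" "\<And>j. ediam d (E j) \<le> ennreal ?\<delta>" by blast+
      have Em: "E j \<in> sets M" for j using E(1)[of j] M by auto
      have j: "emeasure M (E j \<inter> (A \<inter> C m)) \<le> ennreal t * cost (E j)" for j
      proof (cases "E j \<inter> (A \<inter> C m) = {}")
        case False
        then obtain x where x: "x \<in> E j" "x \<in> C m" by auto
        obtain y r where yr: "E j = cb y r" "r > 0" using E(1)[of j] by auto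
        \<comment> \<open>The size bound controls the diameter 2r, which leaves room for the strict
          inequality on r.\<close>
        have "2 * r \<le> ?\<delta>" using E(3)[of j] yr by (simp add: ediam_ball ennreal_le_iff)
        then have "r < ?\<delta>" using yr by simp
        moreover have "\<forall>y r. 0 < r \<and> r < ?\<delta> \<and> d y x \<le> r \<longrightarrow> \<not> ennreal (t * r ^ p) < emeasure M (cb y r)"
          using x(2) unfolding C_def by blast
        ultimately have "emeasure M (E j) \<le> ennreal (t * r ^ p)"
          using x(1) yr by (metis mem_Collect_eq not_less)
        also have "\<dots> = ennreal t * cost (E j)"
          using yr t by (simp only: cost_cb ennreal_mult less_imp_le zero_le_power)
        finally show ?thesis using emeasure_mono[of "E j \<inter> (A \<inter> C m)" "E j" M] Em by auto
      qed simp
      have "emeasure M (A \<inter> C m) = emeasure M (\<Union>j. E j \<inter> (A \<inter> C m))"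
        using E(2) by (intro arg_cong[of _ _ "emeasure M"]) blast
      also have "\<dots> \<le> (\<Sum>j. emeasure M (E j \<inter> (A \<inter> C m)))"
        using Em ACm by (intro emeasure_subadditive_countably) auto
      also have "\<dots> \<le> (\<Sum>j. ennreal t * cost (E j))" using j by (intro suminf_le) auto
      finally have "ennreal (1/t) * emeasure M (A \<inter> C m) \<le> ennreal (1/t) * (ennreal t * (\<Sum>j. cost (E j)))"
        by (intro mult_left_mono) auto
      also have "\<dots> = (\<Sum>j. cost (E j))"
        using t by (simp add: mult.assoc[symmetric] ennreal_mult[symmetric] del: ennreal_suminf_cmult)
      finally show "ennreal (1/t) * emeasure M (A \<inter> C m) \<le> (\<Sum>j. cost (E j))" .
    qed
    also have "\<dots> \<le> outer (A \<inter> C m)" by (rule caratheodory_pre_le_outer) simp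
    also have "\<dots> \<le> outer A" by (rule caratheodory_outer_mono) auto
    finally have "ennreal t * (ennreal (1 / t) * emeasure M (A \<inter> C m)) \<le> ennreal t * outer A"
      by (rule mult_left_mono) simp
    then show ?thesis using t by (simp add: mult.assoc[symmetric] ennreal_mult[symmetric])
  qed
  have "emeasure M A = (SUP m. emeasure M (A \<inter> C m))"
    using ACm inc by (subst A_eq, intro SUP_emeasure_incseq[symmetric]) auto
  then show ?thesis using le by (simp add: SUP_least)
qed

text \<open>Zorn's lemma is applied to the disjoint families with the property that a ball of
  \<open>K\<close> meeting some member meets a member of at least half its radius; unions of chains
  keep it. If a maximal family missed a ball, a missed ball with radius above half the supremum of
  the missed radii could be added. Pairs of centre and radius are used because a ball, as a set,
  need not determine them.\<close>

lemma Vitali_disjoint_subfamily: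
  fixes K :: "('a \<times> real) set"
  assumes K: "\<And>y r. (y, r) \<in> K \<Longrightarrow> 0 < r \<and> r \<le> R"
  obtains G where "G \<subseteq> K" "disjoint_family_on (\<lambda>(y, r). cb y r) G"
    "\<And>y r. (y, r) \<in> K \<Longrightarrow> \<exists>(y', r')\<in>G. cb y r \<inter> cb y' r' \<noteq> {} \<and> r \<le> 2 * r'"
proof -
  let ?B = "\<lambda>(y, r). cb y r"
  define Q where "Q = {G. G \<subseteq> K \<and> disjoint_family_on ?B G \<and>
    (\<forall>b\<in>K. (\<exists>g\<in>G. ?B b \<inter> ?B g \<noteq> {}) \<longrightarrow> (\<exists>g\<in>G. ?B b \<inter> ?B g \<noteq> {} \<and> snd b \<le> 2 * snd g))}"
  have "\<exists>G\<in>Q. \<forall>X\<in>Q. G \<subseteq> X \<longrightarrow> X = G"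
  proof (rule subset_Zorn_nonempty)
    show "Q \<noteq> {}" by (auto simp: Q_def disjoint_family_on_def intro!: exI[of _ "{}"])
    fix \<C> assume \<C>: "\<C> \<noteq> {}" "subset.chain Q \<C>"
    then have sub: "\<C> \<subseteq> Q" and tot: "\<And>X Y. X \<in> \<C> \<Longrightarrow> Y \<in> \<C> \<Longrightarrow> X \<subseteq> Y \<or> Y \<subseteq> X"
      by (auto simp: subset_chain_def)
    have "disjoint_family_on ?B (\<Union>\<C>)"
      unfolding disjoint_family_on_def
    proof (intro ballI impI)
      fix a b assume ab: "a \<in> \<Union>\<C>" "b \<in> \<Union>\<C>" "a \<noteq> b"
      then obtain X where "X \<in> \<C>" "a \<in> X" "b \<in> X" using tot by blast
      moreover from this have "disjoint_family_on ?B X" using sub by (auto simp: Q_def)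
      ultimately show "?B a \<inter> ?B b = {}" using ab by (meson disjoint_family_onD)
    qed
    then show "\<Union>\<C> \<in> Q" using sub unfolding Q_def by blast
  qed
  then obtain G where G: "G \<in> Q" and Gmax: "\<And>X. X \<in> Q \<Longrightarrow> G \<subseteq> X \<Longrightarrow> X = G" by blast
  have GK: "G \<subseteq> K" "disjoint_family_on ?B G" and Gprop: "\<And>b. b \<in> K \<Longrightarrow> \<exists>g\<in>G. ?B b \<inter> ?B g \<noteq> {} \<Longrightarrow>
      \<exists>g\<in>G. ?B b \<inter> ?B g \<noteq> {} \<and> snd b \<le> 2 * snd g"
    using G unfolding Q_def by blast+
  have meets: "\<exists>g\<in>G. ?B b \<inter> ?B g \<noteq> {}" if b: "b \<in> K" for b
  proof (rule ccontr)
    assume nb: "\<not> (\<exists>g\<in>G. ?B b \<inter> ?B g \<noteq> {})"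
    define K' where "K' = {b\<in>K. \<forall>g\<in>G. ?B b \<inter> ?B g = {}}"
    define s where "s = Sup (snd ` K')"
    have bK': "b \<in> K'" using b nb by (auto simp: K'_def)
    have bdd: "bdd_above (snd ` K')" using K by (auto simp: K'_def intro!: bdd_aboveI[of _ R])
    have le_s: "snd x \<le> s" if "x \<in> K'" for x
      unfolding s_def using bdd that by (intro cSup_upper) auto
    have "s > 0" using le_s[OF bK'] K[of "fst b" "snd b"] b by auto
    then have "s / 2 < s" by simp
    then have "\<exists>x\<in>snd ` K'. s / 2 < x" unfolding s_def
      using bK' bdd by (subst (asm) less_cSup_iff) auto
    then obtain b0 where b0: "b0 \<in> K'" "s / 2 < snd b0" by auto
    have b0K: "b0 \<in> K" using b0 by (simp add: K'_def)
    have "snd b0 > 0" using K[of "fst b0" "snd b0"] b0K by auto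
    then have self: "?B b0 \<inter> ?B b0 \<noteq> {}" by (auto simp: case_prod_beta intro!: exI[of _ "fst b0"])
    have b0G: "?B b0 \<inter> ?B g = {}" if "g \<in> G" for g using b0 that by (auto simp: K'_def)
    have "insert b0 G \<in> Q" unfolding Q_def mem_Collect_eq
    proof (intro conjI ballI impI)
      show "insert b0 G \<subseteq> K" using GK b0K by auto
      show "disjoint_family_on ?B (insert b0 G)"
        using GK(2) b0G unfolding disjoint_family_on_def by (metis Int_commute insert_iff)
      fix a assume a: "a \<in> K" "\<exists>g\<in>insert b0 G. ?B a \<inter> ?B g \<noteq> {}"
      show "\<exists>g\<in>insert b0 G. ?B a \<inter> ?B g \<noteq> {} \<and> snd a \<le> 2 * snd g"
      proof (cases "\<exists>g\<in>G. ?B a \<inter> ?B g \<noteq> {}")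
        case True
        then show ?thesis using Gprop[OF a(1)] by (meson insertI2)
      next
        case False
        then have "a \<in> K'" using a by (auto simp: K'_def)
        moreover have "?B a \<inter> ?B b0 \<noteq> {}" using False a by blast
        ultimately show ?thesis using le_s[of a] b0 by (intro bexI[of _ b0]) auto
      qed
    qed
    then have "b0 \<in> G" using Gmax by blast
    then show False using b0G self by blast
  qed
  show ?thesis
  proof (rule that[OF GK])
    fix y r assume "(y, r) \<in> K"
    from Gprop[OF this meets[OF this]] show "\<exists>(y', r')\<in>G. cb y r \<inter> cb y' r' \<noteq> {} \<and> r \<le> 2 * r'"
      by (auto simp: case_prod_beta)
  qed
qed

lemma pre_Un_le: "\<delta> > 0 \<Longrightarrow> pre \<delta> (A \<union> B) \<le> pre \<delta> A + pre \<delta> B"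
proof -
  assume \<delta>: "\<delta> > 0"
  let ?S = "\<lambda>i::nat. if i = 0 then A else if i = 1 then B else {}"
  have "(\<Sum>i. pre \<delta> (?S i)) = pre \<delta> A + pre \<delta> B"
    by (subst suminf_finite[of "{0,1}"]) (auto simp: pre_empty[OF \<delta>])
  moreover have "(\<Union>i. ?S i) = A \<union> B" by (auto split: if_splits)
  ultimately show ?thesis using pre_countably_subadditive[OF \<delta>, of ?S] by simp
qed

end

lemma nn_integral_count_space_tail:
  fixes h :: "'b \<Rightarrow> ennreal"
  assumes G: "countable G" and fin: "(\<integral>\<^sup>+g. h g \<partial>count_space G) < top" and e: "e > 0"
  obtains F where "finite F" "F \<subseteq> G" "(\<integral>\<^sup>+g. h g \<partial>count_space (G - F)) < ennreal e"
proof -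
  define F where "F n = {g\<in>G. to_nat_on G g < n}" for n
  have finF: "finite (F n)" for n
  proof -
    have "inj_on (to_nat_on G) (F n)" using G inj_on_to_nat_on[OF G] by (auto simp: F_def inj_on_def)
    moreover have "to_nat_on G ` F n \<subseteq> {..<n}" by (auto simp: F_def)
    ultimately show ?thesis by (meson finite_lessThan finite_subset finite_imageD)
  qed
  let ?N = "density (count_space G) h"
  have eq: "(\<integral>\<^sup>+g. h g \<partial>count_space (G - F n)) = emeasure ?N (G - F n)" for n
    by (subst emeasure_density) (auto simp: nn_integral_count_space_indicator
        intro!: nn_integral_cong split: split_indicator)
  have "(\<lambda>n. emeasure ?N (G - F n)) \<longlonglongrightarrow> emeasure ?N (\<Inter>n. G - F n)"
  proof (rule Lim_emeasure_decseq)
    show "decseq (\<lambda>n. G - F n)" by (auto simp: F_def decseq_def)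
    show "emeasure ?N (G - F n) \<noteq> \<infinity>" for n
    proof -
      have "emeasure ?N G = (\<integral>\<^sup>+g. h g \<partial>count_space G)"
        by (subst emeasure_density) (auto intro!: nn_integral_cong)
      then show ?thesis using emeasure_mono[of "G - F n" G ?N] fin by (auto simp: top_unique)
    qed
  qed auto
  moreover have "(\<Inter>n. G - F n) = {}" by (auto simp: F_def)
  ultimately have "(\<lambda>n. emeasure ?N (G - F n)) \<longlonglongrightarrow> emeasure ?N {}" by metis
  then have "(\<lambda>n. \<integral>\<^sup>+g. h g \<partial>count_space (G - F n)) \<longlonglongrightarrow> 0" by (simp add: eq)
  then have "\<forall>\<^sub>F n in sequentially. (\<integral>\<^sup>+g. h g \<partial>count_space (G - F n)) < ennreal e"
    using e by (intro order_tendstoD) auto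
  then obtain n where "(\<integral>\<^sup>+g. h g \<partial>count_space (G - F n)) < ennreal e"
    by (auto simp: eventually_sequentially)
  then show ?thesis using finF[of n] that[of "F n"] by (auto simp: F_def)
qed

context ball_metric
begin

text \<open>The disjoint balls selected from a fine cover inside \<open>S\<close> have total r^p at
  most M(S)/t. Finitely many of them, \<open>F\<close>, enter the cover unchanged. A point outside
  these has a small ball avoiding \<open>F\<close>, hence lies in the fivefold enlargement of a
  selected ball outside \<open>F\<close>, and all those enlargements together cost only 5^p times a
  tail.\<close>

lemma outer_le_measure_open:
  assumes M: "sets M = sets borel" and O: "open S" "A \<subseteq> S" "emeasure M S < top" and t: "t > 0"
    and lower: "\<And>x \<delta>. x \<in> A \<Longrightarrow> \<delta> > 0 \<Longrightarrow> \<exists>y r. 0 < r \<and> r < \<delta> \<and> d y x \<le> r \<and>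
        ennreal (t * r ^ p) \<le> emeasure M (cb y r)"
  shows "ennreal t * outer A \<le> emeasure M S"
proof -
  have SM: "S \<in> sets M" using O M by auto
  have "pre \<delta> A \<le> ennreal (1 / t) * emeasure M S" if \<delta>: "\<delta> > 0" for \<delta>
  proof -
    \<comment> \<open>The bound \<delta>/10 on the radius leaves the fivefold enlargements with
      diameter at most \<delta>.\<close>
    define K where "K = {(y, r). 0 < r \<and> r \<le> \<delta> / 10 \<and> cb y r \<subseteq> S \<and> ennreal (t * r ^ p) \<le> emeasure M (cb y r)}"
    have fine: "\<exists>y r. (y, r) \<in> K \<and> x \<in> cb y r \<and> cb y r \<subseteq> V" if x: "x \<in> A" and V: "open V" "x \<in> V" for x V
    proof -
      obtain e where e: "e > 0" "\<And>z. d x z < e \<Longrightarrow> z \<in> V \<inter> S"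
        using open_contains_ball[of "V \<inter> S" x] O x V by auto
      obtain y r where yr: "0 < r" "r < min (\<delta>/10) (e/2)" "d y x \<le> r" "ennreal (t * r ^ p) \<le> emeasure M (cb y r)"
        using lower[OF x, of "min (\<delta>/10) (e/2)"] \<delta> e by auto
      have "cb y r \<subseteq> V \<inter> S"
      proof
        fix z assume "z \<in> cb y r"
        then have "d x z < e" using triangle[of x y z] yr commute[of x y] by simp
        then show "z \<in> V \<inter> S" by (rule e)
      qed
      then show ?thesis using yr by (intro exI[of _ y] exI[of _ r]) (auto simp: K_def)
    qed
    have Kr: "0 < r \<and> r \<le> \<delta> / 10" if "(y, r) \<in> K" for y r using that by (simp add: K_def)
    obtain G where G: "G \<subseteq> K" "disjoint_family_on (\<lambda>(y, r). cb y r) G"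
      "\<And>y r. (y, r) \<in> K \<Longrightarrow> \<exists>(y', r')\<in>G. cb y r \<inter> cb y' r' \<noteq> {} \<and> r \<le> 2 * r'"
      by (rule Vitali_disjoint_subfamily[of K "\<delta>/10"], erule Kr, rule that)
    let ?B = "\<lambda>g. cb (fst g) (snd g)"
    have Gr: "0 < snd g" "snd g \<le> \<delta> / 10" "?B g \<subseteq> S" "ennreal (t * snd g ^ p) \<le> emeasure M (?B g)" if "g \<in> G" for g
    proof -
      have "g \<in> K" using that G(1) by blast
      then show "0 < snd g" "snd g \<le> \<delta> / 10" "?B g \<subseteq> S" "ennreal (t * snd g ^ p) \<le> emeasure M (?B g)"
        by (auto simp: K_def)
    qed
    have disj: "disjoint_family_on ?B G" using G(2) unfolding case_prod_unfold .
    have cG: "countable G"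
    proof -
      \<comment> \<open>Countability comes from the open balls inside: they are disjoint, nonempty
        and open in a second countable space.\<close>
      let ?U = "\<lambda>g. {x. d (fst g) x < snd g}"
      have Uc: "fst g \<in> ?U g" if "g \<in> G" for g using Gr(1)[OF that] by simp
      have dU: "?U g \<inter> ?U h = {}" if "g \<in> G" "h \<in> G" "g \<noteq> h" for g h
      proof -
        have "?U g \<subseteq> ?B g" "?U h \<subseteq> ?B h" by auto
        then show ?thesis using disjoint_family_onD[OF disj that] by blast
      qed
      have "inj_on ?U G"
      proof (rule inj_onI, rule ccontr)
        fix g h assume gh: "g \<in> G" "h \<in> G" "?U g = ?U h" "g \<noteq> h"
        then have "fst g \<in> ?U g \<inter> ?U h" using Uc[of g] by blast
        then show False using dU[OF gh(1,2,4)] by blast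
      qed
      moreover have "countable (?U ` G)"
      proof (rule countable_disjoint_open_subsets)
        show "pairwise disjnt (?U ` G)"
          by (rule pairwise_imageI) (use dU in \<open>simp add: disjnt_def\<close>)
      qed (auto intro: open_mball)
      ultimately show ?thesis by (simp add: countable_image_inj_eq)
    qed
    let ?h = "\<lambda>g. ennreal (snd g ^ p)"
    have BM: "?B g \<in> sets M" for g using M by auto
    have "ennreal t * (\<integral>\<^sup>+g. ?h g \<partial>count_space G) = (\<integral>\<^sup>+g. ennreal t * ?h g \<partial>count_space G)"
      by (rule nn_integral_cmult[symmetric]) simp
    also have "\<dots> \<le> (\<integral>\<^sup>+g. emeasure M (?B g) \<partial>count_space G)"
    proof (rule nn_integral_mono)
      fix g assume "g \<in> space (count_space G)"
      then have "g \<in> G" by simp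
      then show "ennreal t * ?h g \<le> emeasure M (?B g)"
        using Gr(1,4)[of g] t by (simp add: ennreal_mult[symmetric])
    qed
    also have "\<dots> = emeasure M (\<Union>g\<in>G. ?B g)"
      using cG BM disj by (intro emeasure_UN_countable[symmetric]) auto
    also have "\<dots> \<le> emeasure M S" using Gr(3) SM by (intro emeasure_mono) auto
    finally have sum_le: "ennreal t * (\<integral>\<^sup>+g. ?h g \<partial>count_space G) \<le> emeasure M S" .
    then have "(\<integral>\<^sup>+g. ?h g \<partial>count_space G) < top"
      using O(3) t by (metis ennreal_eq_0_iff ennreal_mult_eq_top_iff leD le_less_trans less_top)
    note finh = this
    have sum_le': "(\<integral>\<^sup>+g. ?h g \<partial>count_space G) \<le> ennreal (1 / t) * emeasure M S"
    proof -
      have "ennreal (1/t) * (ennreal t * (\<integral>\<^sup>+g. ?h g \<partial>count_space G)) \<le> ennreal (1 / t) * emeasure M S"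
        by (rule mult_left_mono[OF sum_le]) simp
      then show ?thesis using t by (simp add: mult.assoc[symmetric] ennreal_mult[symmetric])
    qed
    show ?thesis
    proof (rule ennreal_le_epsilon)
      fix e :: real assume e: "e > 0"
      obtain F where F: "finite F" "F \<subseteq> G" "(\<integral>\<^sup>+g. ?h g \<partial>count_space (G - F)) < ennreal (e / 5 ^ p)"
        using nn_integral_count_space_tail[OF cG finh, of "e / 5 ^ p"] e by auto
      have cov: "A \<subseteq> (\<Union>g\<in>F. ?B g) \<union> (\<Union>g\<in>G - F. cb (fst g) (5 * snd g))"
      proof
        fix x assume x: "x \<in> A"
        show "x \<in> (\<Union>g\<in>F. ?B g) \<union> (\<Union>g\<in>G - F. cb (fst g) (5 * snd g))"
        proof (cases "x \<in> (\<Union>g\<in>F. ?B g)")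
          case False
          have "open (- (\<Union>g\<in>F. ?B g))"
            using F(1) closed_cb by (intro open_Compl closed_UN) auto
          then obtain y r where yr: "(y, r) \<in> K" "x \<in> cb y r" "cb y r \<subseteq> - (\<Union>g\<in>F. ?B g)"
            using fine[OF x] False by blast
          obtain y' r' where g: "(y', r') \<in> G" "cb y r \<inter> cb y' r' \<noteq> {}" "r \<le> 2 * r'"
            using G(3)[OF yr(1)] by auto
          have "(y', r') \<notin> F" using yr(3) g(2) by force
          moreover obtain z where "d y z \<le> r" "d y' z \<le> r'" using g(2) by auto
          \<comment> \<open>The distance is at most r' + 2r, and r \<le> 2r'.\<close>
          then have "d y' x \<le> 5 * r'"
            using triangle[of y' z x] triangle[of z y x] yr(2) g(3) commute[of y z] by simp
          ultimately show ?thesis using g(1) by force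
        qed simp
      qed
      have "pre \<delta> A \<le> pre \<delta> (\<Union>g\<in>F. ?B g) + pre \<delta> (\<Union>g\<in>G - F. cb (fst g) (5 * snd g))"
        using caratheodory_pre_mono[OF cov] pre_Un_le[OF \<delta>] by (rule order_trans)
      also have "\<dots> \<le> (\<integral>\<^sup>+g. ?h g \<partial>count_space G) + ennreal e"
      proof (rule add_mono)
        have "pre \<delta> (\<Union>g\<in>F. ?B g) \<le> (\<integral>\<^sup>+g. cost (?B g) \<partial>count_space F)"
        proof (rule pre_le_count_space)
          show "countable F" using F by (simp add: countable_finite)
          show "?B g \<in> balls" if "g \<in> F" for g using Gr(1)[of g] F that by auto
          show "ediam d (?B g) \<le> ennreal \<delta>" if "g \<in> F" for g
            using Gr(1,2)[of g] F that \<delta> by (auto simp: ediam_ball intro!: ennreal_leI)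
        qed (use \<delta> in auto)
        also have "\<dots> = (\<integral>\<^sup>+g. ?h g \<partial>count_space F)"
        proof (rule nn_integral_cong)
          fix g assume "g \<in> space (count_space F)"
          then show "cost (?B g) = ?h g" using Gr(1)[of g] F by (intro cost_cb) auto
        qed
        also have "\<dots> \<le> (\<integral>\<^sup>+g. ?h g \<partial>count_space G)"
          using F(2) by (auto simp: nn_integral_count_space_indicator intro!: nn_integral_mono
              split: split_indicator)
        finally show "pre \<delta> (\<Union>g\<in>F. ?B g) \<le> (\<integral>\<^sup>+g. ?h g \<partial>count_space G)" .
        have "pre \<delta> (\<Union>g\<in>G-F. cb (fst g) (5 * snd g)) \<le> (\<integral>\<^sup>+g. cost (cb (fst g) (5 * snd g)) \<partial>count_space (G - F))"
        proof (rule pre_le_count_space)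
          show "countable (G - F)" using cG by auto
          show "cb (fst g) (5 * snd g) \<in> balls" if "g \<in> G - F" for g using Gr(1)[of g] that
            by (auto intro!: exI[of _ "fst g"] exI[of _ "5 * snd g"])
          show "ediam d (cb (fst g) (5 * snd g)) \<le> ennreal \<delta>" if "g \<in> G - F" for g
            using Gr(1,2)[of g] that \<delta> by (auto simp: ediam_ball intro!: ennreal_leI)
        qed (use \<delta> in auto)
        also have "\<dots> = (\<integral>\<^sup>+g. ennreal (5 ^ p) * ?h g \<partial>count_space (G - F))"
        proof (rule nn_integral_cong)
          fix g assume "g \<in> space (count_space (G - F))"
          then have "snd g > 0" using Gr(1)[of g] by auto
          then show "cost (cb (fst g) (5 * snd g)) = ennreal (5 ^ p) * ?h g"
            by (subst cost_cb) (auto simp: power_mult_distrib ennreal_mult)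
        qed
        also have "\<dots> = ennreal (5 ^ p) * (\<integral>\<^sup>+g. ?h g \<partial>count_space (G - F))"
          by (rule nn_integral_cmult) simp
        also have "\<dots> \<le> ennreal (5 ^ p) * ennreal (e / 5 ^ p)"
          using F(3) by (intro mult_left_mono) auto
        also have "\<dots> = ennreal e" using e by (simp add: ennreal_mult[symmetric])
        finally show "pre \<delta> (\<Union>g\<in>G-F. cb (fst g) (5 * snd g)) \<le> ennreal e" .
      qed
      also have "\<dots> \<le> ennreal (1 / t) * emeasure M S + ennreal e"
        using sum_le' by (rule add_right_mono)
      finally show "pre \<delta> A \<le> ennreal (1 / t) * emeasure M S + ennreal e" .
    qed
  qed
  then have "outer A \<le> ennreal (1 / t) * emeasure M S"
    unfolding caratheodory_outer_eq_SUP_pre by (auto intro: SUP_least)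
  then have "ennreal t * outer A \<le> ennreal t * (ennreal (1 / t) * emeasure M S)"
    by (rule mult_left_mono) simp
  then show ?thesis using t by (simp add: mult.assoc[symmetric] ennreal_mult[symmetric])
qed

text \<open>Outer regularity needs a finite measure, so \<open>A\<close> is cut into countably many
  disjoint pieces, each inside an open set \<open>T i\<close> of finite measure, and
  \<open>M\<close> is restricted to \<open>T i\<close>. The infimum over the open sets containing a
  piece then turns the bound for open sets into one for the piece itself.\<close>

lemma outer_le_measure:
  assumes M: "sets M = sets borel" and A: "A \<in> sets borel" and t: "t > 0"
    and finite: "\<And>x. x \<in> A \<Longrightarrow> \<exists>S. open S \<and> x \<in> S \<and> emeasure M S < top"
    and lower: "\<And>x \<delta>. x \<in> A \<Longrightarrow> \<delta> > 0 \<Longrightarrow> \<exists>y r. 0 < r \<and> r < \<delta> \<and> d y x \<le> r \<and>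
        ennreal (t * r ^ p) \<le> emeasure M (cb y r)"
  shows "ennreal t * outer A \<le> emeasure M A"
proof -
  obtain \<S> where \<S>: "countable \<S>" "\<And>S. S \<in> \<S> \<Longrightarrow> open S \<and> emeasure M S < top" "A \<subseteq> \<Union>\<S>"
  proof -
    let ?T = "{S. open S \<and> emeasure M S < top}"
    obtain \<S> where "\<S> \<subseteq> ?T" "countable \<S>" "\<Union>\<S> = \<Union>?T"
      using Lindelof[of ?T] by blast
    moreover have "A \<subseteq> \<Union>?T" using finite by blast
    ultimately show thesis by (intro that[of \<S>]) auto
  qed
  \<comment> \<open>The empty set is inserted so that there is something to enumerate even when the
    subcover is empty.\<close>
  define T where "T = from_nat_into (insert {} \<S>)"
  have T_in: "T i \<in> insert {} \<S>" for i unfolding T_def by (rule from_nat_into) simp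
  have T: "open (T i)" "emeasure M (T i) < top" for i
    using T_in[of i] \<S>(2) by auto
  have TA: "A \<subseteq> (\<Union>i. T i)"
    using range_from_nat_into[of "insert {} \<S>"] \<S> unfolding T_def by auto
  define A' where "A' i = A \<inter> disjointed T i" for i
  have A'T: "A' i \<subseteq> T i" "A' i \<subseteq> A" for i using disjointed_subset[of T i] by (auto simp: A'_def)
  have UA': "(\<Union>i. A' i) = A" using TA UN_disjointed_eq[of T] by (auto simp: A'_def)
  have disjA': "disjoint_family A'"
    using disjoint_family_disjointed[of T] by (auto simp: A'_def disjoint_family_on_def)
  have mA': "A' i \<in> sets borel" for i
  proof -
    have "range T \<subseteq> sets borel" using T by auto
    then have "disjointed T i \<in> sets borel" using sets.range_disjointed_sets[of T borel] by blast
    then show ?thesis using A by (auto simp: A'_def)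
  qed
  have le: "ennreal t * outer (A' i) \<le> emeasure M (A' i)" for i
  proof -
    \<comment> \<open>Restriction by a density keeps the Borel sigma-algebra of the whole type, as
      outer regularity requires.\<close>
    let ?N = "density M (indicator (T i))"
    have TM: "T i \<in> sets M" using T M by auto
    have N: "emeasure ?N X = emeasure M (T i \<inter> X)" if "X \<in> sets borel" for X
      using that M TM by (subst emeasure_density) (auto simp flip: nn_integral_indicator
          intro!: nn_integral_cong split: split_indicator)
    have sp: "space M = UNIV" using sets_eq_imp_space_eq[OF M] by simp
    have "emeasure ?N (A' i) = (INF S\<in>{S. A' i \<subseteq> S \<and> open S}. emeasure ?N S)"
    proof (rule outer_regular)
      show "sets ?N = sets borel" using M by simp
      have "emeasure ?N (space ?N) = emeasure M (T i)" using N[of UNIV] sp by simp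
      then show "emeasure ?N (space ?N) \<noteq> \<infinity>" using T[of i] by simp
    qed (rule mA')
    also have "\<dots> \<ge> ennreal t * outer (A' i)"
    proof (rule INF_greatest)
      fix S assume "S \<in> {S. A' i \<subseteq> S \<and> open S}"
      then have S: "A' i \<subseteq> S" "open S" by auto
      have "emeasure M (T i \<inter> S) \<le> emeasure M (T i)" using TM by (intro emeasure_mono) auto
      then have "emeasure M (T i \<inter> S) < top" using T(2)[of i] by (rule le_less_trans)
      then have "ennreal t * outer (A' i) \<le> emeasure M (T i \<inter> S)"
        using S T A'T[of i] lower t by (intro outer_le_measure_open[OF M]) auto
      then show "ennreal t * outer (A' i) \<le> emeasure ?N S" using N S by simp
    qed
    finally show ?thesis using N[OF mA'[of i]] A'T[of i] by (simp add: Int_absorb1)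
  qed
  have "ennreal t * outer A \<le> ennreal t * (\<Sum>i. outer (A' i))"
    using outer_countably_subadditive[of A'] UA' by (intro mult_left_mono) auto
  also have "\<dots> = (\<Sum>i. ennreal t * outer (A' i))" by simp
  also have "\<dots> \<le> (\<Sum>i. emeasure M (A' i))" using le by (intro suminf_le) auto
  also have "\<dots> = emeasure M (\<Union>i. A' i)"
    using mA' M disjA' by (intro suminf_emeasure) auto
  finally show ?thesis using UA' by simp
qed

section \<open>The differentiation theorem for the spherical measure\<close>

abbreviation "sph \<equiv> measure_of UNIV (sets borel) outer"

lemma sets_sph [simp, measurable_cong]: "sets sph = sets borel"
  using sets.sigma_sets_eq[of "borel :: 'a measure"] by simp

text \<open>Enlarging a ball slightly keeps a strict lower bound on its measure, so the points that lie in small balls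
  of large measure form open sets; hence no measurability of \<open>\<theta>\<close> has to be assumed.\<close>

theorem measure_eq_nn_integral_density:
  fixes \<theta> :: "'a \<Rightarrow> ennreal"
  assumes M: "sets M = sets borel" and B: "B \<in> sets borel"
    and \<theta>: "\<And>x. x \<in> B \<Longrightarrow> 0 < \<theta> x" "\<And>x. x \<in> B \<Longrightarrow> \<theta> x < top"
    and finite: "\<And>x. x \<in> B \<Longrightarrow> \<exists>S. open S \<and> x \<in> S \<and> emeasure M S < top"
    and upper: "\<And>x t. x \<in> B \<Longrightarrow> t > 0 \<Longrightarrow> \<theta> x < ennreal t \<Longrightarrow> \<exists>\<delta>>0. \<forall>y r. 0 < r \<and> r < \<delta> \<and> d y x \<le> r \<longrightarrow>
        emeasure M (cb y r) \<le> ennreal (t * r ^ p)"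
    and lower: "\<And>x t \<delta>. x \<in> B \<Longrightarrow> t > 0 \<Longrightarrow> ennreal t < \<theta> x \<Longrightarrow> \<delta> > 0 \<Longrightarrow> \<exists>y r. 0 < r \<and> r < \<delta> \<and> d y x \<le> r \<and>
        ennreal (t * r ^ p) \<le> emeasure M (cb y r)"
  shows "(\<lambda>x. \<theta> x * indicator B x) \<in> borel_measurable borel"
    and "emeasure M B = (\<integral>\<^sup>+x\<in>B. \<theta> x \<partial>sph)"
proof -
  \<comment> \<open>A point of \<open>B\<close> has \<theta> x > s exactly when, for some rational
    s' > s, at every scale 1/(m+1) some smaller ball through x has mass above s' r^p. This describes
    the superlevel set by countably many open sets.\<close>
  have super: "{x\<in>B. ennreal s < \<theta> x} \<in> sets borel" if s: "s \<ge> 0" for s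
  proof -
    define G where "G m s' = {x. \<exists>y r. 0 < r \<and> r < 1 / real (Suc m) \<and> d y x \<le> r \<and>
      ennreal (s' * r ^ p) < emeasure M (cb y r)}" for m and s' :: real
    have G: "open (G m s')" for m s' unfolding G_def by (rule open_points_of_large_balls[OF M])
    have "{x\<in>B. ennreal s < \<theta> x} = B \<inter> (\<Union>s'\<in>{s'\<in>\<rat>. s' > s}. \<Inter>m. G m s')"
    proof (intro antisym subsetI)
      fix x assume "x \<in> {x\<in>B. ennreal s < \<theta> x}"
      then have x: "x \<in> B" "ennreal s < \<theta> x" by auto
      obtain u where u: "\<theta> x = ennreal u" "u \<ge> 0" using \<theta>(2)[OF x(1)] by (cases "\<theta> x") auto
      have "s < u" using x u s by (simp add: ennreal_less_iff)
      then obtain s' where s': "s' \<in> \<rat>" "s < s'" "s' < u" using Rats_dense_in_real by blast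
      \<comment> \<open>The intermediate t turns the weak inequality of \<open>lower\<close> into a
        strict one at s'.\<close>
      obtain t where t: "s' < t" "t < u" using dense s'(3) by blast
      have "x \<in> G m s'" for m
      proof -
        have "ennreal t < \<theta> x" using t s' s u by (simp add: ennreal_less_iff)
        then obtain y r where yr: "0 < r" "r < 1 / real (Suc m)" "d y x \<le> r"
            "ennreal (t * r ^ p) \<le> emeasure M (cb y r)"
          using lower[OF x(1), of t "1 / real (Suc m)"] t s' s by auto
        have "ennreal (s' * r ^ p) < ennreal (t * r ^ p)"
          using t s' s yr(1) by (intro ennreal_lessI) auto
        then have "ennreal (s' * r ^ p) < emeasure M (cb y r)" using yr(4) by (rule less_le_trans)
        then show ?thesis unfolding G_def using yr by blast
      qed
      then show "x \<in> B \<inter> (\<Union>s'\<in>{s'\<in>\<rat>. s' > s}. \<Inter>m. G m s')" using x s' by auto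
    next
      fix x assume "x \<in> B \<inter> (\<Union>s'\<in>{s'\<in>\<rat>. s' > s}. \<Inter>m. G m s')"
      then obtain s' where x: "x \<in> B" "s < s'" "\<And>m. x \<in> G m s'" by auto
      have "\<not> \<theta> x < ennreal s'"
      proof
        assume "\<theta> x < ennreal s'"
        then obtain \<delta> where \<delta>: "\<delta> > 0" "\<And>y r. 0 < r \<Longrightarrow> r < \<delta> \<Longrightarrow> d y x \<le> r \<Longrightarrow>
          emeasure M (cb y r) \<le> ennreal (s' * r ^ p)" using upper[OF x(1), of s'] x s by auto
        obtain m where "inverse (real (Suc m)) < \<delta>" using reals_Archimedean[OF \<delta>(1)] by blast
        then have m: "1 / real (Suc m) < \<delta>" by (simp add: inverse_eq_divide)
        obtain y r where yr: "0 < r" "r < 1 / real (Suc m)" "d y x \<le> r"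
          "ennreal (s' * r ^ p) < emeasure M (cb y r)" using x(3)[of m] unfolding G_def by blast
        show False using \<delta>(2)[OF yr(1) less_trans[OF yr(2) m] yr(3)] yr(4) by simp
      qed
      moreover have "ennreal s < ennreal s'" using x s by (intro ennreal_lessI) auto
      ultimately show "x \<in> {x\<in>B. ennreal s < \<theta> x}" using x by auto
    qed
    also have "\<dots> \<in> sets borel"
    proof -
      have "countable {s'\<in>\<rat>. s' > s}" by (rule countable_subset[OF _ countable_rat]) auto
      then show ?thesis using B G by (intro sets.Int sets.countable_UN'') auto
    qed
    finally show ?thesis .
  qed
  define h where "h x = \<theta> x * indicator B x" for x
  have h[measurable]: "h \<in> borel_measurable borel"
  proof (rule borel_measurableI_greater)
    fix y :: ennreal
    show "{x \<in> space borel. y < h x} \<in> sets borel"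
    proof (cases y)
      case (real s)
      then have "{x \<in> space borel. y < h x} = {x\<in>B. ennreal s < \<theta> x}"
        by (auto simp: h_def indicator_def)
      then show ?thesis using super real by simp
    qed (auto simp: h_def)
  qed
  \<comment> \<open>\<open>B\<close> is cut into layers on which \<theta> lies in the interval from
    q^J (excluded) to q^(J+1), with J over all integers; positivity and finiteness of \<theta> make
    the layers cover \<open>B\<close>. On each layer the measure and the integral agree up to powers
    of q, and q tends to 1 at the end.\<close>
  have bounds: "(\<integral>\<^sup>+x. h x \<partial>sph) \<le> ennreal q * emeasure M B \<and>
      emeasure M B \<le> ennreal (q\<^sup>2) * (\<integral>\<^sup>+x. h x \<partial>sph)" if q: "q > 1" for q
  proof -
    define J where "J i = real_of_int (int_decode i)" for i
    define A where "A i = {x\<in>B. ennreal (q powr J i) < \<theta> x \<and> \<theta> x \<le> ennreal (q powr (J i + 1))}" for i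
    have mA[measurable]: "A i \<in> sets borel" for i
    proof -
      have "A i = {x\<in>B. ennreal (q powr J i) < \<theta> x} - {x\<in>B. ennreal (q powr (J i + 1)) < \<theta> x}"
        by (auto simp: A_def)
      then show ?thesis using super by auto
    qed
    have disjA: "disjoint_family A"
    proof -
      have "A i \<inter> A j = {}" if ij: "J i < J j" for i j
      proof -
        have "J i + 1 \<le> J j" using ij by (simp add: J_def)
        then have "ennreal (q powr (J i + 1)) \<le> ennreal (q powr J j)"
          using q by (intro ennreal_leI powr_mono) auto
        then have "\<theta> x < \<theta> x" if "x \<in> A i" "x \<in> A j" for x
          using that unfolding A_def by (metis (no_types, lifting) mem_Collect_eq le_less_trans)
        then show ?thesis by blast
      qed
      moreover have "J i \<noteq> J j" if "i \<noteq> j" for i j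
        using that inj_int_decode by (auto simp: J_def inj_on_def)
      ultimately show ?thesis unfolding disjoint_family_on_def by (metis Int_commute linorder_neqE_linordered_idom)
    qed
    have UA: "(\<Union>i. A i) = B"
    proof
      show "B \<subseteq> (\<Union>i. A i)"
      proof
        fix x assume x: "x \<in> B"
        obtain u where u: "\<theta> x = ennreal u" "u > 0" using \<theta>[OF x] by (cases "\<theta> x") auto
        define l where "l = \<lceil>log q u\<rceil> - 1"
        have "real_of_int l < log q u" "log q u \<le> real_of_int l + 1" unfolding l_def by linarith+
        then have "q powr real_of_int l < u" "u \<le> q powr (real_of_int l + 1)"
          using q u by (simp_all add: less_log_iff log_le_iff)
        then have "x \<in> A (int_encode l)" using x u by (auto simp: A_def J_def intro!: ennreal_lessI ennreal_leI)
        then show "x \<in> (\<Union>i. A i)" by blast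
      qed
    qed (auto simp: A_def)
    have qp: "q powr J i > 0" "q powr (J i + 1) = q * q powr J i" "q powr (J i + 2) = q\<^sup>2 * q powr J i" for i
      using q by (simp_all add: powr_add power2_eq_square)
    have lowerA: "ennreal (q powr J i) * outer (A i) \<le> emeasure M (A i)" for i
    proof (rule outer_le_measure[OF M mA])
      show "q powr J i > 0" by (rule qp)
      show "\<exists>S. open S \<and> x \<in> S \<and> emeasure M S < top" if "x \<in> A i" for x
        using finite that by (auto simp: A_def)
      show "\<exists>y r. 0 < r \<and> r < \<delta> \<and> d y x \<le> r \<and> ennreal (q powr J i * r ^ p) \<le> emeasure M (cb y r)"
        if "x \<in> A i" "\<delta> > 0" for x \<delta> using that lower qp(1) by (auto simp: A_def)
    qed
    \<comment> \<open>\<open>upper\<close> asks for a strict bound on \<theta>, so one more power of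
      q is spent here; this is the origin of q^2.\<close>
    have upperA: "emeasure M (A i) \<le> ennreal (q powr (J i + 2)) * outer (A i)" for i
    proof (rule measure_le_outer[OF M mA])
      show "q powr (J i + 2) > 0" using q by simp
      fix x assume x: "x \<in> A i"
      have "ennreal (q powr (J i + 1)) < ennreal (q powr (J i + 2))"
        using q by (intro ennreal_lessI) (auto intro: powr_less_mono)
      then have "\<theta> x < ennreal (q powr (J i + 2))" using x by (auto simp: A_def)
      then show "\<exists>\<delta>>0. \<forall>y r. 0 < r \<and> r < \<delta> \<and> d y x \<le> r \<longrightarrow>
         emeasure M (cb y r) \<le> ennreal (q powr (J i + 2) * r ^ p)"
        using x q by (intro upper) (auto simp: A_def)
    qed
    have I_le: "(\<integral>\<^sup>+x. h x * indicator (A i) x \<partial>sph) \<le> ennreal q * emeasure M (A i)" for i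
    proof -
      have "(\<integral>\<^sup>+x. h x * indicator (A i) x \<partial>sph) \<le> (\<integral>\<^sup>+x. ennreal (q powr (J i + 1)) * indicator (A i) x \<partial>sph)"
        by (intro nn_integral_mono) (auto simp: h_def A_def split: split_indicator)
      also have "\<dots> = ennreal (q powr (J i + 1)) * outer (A i)"
        by (subst nn_integral_cmult_indicator) (simp_all add: emeasure_caratheodory)
      also have "\<dots> = ennreal q * (ennreal (q powr J i) * outer (A i))"
        unfolding qp(2) using q by (simp add: ennreal_mult mult.assoc)
      also have "\<dots> \<le> ennreal q * emeasure M (A i)" by (intro mult_left_mono lowerA) simp
      finally show ?thesis .
    qed
    have I_ge: "emeasure M (A i) \<le> ennreal (q\<^sup>2) * (\<integral>\<^sup>+x. h x * indicator (A i) x \<partial>sph)" for i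
    proof -
      have "emeasure M (A i) \<le> ennreal (q\<^sup>2) * (ennreal (q powr J i) * outer (A i))"
        using upperA[of i] unfolding qp(3) using q by (simp add: ennreal_mult mult.assoc)
      also have "ennreal (q powr J i) * outer (A i) = (\<integral>\<^sup>+x. ennreal (q powr J i) * indicator (A i) x \<partial>sph)"
        by (subst nn_integral_cmult_indicator) (simp_all add: emeasure_caratheodory)
      also have "\<dots> \<le> (\<integral>\<^sup>+x. h x * indicator (A i) x \<partial>sph)"
        by (intro nn_integral_mono) (auto simp: h_def A_def split: split_indicator)
      finally show ?thesis by (simp add: mult_left_mono)
    qed
    have Mdec: "emeasure M B = (\<Sum>i. emeasure M (A i))"
    proof -
      have "range A \<subseteq> sets M" unfolding M using mA by blast
      from suminf_emeasure[OF this disjA] show ?thesis unfolding UA by simp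
    qed
    have "(\<integral>\<^sup>+x. h x \<partial>sph) = (\<integral>\<^sup>+x. h x * indicator (\<Union>i. A i) x \<partial>sph)"
      unfolding UA by (intro nn_integral_cong) (auto simp: h_def split: split_indicator)
    also have "\<dots> = (\<Sum>i. \<integral>\<^sup>+x. h x * indicator (A i) x \<partial>sph)"
      using disjA by (intro nn_integral_disjoint_family) auto
    finally have Idec: "(\<integral>\<^sup>+x. h x \<partial>sph) = (\<Sum>i. \<integral>\<^sup>+x. h x * indicator (A i) x \<partial>sph)" .
    have "(\<integral>\<^sup>+x. h x \<partial>sph) \<le> (\<Sum>i. ennreal q * emeasure M (A i))"
      unfolding Idec using I_le by (intro suminf_le) auto
    moreover have "emeasure M B \<le> (\<Sum>i. ennreal (q\<^sup>2) * (\<integral>\<^sup>+x. h x * indicator (A i) x \<partial>sph))"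
      unfolding Mdec using I_ge by (intro suminf_le) auto
    ultimately show ?thesis unfolding Mdec Idec by simp
  qed
  have le_lim: "a \<le> b" if ab: "\<And>q. q > 1 \<Longrightarrow> a \<le> ennreal (q ^ k) * b" for a b :: ennreal and k :: nat
  proof (cases b)
    case (real u)
    have lim: "((\<lambda>q. ennreal (q ^ k * u)) \<longlongrightarrow> ennreal (1 ^ k * u)) (at_right 1)"
      by (intro tendsto_intros)
    have "\<forall>\<^sub>F q in at_right 1. (1::real) < q" by (rule eventually_at_right_less)
    then have "\<forall>\<^sub>F q in at_right 1. a \<le> ennreal (q ^ k * u)"
    proof eventually_elim
      case (elim q)
      then show ?case using ab[of q] real by (simp add: ennreal_mult)
    qed
    from tendsto_lowerbound[OF lim this] have "a \<le> ennreal (1 ^ k * u)"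
      by (simp add: trivial_limit_at_right_real)
    then show ?thesis using real by simp
  qed simp
  have "(\<integral>\<^sup>+x. h x \<partial>sph) \<le> emeasure M B"
    by (rule le_lim[of _ 1]) (simp only: power_one_right bounds)
  moreover have "emeasure M B \<le> (\<integral>\<^sup>+x. h x \<partial>sph)"
    by (rule le_lim[of _ 2]) (simp only: bounds)
  ultimately show "emeasure M B = (\<integral>\<^sup>+x\<in>B. \<theta> x \<partial>sph)" by (simp add: h_def)
  show "(\<lambda>x. \<theta> x * indicator B x) \<in> borel_measurable borel" using h by (simp add: h_def[abs_def])
qed

end

section \<open>The Heisenberg group and homogeneous distances\<close>

lemma fst_hmul [simp]: "fst (x \<odot> y) = fst x + fst y"
  and snd_hmul [simp]: "snd (x \<odot> y) = snd x + snd y + symp (fst x) (fst y) / 2"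
  by (simp_all add: hmul_def bracket_def e_top_def)

lemma fst_hinv [simp]: "fst (hinv x) = - fst x"
  and snd_hinv [simp]: "snd (hinv x) = - snd x"
  by (simp_all add: hinv_def)

lemma fst_dil [simp]: "fst (dil t x) = t *\<^sub>R fst x"
  and snd_dil [simp]: "snd (dil t x) = t\<^sup>2 * snd x"
  by (simp_all add: dil_def)

lemma symp_add_left: "symp (a + b) c = symp a c + symp b c"
  and symp_add_right: "symp c (a + b) = symp c a + symp c b"
  and symp_scale_left [simp]: "symp (t *\<^sub>R a) b = t * symp a b"
  and symp_scale_right [simp]: "symp a (t *\<^sub>R b) = t * symp a b"
  and symp_minus_left [simp]: "symp (- a) b = - symp a b"
  and symp_minus_right [simp]: "symp a (- b) = - symp a b"
  and symp_self [simp]: "symp a a = 0"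
  and symp_zero_left [simp]: "symp 0 a = 0"
  and symp_zero_right [simp]: "symp a 0 = 0"
  by (simp_all add: symp_def inner_add_left inner_add_right inner_commute algebra_simps)

lemma symp_swap: "symp b a = - symp a b"
  by (simp add: symp_def inner_commute)

lemmas symp_simps = symp_add_left symp_add_right

lemma hmul_assoc: "x \<odot> y \<odot> z = x \<odot> (y \<odot> z)"
  by (simp add: prod_eq_iff symp_simps add_divide_distrib)

lemma hmul_zero_left [simp]: "0 \<odot> x = x" and hmul_zero_right [simp]: "x \<odot> 0 = x"
  by (simp_all add: prod_eq_iff)

lemma hmul_hinv_left [simp]: "hinv x \<odot> x = 0" and hmul_hinv_right [simp]: "x \<odot> hinv x = 0"
  by (simp_all add: prod_eq_iff)

lemma hmul_hinv_cancel [simp]: "x \<odot> (hinv x \<odot> y) = y" "hinv x \<odot> (x \<odot> y) = y"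
  by (simp_all add: hmul_assoc[symmetric])

lemma hinv_hinv [simp]: "hinv (hinv x) = x" and hinv_zero [simp]: "hinv 0 = 0"
  by (simp_all add: hinv_def)

lemma hinv_hmul: "hinv (x \<odot> y) = hinv y \<odot> hinv x"
  by (simp add: prod_eq_iff symp_swap[of "fst y"])

lemma dil_hmul: "dil t (x \<odot> y) = dil t x \<odot> dil t y"
  by (simp add: prod_eq_iff power2_eq_square algebra_simps)

lemma dil_dil [simp]: "dil s (dil t x) = dil (s * t) x"
  by (simp add: prod_eq_iff power_mult_distrib)

lemma dil_one [simp]: "dil 1 x = x" and dil_zero_right [simp]: "dil t 0 = 0"
  by (simp_all add: prod_eq_iff)

lemma symp_bounded_bilinear: "bounded_bilinear symp"
  unfolding symp_def
  by (rule bounded_bilinear.intro, simp_all add: inner_add_left inner_add_right algebra_simps)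
     (rule exI[of _ 2], clarsimp,
      smt (verit, best) Cauchy_Schwarz_ineq2 abs_triangle_ineq4 mult_mono norm_fst_le norm_ge_zero norm_snd_le fst_conv snd_conv)

lemmas tendsto_symp [tendsto_intros] = bounded_bilinear.tendsto[OF symp_bounded_bilinear]
lemmas continuous_on_symp [continuous_intros] = bounded_bilinear.continuous_on[OF symp_bounded_bilinear]

lemma hmul_eq_Pair: "x \<odot> y = (fst x + fst y, snd x + snd y + symp (fst x) (fst y) / 2)"
  by (simp add: prod_eq_iff)

lemma tendsto_hmul [tendsto_intros]:
  "(f \<longlongrightarrow> a) F \<Longrightarrow> (g \<longlongrightarrow> b) F \<Longrightarrow> ((\<lambda>x. f x \<odot> g x) \<longlongrightarrow> a \<odot> b) F"
  unfolding hmul_eq_Pair by (intro tendsto_intros) auto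

lemma tendsto_hinv [tendsto_intros]: "(f \<longlongrightarrow> a) F \<Longrightarrow> ((\<lambda>x. hinv (f x)) \<longlongrightarrow> hinv a) F"
  unfolding hinv_def by (intro tendsto_intros)

lemma tendsto_dil [tendsto_intros]:
  "(f \<longlongrightarrow> a) F \<Longrightarrow> (g \<longlongrightarrow> b) F \<Longrightarrow> ((\<lambda>x. dil (f x) (g x)) \<longlongrightarrow> dil a b) F"
  unfolding dil_def by (intro tendsto_intros)

lemma continuous_on_hmul [continuous_intros]:
  "continuous_on S f \<Longrightarrow> continuous_on S g \<Longrightarrow> continuous_on S (\<lambda>x. f x \<odot> g x)"
  unfolding hmul_eq_Pair by (intro continuous_intros) auto

lemma continuous_on_hinv [continuous_intros]: "continuous_on S f \<Longrightarrow> continuous_on S (\<lambda>x. hinv (f x))"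
  unfolding hinv_def by (intro continuous_intros)

text \<open>Meant for the homogeneous norm on the abelian subgroups spanned by the first and by the
  last n horizontal basis vectors: there the group product is addition and the norm is a
  seminorm.\<close>

lemma seminorm_le_norm:
  fixes f :: "'e::euclidean_space \<Rightarrow> real"
  assumes add: "\<And>x y. f (x + y) \<le> f x + f y" and scale: "\<And>t x. f (t *\<^sub>R x) = \<bar>t\<bar> * f x"
    and nonneg: "\<And>x. f x \<ge> 0"
  shows "f x \<le> (\<Sum>b\<in>Basis. f b) * norm x"
proof -
  have f0: "f 0 = 0" using scale[of 0 0] by simp
  have sum: "f (\<Sum>b\<in>B. g b) \<le> (\<Sum>b\<in>B. f (g b))" if "finite B" for B and g :: "'e \<Rightarrow> 'e"
    using that by induction (auto simp: f0 intro: order_trans[OF add])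
  have "f x = f (\<Sum>b\<in>Basis. (x \<bullet> b) *\<^sub>R b)" by (simp add: euclidean_representation)
  also have "\<dots> \<le> (\<Sum>b\<in>Basis. f ((x \<bullet> b) *\<^sub>R b))" by (rule sum) simp
  also have "\<dots> \<le> (\<Sum>b\<in>Basis. f b * norm x)"
  proof (rule sum_mono)
    fix b :: 'e assume "b \<in> Basis"
    then have "\<bar>x \<bullet> b\<bar> * f b \<le> norm x * f b" by (intro mult_right_mono Basis_le_norm nonneg)
    then show "f ((x \<bullet> b) *\<^sub>R b) \<le> f b * norm x" by (simp add: scale mult.commute)
  qed
  finally show ?thesis by (simp add: sum_distrib_right)
qed

locale hdist =
  fixes d :: "'n::finite heis \<Rightarrow> 'n heis \<Rightarrow> real"
  assumes hd: "homogeneous_distance d"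
begin

sublocale Metric_space UNIV d using hd by (simp add: homogeneous_distance_def)

abbreviation "N \<equiv> hnorm d"

lemma d_left: "d (z \<odot> x) (z \<odot> y) = d x y" using hd unfolding homogeneous_distance_def by blast

lemma d_dil: "t > 0 \<Longrightarrow> d (dil t x) (dil t y) = t * d x y" using hd unfolding homogeneous_distance_def by blast

lemma d_eq_N: "d x y = N (hinv y \<odot> x)"
  using d_left[of "hinv y" x y] by (simp add: hnorm_def)

lemma N_dil: "t > 0 \<Longrightarrow> N (dil t x) = t * N x"
  using d_dil[of t x 0] by (simp add: hnorm_def)

lemma N_hmul: "N (x \<odot> y) \<le> N x + N y"
  using triangle[of "x \<odot> y" x 0] d_left[of x y 0] by (simp add: hnorm_def)

lemma N_hinv [simp]: "N (hinv x) = N x"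
  using d_eq_N[of 0 x] by (simp add: hnorm_def commute)

lemma N_zero [simp]: "N 0 = 0" and N_nonneg [simp]: "N x \<ge> 0" and N_eq_0_iff [simp]: "N x = 0 \<longleftrightarrow> x = 0"
  by (simp_all add: hnorm_def)

lemma N_pos_iff [simp]: "N x > 0 \<longleftrightarrow> x \<noteq> 0"
  by (metis N_eq_0_iff N_nonneg less_le)

section \<open>Homogeneous norms compared with Euclidean coordinates\<close>

lemma N_horizontal_scale: "snd x = 0 \<Longrightarrow> N (t *\<^sub>R x) = \<bar>t\<bar> * N x"
proof -
  assume x: "snd x = 0"
  have pos: "N (t *\<^sub>R x) = t * N x" if "t > 0" for t
    using N_dil[OF that, of x] x by (simp add: dil_def scaleR_prod_def)
  consider "t > 0" | "t = 0" | "t < 0" by linarith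
  then show ?thesis
  proof cases
    case 3
    have "t *\<^sub>R x = hinv ((- t) *\<^sub>R x)" by (simp add: hinv_def)
    then have "N (t *\<^sub>R x) = N ((- t) *\<^sub>R x)" by (metis N_hinv)
    then show ?thesis using pos[of "- t"] 3 by simp
  qed (use pos in auto)
qed

lemma N_vertical: "N (0, s) = sqrt \<bar>s\<bar> * N e_top"
proof -
  have pos: "N (0, s) = sqrt s * N e_top" if "s > 0" for s
    using N_dil[of "sqrt s" e_top] that by (simp add: dil_def e_top_def)
  consider "s > 0" | "s = 0" | "s < 0" by linarith
  then show ?thesis
  proof cases
    case 2
    then have "(0, s) = (0 :: 'n heis)" by (simp add: prod_eq_iff)
    then show ?thesis using 2 by simp
  next
    case 3
    have "(0, s) = hinv (0, - s)" by (simp add: hinv_def)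
    then have "N (0, s) = N (0, - s)" by (metis N_hinv)
    then show ?thesis using pos[of "- s"] 3 by simp
  qed (use pos in auto)
qed

text \<open>Continuity is derived from homogeneity by writing x as a product of elements of two
  abelian horizontal subgroups and of the centre. On the first two the norm is a seminorm, hence at
  most a multiple of the Euclidean norm, and on the centre it grows like a square root.\<close>

lemma tendsto_N_0: "(N \<longlongrightarrow> 0) (nhds 0)"
proof -
  let ?f = "\<lambda>a :: real^'n. N ((a, 0), 0)" and ?g = "\<lambda>b :: real^'n. N ((0, b), 0)"
  define A where "A = (\<Sum>b\<in>Basis. ?f b)"
  define B where "B = (\<Sum>b\<in>Basis. ?g b)"
  have f: "?f a \<le> A * norm a" for a unfolding A_def
  proof (rule seminorm_le_norm)
    show "?f (x + y) \<le> ?f x + ?f y" for x y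
      using N_hmul[of "((x,0),0)" "((y,0),0)"] by (simp add: hmul_eq_Pair symp_def)
    show "?f (t *\<^sub>R x) = \<bar>t\<bar> * ?f x" for t x
      using N_horizontal_scale[of "((x,0),0)" t] by simp
  qed simp
  have g: "?g a \<le> B * norm a" for a unfolding B_def
  proof (rule seminorm_le_norm)
    show "?g (x + y) \<le> ?g x + ?g y" for x y
      using N_hmul[of "((0,x),0)" "((0,y),0)"] by (simp add: hmul_eq_Pair symp_def)
    show "?g (t *\<^sub>R x) = \<bar>t\<bar> * ?g x" for t x
      using N_horizontal_scale[of "((0,x),0)" t] by simp
  qed simp
  define h where "h x = A * norm (fst (fst x)) + B * norm (snd (fst x)) +
    sqrt \<bar>snd x - fst (fst x) \<bullet> snd (fst x) / 2\<bar> * N e_top" for x :: "'n heis"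
  have le: "N x \<le> h x" for x
  proof -
    \<comment> \<open>Subtracting half the inner product undoes the central term that the product of
      the two horizontal factors creates.\<close>
    have "x = ((fst (fst x), 0), 0) \<odot> ((0, snd (fst x)), 0) \<odot> (0, snd x - fst (fst x) \<bullet> snd (fst x) / 2)"
      by (simp add: prod_eq_iff symp_def)
    then have "N x \<le> ?f (fst (fst x)) + ?g (snd (fst x)) + N (0, snd x - fst (fst x) \<bullet> snd (fst x) / 2)"
      using N_hmul[of "((fst (fst x), 0), 0) \<odot> ((0, snd (fst x)), 0)" "(0, snd x - fst (fst x) \<bullet> snd (fst x) / 2)"]
        N_hmul[of "((fst (fst x), 0), 0)" "((0, snd (fst x)), 0)"] by simp
    then show ?thesis using f[of "fst (fst x)"] g[of "snd (fst x)"] by (simp add: h_def N_vertical)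
  qed
  have "(h \<longlongrightarrow> h 0) (nhds 0)" unfolding h_def by (intro tendsto_intros filterlim_ident) auto
  then have h0: "(h \<longlongrightarrow> 0) (nhds 0)" by (simp add: h_def)
  show ?thesis
    by (rule tendsto_sandwich[of "\<lambda>_. 0" N _ h]) (use le h0 in auto)
qed

lemma continuous_on_N: "continuous_on UNIV N"
  unfolding continuous_on_def
proof
  fix x :: "'n heis"
  have z: "((\<lambda>y. hinv x \<odot> y) \<longlongrightarrow> hinv x \<odot> x) (at x)" by (intro tendsto_intros)
  have "((\<lambda>y. N (hinv x \<odot> y)) \<longlongrightarrow> 0) (at x)"
    by (rule filterlim_compose[OF tendsto_N_0]) (use z in simp)
  moreover have "\<bar>N y - N x\<bar> \<le> N (hinv x \<odot> y)" for y
    using N_hmul[of x "hinv x \<odot> y"] N_hmul[of y "hinv (hinv x \<odot> y)"] N_hinv[of "hinv x \<odot> y"]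
    by (simp add: hinv_hmul)
  ultimately have "((\<lambda>y. N y - N x) \<longlongrightarrow> 0) (at x)"
    by (intro Lim_null_comparison[of "\<lambda>y. N y - N x"]) auto
  then show "(N \<longlongrightarrow> N x) (at x)" by (simp add: LIM_zero_iff)
qed

lemma tendsto_N [tendsto_intros]: "(f \<longlongrightarrow> a) F \<Longrightarrow> ((\<lambda>x. N (f x)) \<longlongrightarrow> N a) F"
  using continuous_on_N isCont_tendsto_compose[of a N] unfolding continuous_on_eq_continuous_at[OF open_UNIV]
  by blast

lemma tendsto_d [tendsto_intros]:
  assumes "(f \<longlongrightarrow> a) F" "(g \<longlongrightarrow> b) F"
  shows "((\<lambda>x. d (f x) (g x)) \<longlongrightarrow> d a b) F"
proof -
  have "((\<lambda>x. N (hinv (g x) \<odot> f x)) \<longlongrightarrow> N (hinv b \<odot> a)) F"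
    using assms by (intro tendsto_intros)
  then show ?thesis by (simp only: d_eq_N[symmetric])
qed

text \<open>The gauge \<open>h\<close> is homogeneous under dilations, so the positive minimum of
  the norm on the compact set h = 1 scales to all points. Together with continuity of the norm this
  makes the topology of \<open>d\<close> the Euclidean one.\<close>

lemma N_lower_bound: "\<exists>m>0. \<forall>x. m * (norm (fst x) + sqrt \<bar>snd x\<bar>) \<le> N x"
proof -
  define h where "h x = norm (fst x) + sqrt \<bar>snd x\<bar>" for x :: "'n heis"
  define S where "S = {x. h x = 1}"
  have hc: "continuous_on UNIV h" unfolding h_def by (intro continuous_intros)
  have "bounded S"
  proof (rule boundedI)
    fix x assume "x \<in> S"
    then have "norm (fst x) + sqrt \<bar>snd x\<bar> = 1" by (simp add: S_def h_def)
    then have "norm (fst x) \<le> 1" "sqrt \<bar>snd x\<bar> \<le> 1"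
      using norm_ge_zero[of "fst x"] real_sqrt_ge_zero[of "\<bar>snd x\<bar>"] by linarith+
    then have "norm (fst x) \<le> 1" "\<bar>snd x\<bar> \<le> 1" by auto
    then show "norm x \<le> 2" using norm_Pair_le[of "fst x" "snd x"] by simp
  qed
  moreover have "closed S" unfolding S_def using hc by (intro closed_Collect_eq) auto
  ultimately have "compact S" by (simp add: compact_eq_bounded_closed)
  moreover have "e_top \<in> S" by (simp add: S_def h_def e_top_def)
  moreover have "continuous_on S N" using continuous_on_subset[OF continuous_on_N] by blast
  ultimately obtain z where z: "z \<in> S" "\<And>x. x \<in> S \<Longrightarrow> N z \<le> N x"
    using continuous_attains_inf[of S N] by blast
  have hd: "h (dil t x) = t * h x" if "t > 0" for t x
    using that by (simp add: h_def abs_mult real_sqrt_mult algebra_simps)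
  have z0: "z \<noteq> 0" using z(1) by (auto simp: S_def h_def)
  have "N z * h x \<le> N x" for x
  proof (cases "h x = 0")
    case False
    then have hx: "h x > 0" by (simp add: h_def less_le)
    then have "h (dil (1 / h x) x) = 1" using hd[of "1 / h x" x] by simp
    then have "N z \<le> N (dil (1 / h x) x)" by (intro z) (simp add: S_def)
    also have "\<dots> = 1 / h x * N x" using hx by (intro N_dil) simp
    finally show ?thesis using hx by (simp add: field_simps)
  qed simp
  then show ?thesis using z0 by (auto simp: h_def intro!: exI[of _ "N z"])
qed

lemma norm_small_if_N_small:
  assumes "\<epsilon> > 0"
  obtains e where "e > 0" "\<And>x. N x < e \<Longrightarrow> norm x < \<epsilon>"
proof -
  obtain m where m: "m > 0" "\<And>x. m * (norm (fst x) + sqrt \<bar>snd x\<bar>) \<le> N x" using N_lower_bound by blast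
  define k where "k = min 1 (\<epsilon> / 2)"
  have k: "0 < k" "k \<le> 1" "k \<le> \<epsilon> / 2" using assms by (auto simp: k_def)
  show ?thesis
  proof (rule that[of "m * k"])
    fix x assume "N x < m * k"
    then have "norm (fst x) + sqrt \<bar>snd x\<bar> < k" using m(2)[of x] m(1) by (meson le_less_trans mult_less_cancel_left_pos)
    then have a: "norm (fst x) < k" "sqrt \<bar>snd x\<bar> < k"
      using norm_ge_zero[of "fst x"] real_sqrt_ge_zero[of "\<bar>snd x\<bar>"] by linarith+
    have "\<bar>snd x\<bar> = sqrt \<bar>snd x\<bar> * sqrt \<bar>snd x\<bar>" by simp
    also have "\<dots> \<le> k * 1"
    proof (rule mult_mono)
      show "sqrt \<bar>snd x\<bar> \<le> k" "sqrt \<bar>snd x\<bar> \<le> 1" using a k by linarith+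
    qed (use k in auto)
    finally show "norm x < \<epsilon>" using a k norm_Pair_le[of "fst x" "snd x"] by simp
  qed (use m k in simp)
qed

lemma N_ball_bounded: "bounded {x. N x \<le> R}"
proof -
  obtain m where m: "m > 0" "\<And>x. m * (norm (fst x) + sqrt \<bar>snd x\<bar>) \<le> N x" using N_lower_bound by blast
  have "norm x \<le> R / m + (R / m)\<^sup>2" if "N x \<le> R" for x
  proof -
    have "norm (fst x) + sqrt \<bar>snd x\<bar> \<le> R / m" using m(2)[of x] m(1) that by (simp add: field_simps)
    then have a: "norm (fst x) \<le> R / m" "sqrt \<bar>snd x\<bar> \<le> R / m"
      using norm_ge_zero[of "fst x"] real_sqrt_ge_zero[of "\<bar>snd x\<bar>"] by linarith+
    have "\<bar>snd x\<bar> = (sqrt \<bar>snd x\<bar>)\<^sup>2" by simp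
    also have "\<dots> \<le> (R / m)\<^sup>2" using a by (intro power_mono) auto
    finally show ?thesis using a norm_Pair_le[of "fst x" "snd x"] by simp
  qed
  then show ?thesis by (intro boundedI[of _ "R / m + (R / m)\<^sup>2"]) blast
qed

lemma N_ball_compact: "compact {x. N x \<le> R}"
  unfolding compact_eq_bounded_closed
  using N_ball_bounded continuous_on_N by (auto intro!: closed_Collect_le)

text \<open>The triangle inequality gives the upper bound. It is attained at x z and x z^-1 for a
  horizontal z of norm r, because z z = 2z for such z and the norm of 2z is 2r.\<close>

lemma hball_diameter:
  assumes "r > 0"
  shows "ediam d {y. d x y \<le> r} = ennreal (2 * r)"
proof (rule antisym)
  show "ediam d {y. d x y \<le> r} \<le> ennreal (2 * r)"
  proof (rule ediam_le, rule ennreal_leI)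
    fix y z assume "y \<in> {y. d x y \<le> r}" "z \<in> {y. d x y \<le> r}"
    then show "d y z \<le> 2 * r" using triangle[of y x z] commute[of x y] by simp
  qed
  define e :: "'n heis" where "e = ((1, 0), 0)"
  have e: "e \<noteq> 0" "snd e = 0" by (simp_all add: e_def zero_prod_def)
  define z where "z = (r / N e) *\<^sub>R e"
  have z: "snd z = 0" "N z = r" using e assms by (simp_all add: z_def N_horizontal_scale)
  have "z \<odot> z = 2 *\<^sub>R z" by (simp add: prod_eq_iff z scaleR_2)
  then have "d (x \<odot> z) (x \<odot> hinv z) = 2 * r"
    using z by (simp add: d_left d_eq_N[of z] N_horizontal_scale)
  moreover have "d x (x \<odot> y) = N y" for y using d_left[of x 0 y] by (simp add: hnorm_def commute)
  ultimately show "ennreal (2 * r) \<le> ediam d {y. d x y \<le> r}"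
    using le_ediam[of "x \<odot> z" "{y. d x y \<le> r}" "x \<odot> hinv z" d] z by simp
qed

lemma ball_metric: "p > 0 \<Longrightarrow> ball_metric d p"
proof
  fix S :: "'n heis set" and x assume S: "open S" "x \<in> S"
  have "((\<lambda>z. x \<odot> z) \<longlongrightarrow> x \<odot> 0) (nhds 0)" by (intro tendsto_intros filterlim_ident)
  then have "\<forall>\<^sub>F z in nhds 0. x \<odot> z \<in> S" using S by (simp add: tendsto_def)
  then obtain \<epsilon> where \<epsilon>: "\<epsilon> > 0" "\<And>z. norm z < \<epsilon> \<Longrightarrow> x \<odot> z \<in> S"
    by (auto simp: eventually_nhds_metric dist_norm)
  obtain e where e: "e > 0" "\<And>z. N z < e \<Longrightarrow> norm z < \<epsilon>" using norm_small_if_N_small[OF \<epsilon>(1)] by blast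
  have "y \<in> S" if "d x y < e" for y
  proof -
    have "N (hinv x \<odot> y) < e" using that d_eq_N[of y x] by (simp add: commute)
    then have "x \<odot> (hinv x \<odot> y) \<in> S" by (intro \<epsilon> e)
    then show ?thesis by simp
  qed
  then show "\<exists>e>0. \<forall>y. d x y < e \<longrightarrow> y \<in> S" using e by blast
next
  show "continuous_on UNIV (d y)" for y
    unfolding continuous_on_def by (auto intro!: tendsto_intros)
qed (auto intro: hball_diameter)

end

section \<open>Hausdorff measure on linear subspaces\<close>

lemma continuous_on_linear:
  fixes f :: "'a::euclidean_space \<Rightarrow> 'b::real_normed_vector"
  shows "linear f \<Longrightarrow> continuous_on S f"
  by (simp add: linear_continuous_on linear_conv_bounded_linear)

lemma borel_measurable_linear:
  fixes f :: "'a::euclidean_space \<Rightarrow> 'b::euclidean_space"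
  shows "linear f \<Longrightarrow> f \<in> borel_measurable borel"
  by (intro borel_measurable_continuous_onI continuous_on_linear)

lemma vimage_in_borel:
  "f \<in> borel_measurable borel \<Longrightarrow> X \<in> sets borel \<Longrightarrow> f -` X \<in> sets borel"
  using measurable_sets[of f borel borel X] by simp

text \<open>Uniqueness of translation invariant measures by Fubini: with B the unit cube, the set of
  pairs (x, y) with x in A and y + x in B is measured in both orders. One order gives \<nu>(A),
  since B has Lebesgue measure one; the other gives \<nu>(B) times the Lebesgue measure of
  A.\<close>

lemma translation_invariant_measure_eq_lborel:
  fixes \<nu> :: "'a::euclidean_space measure"
  assumes sets[measurable_cong]: "sets \<nu> = sets borel"
    and trans: "\<And>a A. A \<in> sets borel \<Longrightarrow> emeasure \<nu> ((\<lambda>x. a + x) -` A) = emeasure \<nu> A"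
    and fin: "emeasure \<nu> (box 0 One) < top"
    and A[measurable]: "A \<in> sets borel"
  shows "emeasure \<nu> A = emeasure \<nu> (box 0 One) * emeasure lborel A"
proof -
  have sp: "space \<nu> = UNIV" using sets_eq_imp_space_eq[OF sets] by simp
  have box_shift: "(\<lambda>x. a + x) -` box (a :: 'a) (a + One) = box 0 One" for a
    by (auto simp: box_def inner_add_left)
  interpret \<nu>: sigma_finite_measure \<nu>
  proof
    \<comment> \<open>Sigma-finiteness for Fubini: countably many translated unit cubes cover the
      space, each with the finite measure of the standard one.\<close>
    define \<C> where "\<C> = (\<lambda>a::'a. box (a - (1/2) *\<^sub>R One) (a - (1/2) *\<^sub>R One + One)) ` UNIV"
    obtain \<D> where \<D>: "\<D> \<subseteq> \<C>" "countable \<D>" "\<Union>\<D> = \<Union>\<C>"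
      using Lindelof[of \<C>] by (auto simp: \<C>_def open_box)
    have "x \<in> \<Union>\<C>" for x
      unfolding \<C>_def by (auto simp: box_def inner_diff_left inner_add_left intro!: exI[of _ x])
    then have "\<Union>\<D> = UNIV" using \<D> by auto
    moreover have "emeasure \<nu> D \<noteq> \<infinity>" "D \<in> sets \<nu>" if DD: "D \<in> \<D>" for D
    proof -
      obtain a where a: "D = box a (a + One)" using DD \<D>(1) unfolding \<C>_def by blast
      then have "emeasure \<nu> D = emeasure \<nu> (box 0 One)"
        using trans[of D a] by (simp add: box_shift)
      then show "emeasure \<nu> D \<noteq> \<infinity>" using fin by simp
      show "D \<in> sets \<nu>" using a sets by simp
    qed
    ultimately show "\<exists>A. countable A \<and> A \<subseteq> sets \<nu> \<and> \<Union>A = space \<nu> \<and> (\<forall>a\<in>A. emeasure \<nu> a \<noteq> \<infinity>)"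
      using \<D> sp by (intro exI[of _ \<D>]) auto
  qed
  interpret pair_sigma_finite lborel \<nu> ..
  define B where "B = box (0::'a) One"
  have B[measurable]: "B \<in> sets borel" by (simp add: B_def)
  have LB: "emeasure lborel B = 1"
    unfolding B_def by (subst emeasure_lborel_box) auto
  have inv\<nu>: "(\<integral>\<^sup>+x. h (a + x) \<partial>\<nu>) = (\<integral>\<^sup>+x. h x \<partial>\<nu>)" if [measurable]: "h \<in> borel_measurable borel"
    for h :: "'a \<Rightarrow> ennreal" and a
  proof -
    have "distr \<nu> borel (\<lambda>x. a + x) = \<nu>"
    proof (rule measure_eqI)
      fix X assume "X \<in> sets (distr \<nu> borel (\<lambda>x. a + x))"
      then show "emeasure (distr \<nu> borel (\<lambda>x. a + x)) X = emeasure \<nu> X"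
        using trans[of X a] sp by (subst emeasure_distr) auto
    qed (simp add: sets)
    then show ?thesis
      using nn_integral_distr[of "\<lambda>x. a + x" \<nu> borel h] by simp
  qed
  have invL: "emeasure lborel ((\<lambda>y. y + x) -` X) = emeasure lborel X" "emeasure lborel ((\<lambda>y. x - y) -` X) = emeasure lborel X"
    if [measurable]: "X \<in> sets borel" for x :: 'a and X
  proof -
    have "emeasure lborel X = emeasure (density (distr lborel borel (\<lambda>y. x + c *\<^sub>R y)) (\<lambda>_. \<bar>c\<bar>^DIM('a))) X"
      if "c \<noteq> 0" for c using lborel_affine[OF that, of x] by simp
    from this[of 1] this[of "-1"] show "emeasure lborel ((\<lambda>y. y + x) -` X) = emeasure lborel X"
      "emeasure lborel ((\<lambda>y. x - y) -` X) = emeasure lborel X"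
      by (simp_all add: emeasure_density nn_integral_distr emeasure_distr add.commute density_1)
  qed
  have "emeasure \<nu> A = (\<integral>\<^sup>+x. indicator A x \<partial>\<nu>)" by (simp add: sets)
  also have "\<dots> = (\<integral>\<^sup>+x. indicator A x * (\<integral>\<^sup>+y. indicator B (y + x) \<partial>lborel) \<partial>\<nu>)"
  proof (rule nn_integral_cong)
    fix x
    have "(\<integral>\<^sup>+y. indicator B (y + x) \<partial>lborel) = (\<integral>\<^sup>+y. indicator ((\<lambda>y. y + x) -` B) y \<partial>lborel)"
      by (intro nn_integral_cong) (auto split: split_indicator)
    also have "\<dots> = emeasure lborel ((\<lambda>y. y + x) -` B)"
      by (rule nn_integral_indicator) (simp add: vimage_in_borel)
    also have "\<dots> = 1" using invL(1)[OF B] LB by simp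
    finally show "indicator A x = indicator A x * (\<integral>\<^sup>+y. indicator B (y + x) \<partial>lborel)" by simp
  qed
  also have "\<dots> = (\<integral>\<^sup>+x. \<integral>\<^sup>+y. indicator A x * indicator B (y + x) \<partial>lborel \<partial>\<nu>)"
    by (intro nn_integral_cong nn_integral_cmult[symmetric]) simp
  also have "\<dots> = (\<integral>\<^sup>+y. \<integral>\<^sup>+x. indicator A x * indicator B (y + x) \<partial>\<nu> \<partial>lborel)"
    by (rule Fubini') simp
  also have "\<dots> = (\<integral>\<^sup>+y. \<integral>\<^sup>+x. indicator A (x - y) * indicator B x \<partial>\<nu> \<partial>lborel)"
  proof (rule nn_integral_cong)
    fix y
    show "(\<integral>\<^sup>+x. indicator A x * indicator B (y + x) \<partial>\<nu>) = (\<integral>\<^sup>+x. indicator A (x - y) * indicator B x \<partial>\<nu>)"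
      using inv\<nu>[of "\<lambda>x. indicator A (x - y) * indicator B x" y] by simp
  qed
  also have "\<dots> = (\<integral>\<^sup>+x. \<integral>\<^sup>+y. indicator A (x - y) * indicator B x \<partial>lborel \<partial>\<nu>)"
    by (rule Fubini'[symmetric]) simp
  also have "\<dots> = (\<integral>\<^sup>+x. emeasure lborel A * indicator B x \<partial>\<nu>)"
  proof (rule nn_integral_cong)
    fix x
    have "(\<integral>\<^sup>+y. indicator A (x - y) * indicator B x \<partial>lborel) = (\<integral>\<^sup>+y. indicator A (x - y) \<partial>lborel) * indicator B x"
      by (rule nn_integral_multc) simp
    also have "(\<integral>\<^sup>+y. indicator A (x - y) \<partial>lborel) = (\<integral>\<^sup>+y. indicator ((\<lambda>y. x - y) -` A) y \<partial>lborel)"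
      by (intro nn_integral_cong) (auto split: split_indicator)
    also have "\<dots> = emeasure lborel ((\<lambda>y. x - y) -` A)"
      by (rule nn_integral_indicator) (simp add: vimage_in_borel)
    also have "\<dots> = emeasure lborel A" by (rule invL(2)[OF A])
    finally show "(\<integral>\<^sup>+y. indicator A (x - y) * indicator B x \<partial>lborel) = emeasure lborel A * indicator B x" .
  qed
  also have "\<dots> = emeasure lborel A * emeasure \<nu> B"
    by (subst nn_integral_cmult_indicator) (simp_all add: sets)
  finally show ?thesis by (simp add: B_def mult.commute)
qed

text \<open>The image of Lebesgue measure under a linear map onto the space is translation
  invariant, hence a multiple of Lebesgue measure. The factor is identified only in
  \<open>lborel_linear_vimage\<close>.\<close>

lemma linear_vimage_lborel_eq:
  fixes f :: "real^'m::finite \<Rightarrow> real^'m"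
  assumes f: "linear f" "surj f" and A: "A \<in> sets borel"
  shows "emeasure lborel (f -` A) = emeasure lborel (f -` box 0 One) * emeasure lborel A"
proof -
  have inj: "inj f" using f by (rule linear_surjective_imp_injective) simp
  have m[measurable]: "f \<in> borel_measurable borel" by (rule borel_measurable_linear[OF f(1)])
  let ?\<nu> = "distr lborel borel f"
  have \<nu>: "emeasure ?\<nu> X = emeasure lborel (f -` X)" if "X \<in> sets borel" for X
    using that by (subst emeasure_distr) auto
  have "emeasure ?\<nu> A = emeasure ?\<nu> (box 0 One) * emeasure lborel A"
  proof (rule translation_invariant_measure_eq_lborel)
    fix a :: "real^'m" and X :: "(real^'m) set" assume X: "X \<in> sets borel"
    obtain b where b: "a = f b" using f(2) by (metis surjD)
    have "f -` ((\<lambda>x. a + x) -` X) = (\<lambda>x. b + x) -` (f -` X)"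
      using f(1) by (auto simp: b linear_add)
    moreover have "emeasure lborel ((\<lambda>x. b + x) -` (f -` X)) = emeasure (distr lborel borel ((+) b)) (f -` X)"
      using measurable_sets[OF m X] by (subst emeasure_distr) auto
    moreover have "(\<lambda>x. a + x) -` X \<in> sets borel"
      using measurable_sets[of "\<lambda>x. a + x" borel borel X] X by simp
    ultimately show "emeasure ?\<nu> ((\<lambda>x. a + x) -` X) = emeasure ?\<nu> X"
      using X by (simp add: \<nu> lborel_distr_plus)
  next
    obtain g where g: "linear g" "g \<circ> f = id" using linear_injective_left_inverse[OF f(1) inj] by blast
    have "f -` box 0 One \<subseteq> g ` box 0 One"
    proof
      fix x assume "x \<in> f -` box 0 One"
      moreover have "x = g (f x)" using g(2) by (metis comp_apply id_apply)
      ultimately show "x \<in> g ` box 0 One" by blast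
    qed
    moreover have "bounded (g ` box 0 One)"
      using g(1) by (intro bounded_linear_image) (auto simp: linear_conv_bounded_linear)
    ultimately have "bounded (f -` box 0 One)" by (rule bounded_subset[rotated])
    then show "emeasure ?\<nu> (box 0 One) < top" by (simp add: \<nu> emeasure_bounded_finite[unfolded infinity_ennreal_def])
  qed (use A in auto)
  then show ?thesis using A by (simp add: \<nu>)
qed

lemma abs_eq_1_if_square_eq_1: "x * x = 1 \<Longrightarrow> \<bar>x\<bar> = (1::real)"
  using square_eq_1_iff[of x] by auto

text \<open>Reduction to elementary maps. The predicate \<open>P\<close> holds trivially for
  singular maps and passes to compositions, because a nonsingular composition has nonsingular
  factors. Swaps preserve the unit cube; a shear is conjugate to its inverse by a reflection, so its
  volume factor has square one.\<close>

lemma lborel_linear_vimage: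
  fixes f :: "real^'m::finite \<Rightarrow> real^'m"
  assumes f: "linear f" and det: "det (matrix f) \<noteq> 0" and A: "A \<in> sets borel"
  shows "ennreal \<bar>det (matrix f)\<bar> * emeasure lborel (f -` A) = emeasure lborel A"
proof -
  define P where "P f \<longleftrightarrow> linear f \<and> (det (matrix f) \<noteq> 0 \<longrightarrow>
    (\<forall>A\<in>sets borel. ennreal \<bar>det (matrix f)\<bar> * emeasure lborel (f -` A) = emeasure lborel A))"
    for f :: "real^'m \<Rightarrow> real^'m"
  have bm: "f -` X \<in> sets borel" if "linear f" "X \<in> sets borel" for f :: "real^'m \<Rightarrow> real^'m" and X
    using that by (intro vimage_in_borel borel_measurable_linear)
  have surj: "surj f" if "linear f" "det (matrix f) \<noteq> 0" for f :: "real^'m \<Rightarrow> real^'m"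
    using that det_nz_iff_inj[of f] linear_injective_imp_surjective by blast
  have involution: "P f" if f: "linear f" "f \<circ> f = id" and b: "f -` box 0 One = box 0 One" for f :: "real^'m \<Rightarrow> real^'m"
  proof -
    have "matrix f ** matrix f = mat 1" using f by (metis matrix_compose matrix_id_mat_1)
    then have "det (matrix f) * det (matrix f) = 1" by (metis det_I det_mul)
    then have "\<bar>det (matrix f)\<bar> = 1" by (rule abs_eq_1_if_square_eq_1)
    moreover have "emeasure lborel (f -` A) = emeasure lborel A" if "A \<in> sets borel" for A
    proof -
      have "surj f" using f(2) by (metis comp_apply id_apply surjI)
      then show ?thesis using linear_vimage_lborel_eq[OF f(1) _ that] b
        by (simp add: emeasure_lborel_box inner_Basis)
    qed
    ultimately show ?thesis using f by (simp add: P_def)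
  qed
  have comp: "P (f \<circ> g)" if "P f" "P g" for f g
  proof -
    have lin: "linear f" "linear g" using that by (auto simp: P_def)
    have m: "det (matrix (f \<circ> g)) = det (matrix f) * det (matrix g)"
      using lin by (simp add: matrix_compose det_mul)
    have "ennreal \<bar>det (matrix (f \<circ> g))\<bar> * emeasure lborel ((f \<circ> g) -` A) = emeasure lborel A"
      if A: "A \<in> sets borel" and nz: "det (matrix (f \<circ> g)) \<noteq> 0" for A
    proof -
      have "ennreal \<bar>det (matrix (f \<circ> g))\<bar> * emeasure lborel ((f \<circ> g) -` A)
        = ennreal \<bar>det (matrix f)\<bar> * (ennreal \<bar>det (matrix g)\<bar> * emeasure lborel (g -` (f -` A)))"
        unfolding m by (simp add: abs_mult ennreal_mult mult.assoc vimage_comp)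
      also have "\<dots> = emeasure lborel A"
        using \<open>P f\<close> \<open>P g\<close> nz m A bm[OF lin(1) A] by (simp add: P_def)
      finally show ?thesis .
    qed
    then show ?thesis using lin by (simp add: P_def linear_compose)
  qed
  have const: "P (\<lambda>x. \<chi> i. c i * x $ i)" for c
  proof -
    let ?f = "\<lambda>x::real^'m. \<chi> i. c i * x $ i"
    have lin: "linear ?f" by (rule linearI) (auto simp: vec_eq_iff algebra_simps)
    have "det (matrix ?f) = (\<Prod>i\<in>UNIV. matrix ?f $ i $ i)"
      by (rule det_diagonal) (simp add: matrix_def axis_def)
    also have "\<dots> = (\<Prod>i\<in>UNIV. c i)" by (simp add: matrix_def axis_def)
    finally have d: "det (matrix ?f) = (\<Prod>i\<in>UNIV. c i)" .
    have "ennreal \<bar>det (matrix ?f)\<bar> * emeasure lborel (?f -` A) = emeasure lborel A"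
      if nz: "det (matrix ?f) \<noteq> 0" and A: "A \<in> sets borel" for A
    proof -
      \<comment> \<open>The diagonal entries, indexed by basis vectors as
        \<open>lborel_affine_euclidean\<close> expects them.\<close>
      define c' where "c' b = (\<chi> i. c i) \<bullet> b" for b :: "real^'m"
      have B: "(Basis :: (real^'m) set) = range (\<lambda>i. axis i 1)" by (auto simp: Basis_vec_def)
      have inj: "inj (\<lambda>i::'m. axis i (1::real))" by (auto simp: inj_on_def axis_eq_axis)
      have c'0: "c' b \<noteq> 0" if "b \<in> Basis" for b
        using that nz d by (auto simp: B c'_def inner_axis)
      have T: "0 + (\<Sum>j\<in>Basis. (c' j * (x \<bullet> j)) *\<^sub>R j) = ?f x" for x
      proof -
        have "(\<Sum>j\<in>Basis. (c' j * (x \<bullet> j)) *\<^sub>R j) = (\<Sum>i\<in>UNIV. (c i * x $ i) *\<^sub>R axis i 1)"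
          unfolding B using inj by (simp add: sum.reindex c'_def inner_axis)
        also have "\<dots> = ?f x"
          by (simp add: vec_eq_iff axis_def if_distrib[of "\<lambda>t. _ * t"] cong: if_cong)
        finally show ?thesis by simp
      qed
      have "(\<Prod>j\<in>Basis. \<bar>c' j\<bar>) = \<bar>det (matrix ?f)\<bar>"
        unfolding B using inj by (simp add: prod.reindex c'_def inner_axis d abs_prod)
      moreover have "lborel = density (distr lborel borel ?f) (\<lambda>_. (\<Prod>j\<in>Basis. \<bar>c' j\<bar>))"
        using lborel_affine_euclidean[where c=c' and t=0, OF c'0] unfolding T .
      ultimately have "lborel = density (distr lborel borel ?f) (\<lambda>_. ennreal \<bar>det (matrix ?f)\<bar>)" by simp
      then have "emeasure lborel A = emeasure (density (distr lborel borel ?f) (\<lambda>_. ennreal \<bar>det (matrix ?f)\<bar>)) A"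
        by simp
      also have "\<dots> = ennreal \<bar>det (matrix ?f)\<bar> * emeasure (distr lborel borel ?f) A"
        using A by (subst emeasure_density) (auto simp: nn_integral_cmult_indicator)
      also have "emeasure (distr lborel borel ?f) A = emeasure lborel (?f -` A)"
        using A borel_measurable_linear[OF lin] by (subst emeasure_distr) auto
      finally show ?thesis by simp
    qed
    then show ?thesis using lin by (simp add: P_def)
  qed
  have "P f"
    using f
  proof (rule induct_linear_elementary)
    show "P (f \<circ> g)" if "linear f" "linear g" "P f" "P g" for f g using comp that by blast
    show "P f" if "linear f" "\<And>x. f x $ i = 0" for f i
    proof -
      have "row i (matrix f) = 0" using that by (simp add: row_def matrix_def vec_eq_iff)
      then have "det (matrix f) = 0" by (rule det_zero_row)
      then show ?thesis using that by (simp add: P_def)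
    qed
    show "P (\<lambda>x. \<chi> i. c i * x $ i)" for c by (rule const)
    show "P (\<lambda>x. \<chi> i. x $ Transposition.transpose m n i)" if "m \<noteq> n" for m n :: 'm
    proof (rule involution)
      show "linear (\<lambda>x::real^'m. \<chi> i. x $ Transposition.transpose m n i)"
        by (rule linearI) (auto simp: vec_eq_iff)
      show "(\<lambda>x::real^'m. \<chi> i. x $ Transposition.transpose m n i) \<circ> (\<lambda>x. \<chi> i. x $ Transposition.transpose m n i) = id"
        by (auto simp: fun_eq_iff vec_eq_iff)
      show "(\<lambda>x::real^'m. \<chi> i. x $ Transposition.transpose m n i) -` box 0 One = box 0 One"
      proof -
        have box: "box 0 One = {x::real^'m. \<forall>i. 0 < x $ i \<and> x $ i < 1}"
        proof -
          have "(One :: real^'m) \<bullet> axis i 1 = 1" for i by (rule inner_sum_Basis) (auto simp: Basis_vec_def)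
          then have "(One :: real^'m) $ i = 1" for i by (simp only: inner_axis) simp
          then show ?thesis by (auto simp: mem_box_cart simp del: sum_component)
        qed
        have "(\<forall>i. Q (x $ Transposition.transpose m n i)) \<longleftrightarrow> (\<forall>i. Q (x $ i))" for Q and x :: "real^'m"
          by (metis transpose_involutory)
        from this[of "\<lambda>t. 0 < t \<and> t < 1"] show ?thesis unfolding box by (simp add: vimage_def)
      qed
    qed
    show "P (\<lambda>x. \<chi> i. if i = m then x $ m + x $ n else x $ i)" if mn: "m \<noteq> n" for m n :: 'm
    proof -
      let ?f = "\<lambda>x::real^'m. \<chi> i. if i = m then x $ m + x $ n else x $ i"
      let ?D = "\<lambda>x::real^'m. \<chi> i. (if i = m then -1 else 1) * x $ i"
      have lin: "linear ?f" "linear ?D" by (rule linearI; auto simp: vec_eq_iff algebra_simps)+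
      \<comment> \<open>With D the reflection in coordinate m, the composition of f and D is an
        involution; this fixes both the absolute determinant and the volume factor of f.\<close>
      have inv: "?f \<circ> (?D \<circ> (?f \<circ> ?D)) = id" using mn by (auto simp: fun_eq_iff vec_eq_iff)
      have D: "\<bar>det (matrix ?D)\<bar> = 1"
      proof -
        have "?D \<circ> ?D = id" by (auto simp: fun_eq_iff vec_eq_iff)
        then have "matrix (?D \<circ> ?D) = mat 1" by (simp only: matrix_id_mat_1)
        then have "matrix ?D ** matrix ?D = mat 1" by (simp only: matrix_compose[OF lin(2) lin(2)])
        then have "det (matrix ?D ** matrix ?D) = 1" by simp
        then have "det (matrix ?D) * det (matrix ?D) = 1" by (simp only: det_mul)
        then show ?thesis by (rule abs_eq_1_if_square_eq_1)
      qed
      have PD: "P ?D" by (rule const)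
      have LD: "emeasure lborel (?D -` A) = emeasure lborel A" if "A \<in> sets borel" for A
        using PD that D by (auto simp: P_def)
      have "matrix ?f ** (matrix ?D ** (matrix ?f ** matrix ?D)) = matrix (?f \<circ> (?D \<circ> (?f \<circ> ?D)))"
        using lin by (simp only: matrix_compose linear_compose)
      also have "\<dots> = mat 1" unfolding inv by (rule matrix_id_mat_1)
      finally have "det (matrix ?f ** (matrix ?D ** (matrix ?f ** matrix ?D))) = det (mat 1 :: real^'m^'m)"
        by (rule arg_cong)
      then have "(det (matrix ?f) * det (matrix ?D)) * (det (matrix ?f) * det (matrix ?D)) = 1"
        by (simp only: det_mul det_I mult.assoc)
      then have "\<bar>det (matrix ?f) * det (matrix ?D)\<bar> = 1" by (rule abs_eq_1_if_square_eq_1)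
      then have "\<bar>det (matrix ?f)\<bar> = 1" using D by (simp only: abs_mult mult_1_right)
      moreover have "emeasure lborel (?f -` A) = emeasure lborel A" if A: "A \<in> sets borel" for A
      proof -
        have sf: "surj ?f" by (rule surj[OF lin(1)]) (use \<open>\<bar>det (matrix ?f)\<bar> = 1\<close> in auto)
        let ?c = "emeasure lborel (?f -` box 0 One)"
        have box: "box 0 One \<in> sets (borel :: (real^'m) measure)" by simp
        have "emeasure lborel (box 0 One :: (real^'m) set) = emeasure lborel ((?f \<circ> (?D \<circ> (?f \<circ> ?D))) -` box 0 One)"
          unfolding inv by simp
        also have "\<dots> = emeasure lborel (?D -` (?f -` (?D -` (?f -` box 0 One))))"
          by (simp add: vimage_comp comp_assoc)
        also have "\<dots> = ?c * ?c"
        proof -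
          have 1: "?f -` box 0 One \<in> sets borel" by (rule bm[OF lin(1) box])
          have 2: "?D -` (?f -` box 0 One) \<in> sets borel" by (rule bm[OF lin(2) 1])
          have 3: "?f -` (?D -` (?f -` box 0 One)) \<in> sets borel" by (rule bm[OF lin(1) 2])
          show ?thesis
            by (simp only: LD[OF 3] linear_vimage_lborel_eq[OF lin(1) sf 2] LD[OF 1])
        qed
        finally have "?c * ?c = 1" by (simp add: emeasure_lborel_box inner_Basis)
        then have "?c = 1"
        proof (cases ?c)
          case (real r)
          then have "ennreal (r * r) = ennreal 1" using \<open>?c * ?c = 1\<close> by (simp only: ennreal_mult ennreal_1)
          then have "r * r = 1" using real by (subst (asm) ennreal_inj) auto
          then have "r = 1" using abs_eq_1_if_square_eq_1[of r] real by simp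
          then show ?thesis using real by simp
        qed simp
        then show ?thesis using linear_vimage_lborel_eq[OF lin(1) sf A] by simp
      qed
      ultimately show ?thesis using lin by (simp add: P_def)
    qed
  qed
  then show ?thesis using assms by (simp add: P_def)
qed

section \<open>Hausdorff measure expressed through Lebesgue measure\<close>

lemma emeasure_hausdorff:
  assumes "p > 0" "A \<in> sets borel"
  shows "emeasure (hausdorff_measure p :: 'a::euclidean_space measure) A =
    caratheodory_outer dist UNIV (unit_ball_vol (real p) / 2 ^ p) p A"
proof -
  interpret gauge "dist :: 'a \<Rightarrow> 'a \<Rightarrow> real" UNIV "unit_ball_vol (real p) / 2 ^ p" p
    using assms(1) by (rule gauge_dist)
  show ?thesis unfolding hausdorff_measure_def by (rule emeasure_caratheodory[OF assms(2)])
qed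

lemma sets_hausdorff [simp, measurable_cong]: "sets (hausdorff_measure p) = sets borel"
  unfolding hausdorff_measure_def using sets.sigma_sets_eq[of "borel"] by simp

definition hausdorff_const :: "'a::euclidean_space itself \<Rightarrow> ennreal" where
  "hausdorff_const _ = emeasure (hausdorff_measure DIM('a)) (box 0 (One :: 'a))"

lemma hausdorff_const_finite: "hausdorff_const TYPE('a::euclidean_space) < top"
  unfolding hausdorff_const_def by (subst emeasure_hausdorff) (auto intro: caratheodory_outer_box_finite)

lemma hausdorff_measure_eq_lborel:
  assumes A: "A \<in> sets borel"
  shows "emeasure (hausdorff_measure DIM('a)) A = hausdorff_const TYPE('a) * emeasure lborel (A :: 'a::euclidean_space set)"
  unfolding hausdorff_const_def
proof (rule translation_invariant_measure_eq_lborel[OF _ _ _ A])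
  fix a :: 'a and X :: "'a set" assume X: "X \<in> sets borel"
  have X': "(\<lambda>x. a + x) -` X \<in> sets borel"
    using measurable_sets[of "\<lambda>x. a + x" borel borel X] X by simp
  have "X = (\<lambda>x. a + x) ` ((\<lambda>x. a + x) -` X)" by (auto intro!: image_eqI[of _ _ "_ - a"])
  then have "caratheodory_outer dist UNIV c p X = caratheodory_outer dist UNIV c p ((\<lambda>x. a + x) -` X)" for c p
    by (metis caratheodory_outer_isometric_image dist_add_cancel)
  then show "emeasure (hausdorff_measure DIM('a)) ((\<lambda>x. a + x) -` X) = emeasure (hausdorff_measure DIM('a)) X"
    using X X' by (simp add: emeasure_hausdorff)
qed (use hausdorff_const_finite in \<open>auto simp: hausdorff_const_def\<close>)

lemma emeasure_hausdorff_isometry: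
  fixes \<iota> :: "'e::euclidean_space \<Rightarrow> 'b::euclidean_space"
  assumes \<iota>: "linear \<iota>" "\<And>x. norm (\<iota> x) = norm x" and S: "S \<in> sets borel"
  shows "emeasure (hausdorff_measure DIM('e)) (S \<inter> range \<iota>) = hausdorff_const TYPE('e) * emeasure lborel (\<iota> -` S)"
proof -
  have m: "\<iota> -` S \<in> sets borel" by (rule vimage_in_borel[OF borel_measurable_linear[OF \<iota>(1)] S])
  have "closed (range \<iota>)" using \<iota>(1) by (intro closed_subspace linear_subspace_image) auto
  then have Sr: "S \<inter> range \<iota> \<in> sets borel" using S by auto
  have "S \<inter> range \<iota> = \<iota> ` (\<iota> -` S)" by auto
  moreover have "dist (\<iota> x) (\<iota> y) = dist x y" for x y
    using \<iota> by (metis dist_norm linear_diff)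
  ultimately have "caratheodory_outer dist UNIV c p (S \<inter> range \<iota>) = caratheodory_outer dist UNIV c p (\<iota> -` S)" for c p
    by (metis caratheodory_outer_isometric_image)
  then show ?thesis
    using hausdorff_measure_eq_lborel[OF m] m Sr by (simp add: emeasure_hausdorff)
qed

text \<open>An indicator density concentrates the Hausdorff measure on the subspace; it then
  coincides, as a Borel measure on the ambient space, with a multiple of the image of Lebesgue
  measure.\<close>

lemma nn_integral_hausdorff_isometry:
  fixes \<iota> :: "'e::euclidean_space \<Rightarrow> 'b::euclidean_space"
  assumes \<iota>: "linear \<iota>" "\<And>x. norm (\<iota> x) = norm x" and h[measurable]: "h \<in> borel_measurable borel"
  shows "(\<integral>\<^sup>+x. h x * indicator (range \<iota>) x \<partial>hausdorff_measure DIM('e))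
    = hausdorff_const TYPE('e) * (\<integral>\<^sup>+e. h (\<iota> e) \<partial>lborel)"
proof -
  have m[measurable]: "\<iota> \<in> borel_measurable borel" by (rule borel_measurable_linear[OF \<iota>(1)])
  have "closed (range \<iota>)" using \<iota>(1) by (intro closed_subspace linear_subspace_image) auto
  then have R[measurable]: "range \<iota> \<in> sets borel" by auto
  have eq: "density (hausdorff_measure DIM('e)) (indicator (range \<iota>)) =
      density (distr lborel borel \<iota>) (\<lambda>_. hausdorff_const TYPE('e))" (is "?L = ?R")
  proof (rule measure_eqI)
    fix S assume "S \<in> sets ?L"
    then have S: "S \<in> sets borel" by simp
    have "emeasure ?L S = emeasure (hausdorff_measure DIM('e)) (S \<inter> range \<iota>)"
      using S by (subst emeasure_density)
        (auto simp flip: nn_integral_indicator intro!: nn_integral_cong split: split_indicator)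
    also have "\<dots> = hausdorff_const TYPE('e) * emeasure lborel (\<iota> -` S)"
      by (rule emeasure_hausdorff_isometry[OF \<iota> S])
    also have "\<dots> = emeasure ?R S"
      using S by (subst emeasure_density) (auto simp: nn_integral_cmult_indicator emeasure_distr)
    finally show "emeasure ?L S = emeasure ?R S" .
  qed simp
  have "(\<integral>\<^sup>+x. h x * indicator (range \<iota>) x \<partial>hausdorff_measure DIM('e)) = (\<integral>\<^sup>+x. h x \<partial>?L)"
    by (subst nn_integral_density) (auto simp: mult.commute)
  also have "\<dots> = hausdorff_const TYPE('e) * (\<integral>\<^sup>+e. h (\<iota> e) \<partial>lborel)"
    unfolding eq by (subst nn_integral_density) (auto simp: nn_integral_cmult nn_integral_distr)
  finally show ?thesis .
qed

section \<open>Block determinants and multivector norms\<close>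

text \<open>The index type is split as the disjoint union of the ranges of \<open>f\<close> and \<open>g\<close>. Only the permutations that
  preserve \<open>range g\<close> contribute to the determinant, and these are the pairs of permutations of the two blocks.\<close>

lemma det_block_triangular:
  fixes A :: "real^'c^'c::finite" and f :: "'a::finite \<Rightarrow> 'c" and g :: "'b::finite \<Rightarrow> 'c"
  assumes f: "inj f" and g: "inj g" and disj: "range f \<inter> range g = {}" and un: "range f \<union> range g = UNIV"
    and zero: "\<And>i j. A $ g i $ f j = 0"
  shows "det A = det (\<chi> i j. A $ f i $ f j) * det (\<chi> i j. A $ g i $ g j)"
proof -
  define F where "F p = map_permutation UNIV f p" for p
  define G where "G p = map_permutation UNIV g p" for p
  have bf: "bij_betw f UNIV (range f)" and bg: "bij_betw g UNIV (range g)"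
    using f g by (auto simp: bij_betw_def)
  have Ff: "F p (f x) = f (p x)" for p x unfolding F_def using f by (rule map_permutation_apply) simp
  have Gg: "G p (g x) = g (p x)" for p x unfolding G_def using g by (rule map_permutation_apply) simp
  have Fp: "F p permutes range f" if "p permutes UNIV" for p
    unfolding F_def using bf that by (rule map_permutation_permutes)
  have Gp: "G p permutes range g" if "p permutes UNIV" for p
    unfolding G_def using bg that by (rule map_permutation_permutes)
  have Fg: "F p (g x) = g x" if "p permutes UNIV" for p x
    using permutes_not_in[OF Fp[OF that], of "g x"] disj by blast
  have Gf: "G p (f x) = f x" if "p permutes UNIV" for p x
    using permutes_not_in[OF Gp[OF that], of "f x"] disj by blast
  define h where "h = (\<lambda>(p, q). F p \<circ> G q)"
  have hf: "h (p, q) (f x) = f (p x)" if "q permutes UNIV" for p q x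
    using that by (simp add: h_def Gf Ff)
  have hg: "h (p, q) (g x) = g (q x)" if "p permutes UNIV" for p q x
    using that by (simp add: h_def Gg Fg)
  let ?P = "{p. p permutes (UNIV :: 'a set)} \<times> {q. q permutes (UNIV :: 'b set)}"
  define Q where "Q = {p. p permutes (UNIV :: 'c set) \<and> p ` range g \<subseteq> range g}"
  have Fpu: "F p permutes UNIV" if "p permutes UNIV" for p using permutes_subset[OF Fp[OF that]] by simp
  have Gpu: "G p permutes UNIV" if "p permutes UNIV" for p using permutes_subset[OF Gp[OF that]] by simp
  have bij: "bij_betw h ?P Q"
  proof (rule bij_betw_imageI)
    show "inj_on h ?P"
    proof (rule inj_onI, clarify)
      fix p q p' q' assume p: "p permutes (UNIV :: 'a set)" "q permutes (UNIV :: 'b set)"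
         "p' permutes (UNIV :: 'a set)" "q' permutes (UNIV :: 'b set)" and eq: "h (p, q) = h (p', q')"
      have "f (p x) = f (p' x)" for x using hf[OF p(2), of p x] hf[OF p(4), of p' x] eq by simp
      moreover have "g (q x) = g (q' x)" for x using hg[OF p(1), of q x] hg[OF p(3), of q' x] eq by simp
      ultimately show "p = p' \<and> q = q'" using f g by (auto simp: fun_eq_iff inj_def)
    qed
    show "h ` ?P = Q"
    proof (intro antisym subsetI)
      fix r assume "r \<in> h ` ?P"
      then obtain p q where p: "p permutes (UNIV :: 'a set)" "q permutes (UNIV :: 'b set)" "r = h (p, q)" by auto
      have "r permutes UNIV" using p Fpu Gpu by (auto simp: h_def intro: permutes_compose)
      moreover have "r ` range g \<subseteq> range g" using p hg by auto
      ultimately show "r \<in> Q" by (simp add: Q_def)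
    next
      fix r assume "r \<in> Q"
      then have r: "r permutes UNIV" "r ` range g \<subseteq> range g" by (auto simp: Q_def)
      have ir: "inj r" using r(1) by (simp add: permutes_inj)
      \<comment> \<open>An injective map of a finite set into itself is onto, so r permutes
        \<open>range g\<close> and therefore also its complement \<open>range f\<close>.\<close>
      have rg: "r ` range g = range g"
        by (rule card_subset_eq[OF _ r(2)]) (auto simp: card_image inj_on_subset[OF ir])
      have rf: "r ` range f \<subseteq> range f"
      proof clarify
        fix x show "r (f x) \<in> range f"
        proof (rule ccontr)
          assume "r (f x) \<notin> range f"
          then have "r (f x) \<in> r ` range g" using un rg by blast
          then have "f x \<in> range g" using ir by (auto simp: inj_def)
          then show False using disj by blast
        qed
      qed
      define p where "p x = inv_into UNIV f (r (f x))" for x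
      define q where "q x = inv_into UNIV g (r (g x))" for x
      have fp: "f (p x) = r (f x)" for x using rf unfolding p_def by (intro f_inv_into_f) auto
      have gq: "g (q x) = r (g x)" for x using rg unfolding q_def by (intro f_inv_into_f) auto
      have "inj p"
        by (rule injI) (metis fp f ir injD)
      then have p: "p permutes UNIV" by (intro bij_imp_permutes) (auto simp: bij_betw_def finite_UNIV_inj_surj)
      have "inj q"
        by (rule injI) (metis gq g ir injD)
      then have q: "q permutes UNIV" by (intro bij_imp_permutes) (auto simp: bij_betw_def finite_UNIV_inj_surj)
      have "h (p, q) x = r x" for x
        using un hf[OF q, of p] hg[OF p, of q] fp gq by (metis UNIV_I UnE rangeE)
      then show "r \<in> h ` ?P" using p q by (intro image_eqI[of _ _ "(p, q)"]) auto
    qed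
  qed
  have "det A = (\<Sum>p\<in>{p. p permutes UNIV}. of_int (sign p) * (\<Prod>i\<in>UNIV. A $ i $ p i))"
    by (simp add: det_def)
  also have "\<dots> = (\<Sum>p\<in>Q. of_int (sign p) * (\<Prod>i\<in>UNIV. A $ i $ p i))"
  proof (rule sum.mono_neutral_right)
    show "\<forall>p\<in>{p. p permutes UNIV} - Q. of_int (sign p) * (\<Prod>i\<in>UNIV. A $ i $ p i) = 0"
    proof
      fix p assume "p \<in> {p. p permutes UNIV} - Q"
      then obtain x where "p (g x) \<notin> range g" by (auto simp: Q_def)
      then obtain y where "p (g x) = f y" using un by blast
      then have "A $ g x $ p (g x) = 0" using zero by simp
      then have "(\<Prod>i\<in>UNIV. A $ i $ p i) = 0" by (intro prod_zero) auto
      then show "of_int (sign p) * (\<Prod>i\<in>UNIV. A $ i $ p i) = 0" by simp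
    qed
  qed (auto simp: Q_def)
  also have "\<dots> = (\<Sum>pq\<in>?P. of_int (sign (h pq)) * (\<Prod>i\<in>UNIV. A $ i $ h pq i))"
    by (rule sum.reindex_bij_betw[OF bij, symmetric])
  also have "\<dots> = (\<Sum>(p, q)\<in>?P. (of_int (sign p) * (\<Prod>i\<in>UNIV. A $ f i $ f (p i))) *
      (of_int (sign q) * (\<Prod>i\<in>UNIV. A $ g i $ g (q i))))"
  proof (rule sum.cong[OF refl], clarify)
    fix p q assume p: "p permutes (UNIV :: 'a set)" "q permutes (UNIV :: 'b set)"
    have "sign (h (p, q)) = sign (F p) * sign (G q)"
      using permutes_imp_permutation[OF _ Fpu[OF p(1)]] permutes_imp_permutation[OF _ Gpu[OF p(2)]]
      by (simp add: h_def sign_compose)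
    also have "sign (F p) = sign p" unfolding F_def using p f by (intro sign_map_permutation) auto
    also have "sign (G q) = sign q" unfolding G_def using p g by (intro sign_map_permutation) auto
    finally have s: "sign (h (p, q)) = sign p * sign q" .
    have "(\<Prod>i\<in>UNIV. A $ i $ h (p, q) i) = (\<Prod>i\<in>range f \<union> range g. A $ i $ h (p, q) i)" by (simp add: un)
    also have "\<dots> = (\<Prod>i\<in>range f. A $ i $ h (p, q) i) * (\<Prod>i\<in>range g. A $ i $ h (p, q) i)"
      using disj by (intro prod.union_disjoint) auto
    also have "\<dots> = (\<Prod>i\<in>UNIV. A $ f i $ f (p i)) * (\<Prod>i\<in>UNIV. A $ g i $ g (q i))"
      using f g hf[OF p(2)] hg[OF p(1)] by (simp add: prod.reindex)
    finally show "of_int (sign (h (p, q))) * (\<Prod>i\<in>UNIV. A $ i $ h (p, q) i) =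
       (of_int (sign p) * (\<Prod>i\<in>UNIV. A $ f i $ f (p i))) * (of_int (sign q) * (\<Prod>i\<in>UNIV. A $ g i $ g (q i)))"
      by (simp add: s)
  qed
  also have "\<dots> = (\<Sum>p\<in>{p. p permutes UNIV}. of_int (sign p) * (\<Prod>i\<in>UNIV. A $ f i $ f (p i))) *
      (\<Sum>q\<in>{q. q permutes UNIV}. of_int (sign q) * (\<Prod>i\<in>UNIV. A $ g i $ g (q i)))"
    by (simp add: sum_product sum.cartesian_product)
  also have "\<dots> = det (\<chi> i j. A $ f i $ f j) * det (\<chi> i j. A $ g i $ g j)"
    by (simp add: det_def)
  finally show ?thesis .
qed

section \<open>Orthonormal frames and norms of simple multivectors\<close>

lemma det_mat_one: "det (\<chi> i j. if i = j then 1 :: real else 0) = 1"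
  unfolding mat_def[symmetric] by (rule det_I)

lemma span_range_finite:
  fixes b :: "'i::finite \<Rightarrow> 'a::real_vector"
  assumes "x \<in> span (range b)"
  shows "\<exists>c. x = (\<Sum>i\<in>UNIV. c i *\<^sub>R b i)"
  using assms
proof (induction rule: span_induct_alt)
  case base
  show ?case by (rule exI[of _ "\<lambda>_. 0"]) simp
next
  case (step a x y)
  then obtain i c where "x = b i" "y = (\<Sum>i\<in>UNIV. c i *\<^sub>R b i)" by auto
  then have "a *\<^sub>R x + y = (\<Sum>j\<in>UNIV. ((if j = i then a else 0) + c j) *\<^sub>R b j)"
    by (simp add: scaleR_add_left sum.distrib if_distrib[of "\<lambda>t. t *\<^sub>R _"] cong: if_cong)
  then show ?case by (rule exI[of _ "\<lambda>j. (if j = i then a else 0) + c j"])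
qed

lemma orthonormal_basis_expand:
  assumes "orthonormal_basis_of b S" "x \<in> S"
  shows "x = (\<Sum>i\<in>UNIV. (x \<bullet> b i) *\<^sub>R b (i :: 'i::finite))"
proof -
  have orth: "b i \<bullet> b j = (if i = j then 1 else 0)" for i j
    using assms(1) by (simp add: orthonormal_basis_of_def)
  have "x \<in> span (range b)" using assms by (simp add: orthonormal_basis_of_def)
  then obtain c where c: "x = (\<Sum>i\<in>UNIV. c i *\<^sub>R b i)" using span_range_finite by blast
  have "x \<bullet> b j = c j" for j
    unfolding c by (simp add: inner_sum_left orth if_distrib[of "\<lambda>t. _ * t"] cong: if_cong)
  then show ?thesis using c by simp
qed

lemma inner_orthonormal_basis:
  assumes "orthonormal_basis_of b S" "x \<in> S"
  shows "x \<bullet> y = (\<Sum>i\<in>UNIV. (x \<bullet> b i) * (b (i :: 'i::finite) \<bullet> y))"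
  by (subst orthonormal_basis_expand[OF assms]) (simp add: inner_sum_left)

text \<open>The Gram matrix of \<open>c\<close> is the product of its coordinate matrix in the basis
  \<open>b\<close> with the transpose, so the Gram determinant is a square.\<close>

lemma multivector_norm_wedge_orthonormal:
  fixes b c :: "'i::finite \<Rightarrow> 'a::euclidean_space"
  assumes "orthonormal_basis_of b S" "\<And>i. c i \<in> S"
  shows "multivector_norm (wedge c) = \<bar>det (\<chi> i j. c i \<bullet> b j)\<bar>"
proof -
  let ?C = "\<chi> i j. c i \<bullet> b j"
  have "c i \<bullet> c j = (\<Sum>l\<in>UNIV. (c i \<bullet> b l) * (c j \<bullet> b l))" for i j
    using inner_orthonormal_basis[OF assms(1) assms(2)[of i], of "c j"]
    by (simp only: inner_commute[of "c j"])
  then have "(\<chi> i j. c i \<bullet> c j) = ?C ** transpose ?C"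
    by (simp add: vec_eq_iff matrix_matrix_mult_def transpose_def)
  then have "det (\<chi> i j. c i \<bullet> c j) = (det ?C)\<^sup>2"
    by (simp add: det_mul power2_eq_square)
  then show ?thesis by (simp add: multivector_norm_wedge)
qed

lemma orthonormal_family_independent:
  fixes b :: "'i \<Rightarrow> 'a::euclidean_space"
  assumes orth: "\<And>i j. b i \<bullet> b j = (if i = j then 1 else 0)"
  shows "inj b" "independent (range b)"
proof -
  show "inj b" by (rule injI) (metis orth zero_neq_one)
  show "independent (range b)"
  proof (rule pairwise_orthogonal_independent)
    show "pairwise orthogonal (range b)" using orth by (auto simp: pairwise_def orthogonal_def)
    show "0 \<notin> range b" using orth by (metis inner_zero_left rangeE zero_neq_one)
  qed
qed

lemma dim_orthonormal_basis:
  fixes b :: "'i::finite \<Rightarrow> 'a::euclidean_space"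
  assumes "orthonormal_basis_of b S"
  shows "dim S = CARD('i)"
proof -
  have b: "b i \<bullet> b j = (if i = j then 1 else 0)" for i j
    using assms by (simp add: orthonormal_basis_of_def)
  have S: "span (range b) = S" using assms by (simp add: orthonormal_basis_of_def)
  have "dim (range b) = CARD('i)"
    using orthonormal_family_independent[OF b] by (simp add: dim_eq_card_independent card_image)
  then show ?thesis using dim_span[of "range b"] S by simp
qed

lemma orthonormal_span_eq_UNIV:
  fixes b :: "'i::finite \<Rightarrow> 'a::euclidean_space"
  assumes orth: "\<And>i j. b i \<bullet> b j = (if i = j then 1 else 0)" and card: "CARD('i) = DIM('a)"
  shows "orthonormal_basis_of b UNIV"
proof -
  note ind = orthonormal_family_independent[OF orth]
  have "UNIV \<subseteq> span (range b)"
    by (rule card_ge_dim_independent[OF _ ind(2)]) (use ind(1) card in \<open>auto simp: card_image\<close>)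
  then show ?thesis using orth by (auto simp: orthonormal_basis_of_def)
qed

lemma orthonormal_basis_of_subspace_exists:
  fixes S :: "'a::euclidean_space set"
  assumes "subspace S" "dim S = CARD('i::finite)"
  shows "\<exists>b :: 'i \<Rightarrow> 'a. orthonormal_basis_of b S"
proof -
  obtain B where B: "B \<subseteq> S" "pairwise orthogonal B" "\<And>x. x \<in> B \<Longrightarrow> norm x = 1"
    "independent B" "card B = dim S" "span B = S"
    using orthonormal_basis_subspace[OF assms(1)] by metis
  have "finite B" using B(4) by (rule independent_imp_finite)
  then obtain b where b: "bij_betw b (UNIV :: 'i set) B"
    using B(5) assms(2) finite_same_card_bij[of "UNIV :: 'i set" B] by auto
  have "b i \<bullet> b j = (if i = j then 1 else 0)" for i j
  proof (cases "i = j")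
    case True
    then show ?thesis using B(3)[of "b i"] b by (auto simp: bij_betw_def dot_square_norm)
  next
    case False
    then have "b i \<noteq> b j" "b i \<in> B" "b j \<in> B" using b by (auto simp: bij_betw_def inj_def)
    then show ?thesis using B(2) False by (auto simp: pairwise_def orthogonal_def)
  qed
  then show ?thesis
    using b B(6) unfolding orthonormal_basis_of_def by (intro exI[of _ b]) (simp add: bij_betw_def)
qed

text \<open>The left-hand determinant is the Jacobian of the projection onto the common orthogonal complement of the
  \<open>g i\<close> along the span of the \<open>v i\<close>.\<close>

lemma jacobian_projection_along:
  fixes v \<nu> g :: "'k::finite \<Rightarrow> 'a::euclidean_space" and w \<tau> l :: "'m::finite \<Rightarrow> 'a" and e :: 'a
  assumes basis: "orthonormal_basis_of (case_sum \<nu> (case_option e \<tau>)) UNIV"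
    and \<nu>: "orthonormal_basis_of \<nu> (span (range g))"
    and ve: "\<And>i. v i \<bullet> e = 0" and we: "\<And>i. w i \<bullet> e = 0"
    and l: "\<And>i. l i \<in> span (range v)"
    and gl: "\<And>i j. g j \<bullet> (w i + l i) = 0"
    and ge: "\<And>i. g i \<bullet> e = 0"
    and nz: "det (\<chi> i j. g i \<bullet> v j) \<noteq> 0"
  shows "\<bar>det (\<chi> i j. (w i + l i) \<bullet> \<tau> j)\<bar> =
    multivector_norm (wedge (case_sum v (case_option e w))) * (multivector_norm (wedge g) / \<bar>det (\<chi> i j. g i \<bullet> v j)\<bar>)"
proof -
  let ?b = "case_sum \<nu> (case_option e \<tau>)"
  let ?c = "case_sum v (case_option e w)"
  let ?c' = "case_sum v (case_option e (\<lambda>i. w i + l i))"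
  let ?C = "\<chi> i j. ?c i \<bullet> ?b j" and ?C' = "\<chi> i j. ?c' i \<bullet> ?b j"
  have orth: "?b i \<bullet> ?b j = (if i = j then 1 else 0)" for i j
    using basis by (simp add: orthonormal_basis_of_def)
  have e\<tau>: "e \<bullet> \<tau> j = 0" for j using orth[of "Inr None" "Inr (Some j)"] by simp
  have e\<nu>: "e \<bullet> \<nu> j = 0" for j using orth[of "Inr None" "Inl j"] by simp
  have ee: "e \<bullet> e = 1" using orth[of "Inr None" "Inr None"] by simp
  have le: "l i \<bullet> e = 0" for i
    using l[of i] by (induction rule: span_induct_alt) (auto simp: inner_add_left ve)
  have \<nu>wl: "(w i + l i) \<bullet> \<nu> j = 0" for i j
  proof -
    have "\<nu> j \<in> span (range g)" using \<nu> span_base[of "\<nu> j" "range \<nu>"] by (auto simp: orthonormal_basis_of_def)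
    then have "\<nu> j \<bullet> (w i + l i) = 0"
      by (induction rule: span_induct_alt) (auto simp: inner_add_left gl)
    then show ?thesis by (simp add: inner_commute)
  qed
  have "\<exists>x. l i = (\<Sum>j\<in>UNIV. x j *\<^sub>R v j)" for i
    using span_range_finite[OF l] .
  then obtain X where X: "\<And>i. l i = (\<Sum>j\<in>UNIV. X i j *\<^sub>R v j)" by metis
  have inl_inr: "inj Inl" "inj Inr" "range Inl \<inter> range Inr = {}" "range Inl \<union> range Inr = UNIV"
    "range Inr \<inter> range Inl = {}" "range Inr \<union> range Inl = UNIV"
    by (auto, (metis rangeI sumE)+)
  \<comment> \<open>The change of frame from v, e, w to v, e, w + l. It is unipotent because each l
    i lies in the span of v, so replacing w by w + l leaves the determinant unchanged.\<close>
  define G :: "real^('k + 'm option)^('k + 'm option)" where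
    "G = (\<chi> a b. case a of Inl i \<Rightarrow> (if b = Inl i then 1 else 0)
       | Inr None \<Rightarrow> (if b = Inr None then 1 else 0)
       | Inr (Some i) \<Rightarrow> (case b of Inl j \<Rightarrow> X i j | Inr b' \<Rightarrow> (if b' = Some i then 1 else 0)))"
  have "det G = det (\<chi> i j. G $ Inr i $ Inr j) * det (\<chi> i j. G $ Inl i $ Inl j)"
    by (rule det_block_triangular) (use inl_inr in \<open>auto simp: G_def\<close>)
  also have "(\<chi> i j. G $ Inr i $ Inr j) = (\<chi> i j. if i = j then 1 else 0)"
    by (auto simp: G_def vec_eq_iff split: option.splits)
  also have "(\<chi> i j. G $ Inl i $ Inl j) = (\<chi> i j. if i = j then 1 else 0)"
    by (auto simp: G_def vec_eq_iff)
  finally have detG: "det G = 1" by (simp add: det_mat_one)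
  have "?C' = G ** ?C"
  proof -
    have sum_split: "(\<Sum>a\<in>UNIV. F a) = (\<Sum>i\<in>UNIV. F (Inl i)) + (F (Inr None) + (\<Sum>i\<in>UNIV. F (Inr (Some i))))"
      for F :: "'k + 'm option \<Rightarrow> real"
      by (simp add: UNIV_Plus_UNIV[symmetric] sum.Plus UNIV_option_conv sum.reindex)
    have "?c' a \<bullet> ?b c = (\<Sum>b\<in>UNIV. G $ a $ b * (?c b \<bullet> ?b c))" for a c
      unfolding sum_split
      by (auto simp: G_def X inner_add_left inner_sum_left if_distrib[of "\<lambda>t. t * _"] split: sum.splits option.splits cong: if_cong)
    then show ?thesis by (simp add: vec_eq_iff matrix_matrix_mult_def)
  qed
  then have CC': "det ?C = det ?C'" by (simp add: det_mul detG)
  \<comment> \<open>In the frame \<nu>, e, \<tau> the vectors e and w + l have no \<nu>-components,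
    and w + l has no e-component; two block splittings isolate the \<tau>-block.\<close>
  have "det ?C' = det (\<chi> i j. ?C' $ Inl i $ Inl j) * det (\<chi> i j. ?C' $ Inr i $ Inr j)"
    by (rule det_block_triangular) (use inl_inr in \<open>auto simp: \<nu>wl e\<nu> split: option.splits\<close>)
  also have "(\<chi> i j. ?C' $ Inl i $ Inl j) = (\<chi> i j. v i \<bullet> \<nu> j)" by simp
  also have "det (\<chi> i j. ?C' $ Inr i $ Inr j) = det (\<chi> (i::1) j. ?C' $ Inr None $ Inr None) *
      det (\<chi> i j. ?C' $ Inr (Some i) $ Inr (Some j))"
  proof -
    have 1: "inj (\<lambda>_::1. None :: 'm option)" by (rule injI) (simp add: num1_eq_iff)
    show ?thesis
      by (subst det_block_triangular[of "\<lambda>_::1. None :: 'm option" Some])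
        (use 1 in \<open>auto simp: ve we le inner_add_left UNIV_option_conv\<close>)
  qed
  also have "det (\<chi> (i::1) j. ?C' $ Inr None $ Inr None) = 1"
    by (simp add: det_1 ee)
  also have "(\<chi> i j. ?C' $ Inr (Some i) $ Inr (Some j)) = (\<chi> i j. (w i + l i) \<bullet> \<tau> j)" by simp
  finally have detC: "det ?C = det (\<chi> i j. v i \<bullet> \<nu> j) * det (\<chi> i j. (w i + l i) \<bullet> \<tau> j)"
    using CC' by simp
  have N: "multivector_norm (wedge ?c) = \<bar>det ?C\<bar>"
    by (rule multivector_norm_wedge_orthonormal[OF basis]) simp
  have H: "multivector_norm (wedge g) = \<bar>det (\<chi> i j. g i \<bullet> \<nu> j)\<bar>"
    by (rule multivector_norm_wedge_orthonormal[OF \<nu>]) (simp add: span_base)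
  \<comment> \<open>The pairing of g and v factors through \<nu>, an orthonormal basis of the span
    of g. The determinant of v against \<nu> thus occurs in this pairing and in the frame norm, and
    cancels.\<close>
  have "g i \<bullet> v j = (\<Sum>l\<in>UNIV. (g i \<bullet> \<nu> l) * (v j \<bullet> \<nu> l))" for i j
    using inner_orthonormal_basis[OF \<nu>, of "g i" "v j"]
    by (simp only: inner_commute[of "v j"] span_base rangeI)
  then have "(\<chi> i j. g i \<bullet> v j) = (\<chi> i j. g i \<bullet> \<nu> j) ** transpose (\<chi> i j. v i \<bullet> \<nu> j)"
    by (simp add: vec_eq_iff matrix_matrix_mult_def transpose_def)
  then have V: "det (\<chi> i j. g i \<bullet> v j) = det (\<chi> i j. g i \<bullet> \<nu> j) * det (\<chi> i j. v i \<bullet> \<nu> j)"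
    by (simp add: det_mul)
  show ?thesis unfolding N H V detC using nz unfolding V by (simp add: abs_mult field_simps)
qed

section \<open>Homogeneous homomorphisms and horizontal gradients\<close>

lemma vertical_eq: "(0, s) = s *\<^sub>R e_top"
  by (simp add: e_top_def)

lemma snd_e_top [simp]: "snd e_top = 1"
  by (simp add: e_top_def)

lemma inner_e_top [simp]: "x \<bullet> e_top = snd x" "e_top \<bullet> x = snd x"
  by (simp_all add: e_top_def inner_prod_def)

text \<open>Additivity on the centre and homogeneity of degree one are incompatible with the degree-two dilation
  of the centre, so homogeneous homomorphisms into vector groups vanish there.\<close>

lemma h_homomorphism_linear_on:
  fixes L :: "'n::finite heis \<Rightarrow> 'b::real_vector"
  assumes S: "subspace S" "e_top \<in> S"
    and add: "\<And>x y. x \<in> S \<Longrightarrow> y \<in> S \<Longrightarrow> L (x \<odot> y) = L x + L y"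
    and dil: "\<And>t x. t > 0 \<Longrightarrow> x \<in> S \<Longrightarrow> L (dil t x) = t *\<^sub>R L x"
  shows "L (0, s) = 0" "x \<in> S \<Longrightarrow> y \<in> S \<Longrightarrow> L (x + y) = L x + L y" "x \<in> S \<Longrightarrow> L (c *\<^sub>R x) = c *\<^sub>R L x"
proof -
  have zS: "(0, s) \<in> S" for s using S by (simp add: vertical_eq subspace_scale)
  show z: "L (0, s) = 0" for s
  proof -
    \<comment> \<open>Dilation by sqrt 2 doubles a central coordinate, and so does multiplying the
      element by itself; hence L is both doubled and multiplied by sqrt 2.\<close>
    have "dil (sqrt 2) (0, s) = (0, s) \<odot> (0, s)" by (simp add: prod_eq_iff)
    moreover have "L (dil (sqrt 2) (0, s)) = sqrt 2 *\<^sub>R L (0, s)" using zS by (intro dil) auto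
    ultimately have "sqrt 2 *\<^sub>R L (0, s) = L (0, s) + L (0, s)" using add[OF zS zS, of s s] by metis
    then have "(2 - sqrt 2) *\<^sub>R L (0, s) = 0" by (simp add: scaleR_diff_left scaleR_2)
    moreover have "sqrt 2 \<noteq> (2::real)"
      by (metis numeral_eq_one_iff power2_eq_square real_sqrt_pow2 zero_le_numeral mult_cancel_left2 numeral_eq_iff semiring_norm(85) zero_neq_numeral)
    ultimately show ?thesis by simp
  qed
  \<comment> \<open>Products differ from sums, and dilations from scalar multiples, only by central
    factors, which L does not see.\<close>
  have shift: "L (x \<odot> (0, s)) = L x" if "x \<in> S" for x s using add[OF that zS] z by simp
  show add': "L (x + y) = L x + L y" if "x \<in> S" "y \<in> S" for x y
  proof -
    have "x \<odot> y = (x + y) \<odot> (0, symp (fst x) (fst y) / 2)" by (simp add: prod_eq_iff)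
    then have "L (x \<odot> y) = L (x + y)" using shift[of "x + y"] that S by (simp add: subspace_add)
    then show ?thesis using add that by simp
  qed
  have pos: "L (c *\<^sub>R x) = c *\<^sub>R L x" if "c > 0" "x \<in> S" for c x
  proof -
    have "dil c x = (c *\<^sub>R x) \<odot> (0, (c\<^sup>2 - c) * snd x)" by (simp add: prod_eq_iff algebra_simps)
    then have "L (dil c x) = L (c *\<^sub>R x)" using shift[of "c *\<^sub>R x"] that S by (simp add: subspace_scale)
    then show ?thesis using dil that by simp
  qed
  have z0: "L 0 = 0" using z[of 0] by (simp add: zero_prod_def)
  show "L (c *\<^sub>R x) = c *\<^sub>R L x" if x: "x \<in> S"
  proof -
    consider "c > 0" | "c = 0" | "c < 0" by linarith
    then show ?thesis
    proof cases
      case 3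
      have "L (c *\<^sub>R x + (- c) *\<^sub>R x) = L (c *\<^sub>R x) + L ((- c) *\<^sub>R x)"
        using x S by (intro add') (auto simp: subspace_scale subspace_neg)
      then have "L (c *\<^sub>R x) = - L ((- c) *\<^sub>R x)" using z0 by (simp add: eq_neg_iff_add_eq_0)
      then show ?thesis using pos[of "- c" x] 3 x by simp
    qed (use pos x z0 in auto)
  qed
qed

lemma h_homomorphism_vec_groupD:
  assumes "h_homomorphism heis_group dil vec_group (*\<^sub>R) L"
  shows "linear L" "L e_top = 0"
    and "t > 0 \<Longrightarrow> L (dil t x) = t *\<^sub>R L x" "L (x \<odot> y) = L x + L y"
proof -
  have hom: "L (x \<odot> y) = L x + L y" "t > 0 \<Longrightarrow> L (dil t x) = t *\<^sub>R L x" for x y t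
    using assms
    by (simp_all add: h_homomorphism_def hom_def heis_group_def vec_group_def del: split_paired_All)
  then show "t > 0 \<Longrightarrow> L (dil t x) = t *\<^sub>R L x" "L (x \<odot> y) = L x + L y" by auto
  note lin = h_homomorphism_linear_on[of UNIV L, OF subspace_UNIV UNIV_I hom]
  show "linear L" using lin by (intro linearI) auto
  show "L e_top = 0" using lin(1)[of 1] by (simp add: e_top_def)
qed

lemma tendsto_det [tendsto_intros]:
  fixes A :: "'a \<Rightarrow> 'i::finite \<Rightarrow> 'i \<Rightarrow> real"
  assumes "\<And>i j. ((\<lambda>x. A x i j) \<longlongrightarrow> B i j) F"
  shows "((\<lambda>x. det (\<chi> i j. A x i j)) \<longlongrightarrow> det (\<chi> i j. B i j)) F"
  unfolding det_def by (simp, intro tendsto_intros assms)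

context hdist
begin

section \<open>Uniqueness of the Pansu differential; gradients and Jacobians\<close>

lemma filterlim_dil_at_0:
  fixes x :: "'n heis"
  assumes "x \<noteq> 0"
  shows "filterlim (\<lambda>t. dil t x) (at 0) (at_right 0)"
proof -
  have "((\<lambda>t. dil t x) \<longlongrightarrow> dil 0 x) (at_right 0)" by (intro tendsto_intros)
  moreover have "dil 0 x = 0" by (simp add: prod_eq_iff)
  moreover have "\<forall>\<^sub>F t in at_right 0. (0::real) < t" by (rule eventually_at_right_less)
  then have "\<forall>\<^sub>F t in at_right 0. dil t x \<noteq> 0"
  proof eventually_elim
    case (elim t)
    then have "N (dil t x) \<noteq> 0" using assms by (simp add: N_dil)
    then show ?case by auto
  qed
  ultimately show ?thesis by (simp add: filterlim_at)
qed

text \<open>Both homomorphisms approximate the same increment up to o(N w), while their difference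
  divided by N w is constant along each dilation orbit; the constant must be zero. This is what
  makes the description in \<open>h_deriv\<close> definite.\<close>

lemma has_h_derivative_unique:
  assumes "has_h_derivative d f x L" "has_h_derivative d f x L'"
  shows "L = L'"
proof
  fix w
  have h: "h_homomorphism heis_group dil vec_group (*\<^sub>R) L" "h_homomorphism heis_group dil vec_group (*\<^sub>R) L'"
    using assms by (auto simp: has_h_derivative_def)
  show "L w = L' w"
  proof (cases "w = 0")
    case True
    then show ?thesis using h_homomorphism_vec_groupD(1)[OF h(1)] h_homomorphism_vec_groupD(1)[OF h(2)]
      by (simp add: linear_0)
  next
    case False
    have "((\<lambda>w. norm (f (x \<odot> w) - f x - L w) / N w + norm (f (x \<odot> w) - f x - L' w) / N w) \<longlongrightarrow> 0 + 0) (at 0)"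
      using assms by (intro tendsto_add) (auto simp: has_h_derivative_def)
    then have lim: "((\<lambda>w. norm (f (x \<odot> w) - f x - L w) / N w + norm (f (x \<odot> w) - f x - L' w) / N w) \<longlongrightarrow> 0) (at 0)"
      by simp
    have le: "norm (L w - L' w) / N w \<le> norm (f (x \<odot> w) - f x - L w) / N w + norm (f (x \<odot> w) - f x - L' w) / N w" for w
      using norm_triangle_ineq4[of "f (x \<odot> w) - f x - L' w" "f (x \<odot> w) - f x - L w"]
      by (simp add: add_divide_distrib[symmetric] divide_right_mono add.commute)
    have "((\<lambda>w. norm (L w - L' w) / N w) \<longlongrightarrow> 0) (at 0)"
      by (rule tendsto_sandwich[OF _ _ tendsto_const lim]) (use le in auto)
    then have "((\<lambda>t. norm (L (dil t w) - L' (dil t w)) / N (dil t w)) \<longlongrightarrow> 0) (at_right 0)"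
      using filterlim_dil_at_0[OF False] by (rule filterlim_compose)
    moreover have "\<forall>\<^sub>F t in at_right 0. (0::real) < t" by (rule eventually_at_right_less)
    then have "\<forall>\<^sub>F t in at_right 0. norm (L (dil t w) - L' (dil t w)) / N (dil t w) = norm (L w - L' w) / N w"
    proof eventually_elim
      case (elim t)
      then have "norm (L (dil t w) - L' (dil t w)) = t * norm (L w - L' w)"
        using h_homomorphism_vec_groupD(3)[OF h(1), of t w] h_homomorphism_vec_groupD(3)[OF h(2), of t w]
        by (simp add: scaleR_diff_right[symmetric])
      then show ?case using elim by (simp add: N_dil)
    qed
    ultimately have "((\<lambda>t::real. norm (L w - L' w) / N w) \<longlongrightarrow> 0) (at_right 0)"
      by (rule Lim_transform_eventually)
    then have "norm (L w - L' w) / N w = 0"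
      by (simp add: tendsto_const_iff trivial_limit_at_right_real)
    then show ?thesis using False by simp
  qed
qed

lemma h_deriv_eqI: "has_h_derivative d f x L \<Longrightarrow> h_deriv d f x = L"
  unfolding h_deriv_def using has_h_derivative_unique by blast

lemma has_h_derivative_component:
  fixes f :: "'n heis \<Rightarrow> real^'k::finite"
  assumes "has_h_derivative d f x L"
  shows "has_h_derivative d (\<lambda>y. f y $ i) x (\<lambda>z. L z $ i)"
  unfolding has_h_derivative_def
proof
  have h: "h_homomorphism heis_group dil vec_group (*\<^sub>R) L" using assms by (simp add: has_h_derivative_def)
  show "h_homomorphism heis_group dil vec_group (*\<^sub>R) (\<lambda>z. L z $ i)"
    using h by (simp add: h_homomorphism_def hom_def heis_group_def vec_group_def)
  have lim: "((\<lambda>w. norm (f (x \<odot> w) - f x - L w) / N w) \<longlongrightarrow> 0) (at 0)"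
    using assms by (simp add: has_h_derivative_def)
  have le: "norm (f (x \<odot> w) $ i - f x $ i - L w $ i) / N w \<le> norm (f (x \<odot> w) - f x - L w) / N w" for w
    using component_le_norm_cart[of "f (x \<odot> w) - f x - L w" i] by (intro divide_right_mono) auto
  show "((\<lambda>w. norm (f (x \<odot> w) $ i - f x $ i - L w $ i) / N w) \<longlongrightarrow> 0) (at 0)"
    by (rule tendsto_sandwich[OF _ _ tendsto_const lim]) (use le in auto)
qed

lemma grad_H:
  fixes f :: "'n heis \<Rightarrow> real^'k::finite"
  assumes "has_h_derivative d f x L"
  shows "snd (grad_H d (\<lambda>y. f y $ i) x) = 0" "L z $ i = grad_H d (\<lambda>y. f y $ i) x \<bullet> z"
proof -
  have h: "h_homomorphism heis_group dil vec_group (*\<^sub>R) (\<lambda>z. L z $ i)"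
    using has_h_derivative_component[OF assms] by (simp add: has_h_derivative_def)
  note lin = h_homomorphism_vec_groupD(1,2)[OF h]
  have D: "h_deriv d (\<lambda>y. f y $ i) x = (\<lambda>z. L z $ i)"
    by (rule h_deriv_eqI[OF has_h_derivative_component[OF assms]])
  define g where "g = (\<Sum>b\<in>Basis. (L b $ i) *\<^sub>R b)"
  have g: "L z $ i = g \<bullet> z" for z
  proof -
    have "L z $ i = L (\<Sum>b\<in>Basis. (z \<bullet> b) *\<^sub>R b) $ i" by (simp add: euclidean_representation)
    also have "\<dots> = (\<Sum>b\<in>Basis. (z \<bullet> b) * (L b $ i))"
      by (simp only: linear_sum[OF lin(1)] linear_scale[OF lin(1)] real_scaleR_def)
    also have "\<dots> = z \<bullet> g" by (simp add: g_def inner_sum_right mult.commute)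
    finally show ?thesis by (simp only: inner_commute[of z g])
  qed
  have "grad_H d (\<lambda>y. f y $ i) x = g"
    unfolding grad_H_def D
  proof (rule the_equality)
    have "snd g = g \<bullet> e_top" by simp
    then have "snd g = 0" using g[of e_top] lin(2) by simp
    then show "g \<in> H1 \<and> (\<forall>z. L z $ i = g \<bullet> z)" using g by (simp add: H1_def)
    show "g' = g" if "g' \<in> H1 \<and> (\<forall>z. L z $ i = g' \<bullet> z)" for g'
      using that g by (metis vector_eq_rdot)
  qed
  moreover have "snd g = 0" using g[of e_top] lin(2) by simp
  ultimately show "snd (grad_H d (\<lambda>y. f y $ i) x) = 0" "L z $ i = grad_H d (\<lambda>y. f y $ i) x \<bullet> z"
    using g by auto
qed

text \<open>Written through the values of L on the standard basis, so that continuity of the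
  differential, which is pointwise convergence, carries over to the Jacobian.\<close>

lemma J_H_eq:
  fixes f :: "'n heis \<Rightarrow> real^'k::finite"
  assumes "has_h_derivative d f x L"
  shows "J_H d f x = sqrt (det (\<chi> i j. \<Sum>b\<in>Basis. (L b $ i) * (L b $ j)))"
  unfolding J_H_def multivector_norm_wedge
  by (subst euclidean_inner) (simp add: grad_H(2)[OF assms])

text \<open>The values of L on the orthonormal basis \<open>v\<close> are the coordinates of the
  gradients along V, so the Jacobian is the determinant of the restriction of L to V.\<close>

lemma J_V_eq:
  fixes f :: "'n heis \<Rightarrow> real^'k::finite" and v :: "'k \<Rightarrow> 'n heis"
  assumes "has_h_derivative d f x L" and v: "orthonormal_basis_of v V"
  shows "J_V d V f x = \<bar>det (\<chi> i j. L (v j) $ i)\<bar>"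
proof -
  have V: "subspace V" "\<And>j. v j \<in> V" using v span_base[of "v _" "range v"] by (auto simp: orthonormal_basis_of_def)
  have lin: "linear L" using assms(1) h_homomorphism_vec_groupD(1) by (auto simp: has_h_derivative_def)
  have g: "grad_V d V (\<lambda>y. f y $ i) x \<in> V \<and> (\<forall>z\<in>V. L z $ i = grad_V d V (\<lambda>y. f y $ i) x \<bullet> z)" for i
  proof -
    have D: "h_deriv d (\<lambda>y. f y $ i) x = (\<lambda>z. L z $ i)"
      by (rule h_deriv_eqI[OF has_h_derivative_component[OF assms(1)]])
    define g where "g = (\<Sum>j\<in>UNIV. (L (v j) $ i) *\<^sub>R v j)"
    have gV: "g \<in> V" unfolding g_def using V by (intro subspace_sum subspace_scale) auto
    have g: "L z $ i = g \<bullet> z" if "z \<in> V" for z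
    proof -
      have "L z $ i = L (\<Sum>j\<in>UNIV. (z \<bullet> v j) *\<^sub>R v j) $ i" using orthonormal_basis_expand[OF v that] by simp
      also have "\<dots> = (\<Sum>j\<in>UNIV. (z \<bullet> v j) * (L (v j) $ i))" using lin by (simp add: linear_sum linear_scale)
      also have "\<dots> = z \<bullet> g" by (simp add: g_def inner_sum_right mult.commute)
      finally show ?thesis by (simp only: inner_commute[of z g])
    qed
    have "grad_V d V (\<lambda>y. f y $ i) x = g"
      unfolding grad_V_def D
    proof (rule the_equality)
      show "g \<in> V \<and> (\<forall>z\<in>V. L z $ i = g \<bullet> z)" using gV g by auto
      show "g' = g" if g': "g' \<in> V \<and> (\<forall>z\<in>V. L z $ i = g' \<bullet> z)" for g'
      proof -
        have "g' - g \<in> V" using g' gV V by (simp add: subspace_diff)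
        then have "(g' - g) \<bullet> (g' - g) = 0" using g' g by (simp add: inner_diff_left)
        then show ?thesis by simp
      qed
    qed
    then show ?thesis using gV g by simp
  qed
  have "J_V d V f x = \<bar>det (\<chi> i j. grad_V d V (\<lambda>y. f y $ i) x \<bullet> v j)\<bar>"
    unfolding J_V_def by (rule multivector_norm_wedge_orthonormal[OF v]) (use g in blast)
  also have "(\<chi> i j. grad_V d V (\<lambda>y. f y $ i) x \<bullet> v j) = (\<chi> i j. L (v j) $ i)"
    using g V by (simp add: vec_eq_iff)
  finally show ?thesis .
qed

end

text \<open>With m horizontal variables, these contribute r^m and the vertical one r^2, together the
  homogeneous dimension m + 2. The term \<open>G\<close> only translates the vertical fibres, so
  with the vertical variable integrated first mere measurability of \<open>G\<close> is
  enough.\<close>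

lemma nn_integral_lborel_shear:
  fixes h :: "(real^'m::finite) \<times> real \<Rightarrow> ennreal" and G :: "real^'m \<Rightarrow> real"
  assumes h[measurable]: "h \<in> borel_measurable borel" and G[measurable]: "G \<in> borel_measurable borel" and r: "r > 0"
  shows "(\<integral>\<^sup>+e. h e \<partial>lborel) = ennreal (r ^ (CARD('m) + 2)) *
     (\<integral>\<^sup>+e. h (a0 + r *\<^sub>R fst e, r\<^sup>2 * snd e + G (fst e)) \<partial>lborel)"
proof -
  have h'[measurable]: "h \<in> borel_measurable (lborel \<Otimes>\<^sub>M lborel)"
    using h by (simp add: lborel_prod)
  have prod: "(\<integral>\<^sup>+e. k e \<partial>lborel) = (\<integral>\<^sup>+a. \<integral>\<^sup>+s. k (a, s) \<partial>lborel \<partial>lborel)"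
    if "k \<in> borel_measurable (borel :: ((real^'m) \<times> real) measure)" for k
    using lborel.nn_integral_fst[of k lborel] that by (simp add: lborel_prod)
  define K where "K b = (\<integral>\<^sup>+s. h (b, s) \<partial>lborel)" for b
  have K[measurable]: "K \<in> borel_measurable borel" unfolding K_def by measurable
  have inner: "ennreal (r\<^sup>2) * (\<integral>\<^sup>+s. h (b, r\<^sup>2 * s + c) \<partial>lborel) = K b" for b c
    unfolding K_def using nn_integral_real_affine[of "\<lambda>s. h (b, s)" "r\<^sup>2" c] r by (simp add: add.commute)
  have outer: "(\<integral>\<^sup>+b. K b \<partial>lborel) = ennreal (r ^ CARD('m)) * (\<integral>\<^sup>+a. K (a0 + r *\<^sub>R a) \<partial>lborel)"
  proof -
    have "(\<integral>\<^sup>+b. K b \<partial>lborel) = (\<integral>\<^sup>+b. K b \<partial>density (distr lborel borel (\<lambda>x. a0 + r *\<^sub>R x)) (\<lambda>_. \<bar>r\<bar>^DIM(real^'m)))"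
      using lborel_affine[of r a0] r by simp
    also have "\<dots> = ennreal (r ^ CARD('m)) * (\<integral>\<^sup>+a. K (a0 + r *\<^sub>R a) \<partial>lborel)"
      using r by (simp add: nn_integral_density nn_integral_distr nn_integral_cmult)
    finally show ?thesis .
  qed
  have "(\<integral>\<^sup>+e. h (a0 + r *\<^sub>R fst e, r\<^sup>2 * snd e + G (fst e)) \<partial>lborel) =
      (\<integral>\<^sup>+a. \<integral>\<^sup>+s. h (a0 + r *\<^sub>R a, r\<^sup>2 * s + G a) \<partial>lborel \<partial>lborel)"
  proof -
    have "(\<lambda>e. h (a0 + r *\<^sub>R fst e, r\<^sup>2 * snd e + G (fst e))) \<in> borel_measurable borel"
    proof (rule measurable_compose[OF _ h])
      have "(\<lambda>e::(real^'m) \<times> real. G (fst e)) \<in> borel_measurable borel"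
        by (rule measurable_compose[OF _ G]) (intro borel_measurable_continuous_onI continuous_intros)
      then show "(\<lambda>e. (a0 + r *\<^sub>R fst e, r\<^sup>2 * snd e + G (fst e))) \<in> borel_measurable borel"
        by (intro borel_measurable_Pair borel_measurable_add)
          (auto intro!: borel_measurable_continuous_onI continuous_intros)
    qed
    from prod[OF this] show ?thesis by simp
  qed
  note iterated = this
  have "ennreal (r ^ (CARD('m) + 2)) * (\<integral>\<^sup>+e. h (a0 + r *\<^sub>R fst e, r\<^sup>2 * snd e + G (fst e)) \<partial>lborel) =
      ennreal (r ^ CARD('m)) * (ennreal (r\<^sup>2) * (\<integral>\<^sup>+a. \<integral>\<^sup>+s. h (a0 + r *\<^sub>R a, r\<^sup>2 * s + G a) \<partial>lborel \<partial>lborel))"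
  proof -
    have "ennreal (r ^ (CARD('m) + 2)) = ennreal (r ^ CARD('m)) * ennreal (r\<^sup>2)"
      using r by (subst ennreal_mult[symmetric]) (auto simp: power_add power2_eq_square)
    then show ?thesis by (simp only: mult.assoc iterated)
  qed
  also have "ennreal (r\<^sup>2) * (\<integral>\<^sup>+a. \<integral>\<^sup>+s. h (a0 + r *\<^sub>R a, r\<^sup>2 * s + G a) \<partial>lborel \<partial>lborel) =
      (\<integral>\<^sup>+a. ennreal (r\<^sup>2) * (\<integral>\<^sup>+s. h (a0 + r *\<^sub>R a, r\<^sup>2 * s + G a) \<partial>lborel) \<partial>lborel)"
    by (rule nn_integral_cmult[symmetric]) measurable
  also have "\<dots> = (\<integral>\<^sup>+a. K (a0 + r *\<^sub>R a) \<partial>lborel)" by (simp add: inner)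
  also have "ennreal (r ^ CARD('m)) * \<dots> = (\<integral>\<^sup>+b. K b \<partial>lborel)" by (rule outer[symmetric])
  also have "\<dots> = (\<integral>\<^sup>+e. h e \<partial>lborel)" unfolding K_def by (rule prod[symmetric]) simp
  finally show ?thesis by simp
qed

section \<open>Semidirect factorizations\<close>

text \<open>The index type \<open>'m\<close> counts the horizontal directions of W: its topological
  dimension is \<open>CARD('m) + 1\<close> and its homogeneous dimension
  \<open>CARD('m) + 2\<close>.\<close>

locale factorization =
  fixes W V :: "'n::finite heis set" and v :: "'k::finite \<Rightarrow> 'n heis" and w :: "'m::finite \<Rightarrow> 'n heis"
  assumes fac: "semidirect_factorization W V"
    and basis_V: "orthonormal_basis_of v V"
    and basis_W: "orthonormal_basis_of (case_option e_top w) W"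
begin

lemma subspace_V: "subspace V" and subspace_W: "subspace W"
  using basis_V basis_W by (auto simp: orthonormal_basis_of_def)

lemma v_in_V: "v j \<in> V" and w_in_W: "w i \<in> W" and e_top_in_W: "e_top \<in> W"
proof -
  show "v j \<in> V" using basis_V span_base[of "v j" "range v"] by (auto simp: orthonormal_basis_of_def)
  have "case_option e_top w i \<in> W" for i
    using basis_W span_base[of "case_option e_top w i" "range (case_option e_top w)"]
    by (auto simp: orthonormal_basis_of_def)
  from this[of "Some i"] this[of None] show "w i \<in> W" "e_top \<in> W" by auto
qed

lemma vertical_in_W: "(0, s) \<in> W"
  using e_top_in_W subspace_W by (simp add: vertical_eq subspace_scale)

lemma w_orth: "w i \<bullet> w j = (if i = j then 1 else 0)" and snd_w [simp]: "snd (w i) = 0"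
proof -
  have *: "case_option e_top w i \<bullet> case_option e_top w j = (if i = j then 1 else 0)" for i j
    using basis_W by (simp add: orthonormal_basis_of_def)
  show "w i \<bullet> w j = (if i = j then 1 else 0)" using *[of "Some i" "Some j"] by simp
  show "snd (w i) = 0" using *[of "Some i" None] by simp
qed

lemma snd_V [simp]: "x \<in> V \<Longrightarrow> snd x = 0"
  using fac by (auto simp: semidirect_factorization_def horizontal_subgroup_def H1_def)

lemma W_inter_V: "W \<inter> V = {0}" and W_V_all: "\<exists>a\<in>W. \<exists>b\<in>V. x = a \<odot> b"
  using fac unfolding semidirect_factorization_def by blast+

text \<open>V is closed under products and horizontal, so the central component of a product
  vanishes: the symplectic form is zero on V, and V is abelian with vector addition as its
  product.\<close>

lemma hmul_V: "x \<in> V \<Longrightarrow> y \<in> V \<Longrightarrow> x \<odot> y = x + y" and symp_V: "x \<in> V \<Longrightarrow> y \<in> V \<Longrightarrow> symp (fst x) (fst y) = 0"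
proof -
  assume xy: "x \<in> V" "y \<in> V"
  have "subgroup V heis_group"
    using fac by (simp add: semidirect_factorization_def horizontal_subgroup_def homogeneous_subgroup_def)
  then have "x \<odot> y \<in> V" using subgroup.m_closed[of V heis_group x y] xy by (simp add: heis_group_def)
  then show "symp (fst x) (fst y) = 0" using snd_V[of "x \<odot> y"] xy by simp
  then show "x \<odot> y = x + y" using xy by (simp add: prod_eq_iff)
qed

lemma hinv_V: "x \<in> V \<Longrightarrow> hinv x \<in> V"
  using subspace_V by (simp add: hinv_def subspace_neg)

lemma dil_eq_scaleR: "dil t x = t *\<^sub>R x + ((t\<^sup>2 - t) * snd x) *\<^sub>R e_top"
  by (simp add: prod_eq_iff e_top_def algebra_simps)

lemma dil_W: "x \<in> W \<Longrightarrow> dil t x \<in> W"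
  unfolding dil_eq_scaleR using subspace_W e_top_in_W by (intro subspace_add subspace_scale) auto

lemma dil_V: "x \<in> V \<Longrightarrow> dil t x = t *\<^sub>R x"
  by (simp add: dil_eq_scaleR)

abbreviation "\<pi> \<equiv> projV W V"

text \<open>W contains the centre, so exchanging product and sum does not affect membership in W.
  The group factorization therefore has the same V-factor as the linear splitting, which makes
  \<open>projV\<close> linear, whereas \<open>projW\<close> carries a quadratic central
  term.\<close>

lemma hmul_factor_iff: "b \<in> V \<Longrightarrow> (\<exists>a\<in>W. x = a \<odot> b) \<longleftrightarrow> x - b \<in> W"
proof
  assume "b \<in> V" "\<exists>a\<in>W. x = a \<odot> b"
  then obtain a where a: "a \<in> W" "x = a \<odot> b" by blast
  then have "x - b = a + (symp (fst a) (fst b) / 2) *\<^sub>R e_top" by (simp add: hmul_def bracket_def)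
  then show "x - b \<in> W" using a subspace_W e_top_in_W by (simp add: subspace_add subspace_scale)
next
  assume b: "b \<in> V" "x - b \<in> W"
  have "x \<odot> hinv b = x - b + (- symp (fst x) (fst b) / 2) *\<^sub>R e_top"
    by (simp add: hmul_def bracket_def hinv_def)
  then have "x \<odot> hinv b \<in> W" using b subspace_W e_top_in_W by (metis subspace_add subspace_scale)
  moreover have "x = (x \<odot> hinv b) \<odot> b" by (simp add: hmul_assoc)
  ultimately show "\<exists>a\<in>W. x = a \<odot> b" by blast
qed

lemma V_unique: "a \<in> V \<Longrightarrow> b \<in> V \<Longrightarrow> x - a \<in> W \<Longrightarrow> x - b \<in> W \<Longrightarrow> a = b"
proof -
  assume ab: "a \<in> V" "b \<in> V" "x - a \<in> W" "x - b \<in> W"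
  have "(x - a) - (x - b) \<in> W" using ab(3,4) by (rule subspace_diff[OF subspace_W])
  moreover have "(x - a) - (x - b) = b - a" by simp
  moreover have "b - a \<in> V" using ab(2,1) by (rule subspace_diff[OF subspace_V])
  ultimately have "b - a \<in> W \<inter> V" by simp
  then show ?thesis using W_inter_V by simp
qed

lemma projV_eqI: "b \<in> V \<Longrightarrow> x - b \<in> W \<Longrightarrow> \<pi> x = b"
  unfolding projV_def using hmul_factor_iff V_unique by (intro the_equality) blast+

lemma projV_in_V: "\<pi> x \<in> V" and diff_projV_in_W: "x - \<pi> x \<in> W"
proof -
  obtain a b where "a \<in> W" "b \<in> V" "x = a \<odot> b" using W_V_all by blast
  then have b: "b \<in> V" "x - b \<in> W" using hmul_factor_iff[of b x] by blast+
  then show "\<pi> x \<in> V" "x - \<pi> x \<in> W" using projV_eqI[OF b] by auto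
qed

lemma linear_projV: "linear \<pi>"
proof (rule linearI)
  show "\<pi> (x + y) = \<pi> x + \<pi> y" for x y
  proof (rule projV_eqI)
    show "\<pi> x + \<pi> y \<in> V" using projV_in_V by (intro subspace_add[OF subspace_V])
    have "(x - \<pi> x) + (y - \<pi> y) \<in> W" using diff_projV_in_W by (intro subspace_add[OF subspace_W])
    then show "x + y - (\<pi> x + \<pi> y) \<in> W" by (simp add: algebra_simps)
  qed
  show "\<pi> (c *\<^sub>R x) = c *\<^sub>R \<pi> x" for c x
  proof (rule projV_eqI)
    show "c *\<^sub>R \<pi> x \<in> V" using projV_in_V by (intro subspace_scale[OF subspace_V])
    have "c *\<^sub>R (x - \<pi> x) \<in> W" using diff_projV_in_W by (intro subspace_scale[OF subspace_W])
    then show "c *\<^sub>R x - c *\<^sub>R \<pi> x \<in> W" by (simp add: algebra_simps)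
  qed
qed

lemma projV_V [simp]: "x \<in> V \<Longrightarrow> \<pi> x = x" and projV_W [simp]: "x \<in> W \<Longrightarrow> \<pi> x = 0"
  using subspace_V subspace_W by (auto intro!: projV_eqI simp: subspace_0)

lemma projV_hmul: "\<pi> (x \<odot> y) = \<pi> x + \<pi> y"
  using linear_projV e_top_in_W by (simp add: hmul_def bracket_def linear_add linear_scale)

lemma projV_hinv: "\<pi> (hinv x) = - \<pi> x"
  using linear_projV by (simp add: hinv_def linear_neg)

definition "projW x = x \<odot> hinv (\<pi> x)"

lemma projW_in_W: "projW x \<in> W"
proof -
  have "x - \<pi> x \<in> W" by (rule diff_projV_in_W)
  then obtain a where a: "a \<in> W" "x = a \<odot> \<pi> x" using hmul_factor_iff[OF projV_in_V] by blast
  then have "projW x = (a \<odot> \<pi> x) \<odot> hinv (\<pi> x)" by (simp add: projW_def)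
  then show ?thesis using a(1) by (simp add: hmul_assoc)
qed

lemma projW_hmul: "a \<in> W \<Longrightarrow> b \<in> V \<Longrightarrow> projW (a \<odot> b) = a"
  using linear_projV by (simp add: projW_def projV_hmul hmul_assoc)

lemma continuous_on_projV: "continuous_on S \<pi>"
  by (rule continuous_on_linear[OF linear_projV])

lemma continuous_on_projW: "continuous_on S projW"
  unfolding projW_def by (intro continuous_intros continuous_on_projV)

lemma dim_factors: "CARD('k) + CARD('m) + 1 = DIM('n heis)"
proof -
  have "dim V = CARD('k)" by (rule dim_orthonormal_basis[OF basis_V])
  moreover have "dim W = CARD('m option)" by (rule dim_orthonormal_basis[OF basis_W])
  moreover have "{x + y |x y. x \<in> W \<and> y \<in> V} = UNIV"
  proof -
    have "x = (x - \<pi> x) + \<pi> x" for x by simp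
    then show ?thesis using diff_projV_in_W projV_in_V by blast
  qed
  moreover have "dim {x + y |x y. x \<in> W \<and> y \<in> V} + dim (W \<inter> V) = dim W + dim V"
    using subspace_W subspace_V by (rule dim_sums_Int)
  ultimately show ?thesis using W_inter_V by simp
qed

section \<open>Isometric coordinates on W\<close>

definition \<kappa> :: "real^'m \<Rightarrow> (real^'n) \<times> (real^'n)" where
  "\<kappa> a = (\<Sum>i\<in>UNIV. a $ i *\<^sub>R fst (w i))"

definition \<iota> :: "(real^'m) \<times> real \<Rightarrow> 'n heis" where
  "\<iota> e = (\<kappa> (fst e), snd e)"

lemma fst_iota [simp]: "fst (\<iota> e) = \<kappa> (fst e)" and snd_iota [simp]: "snd (\<iota> e) = snd e"
  by (simp_all add: \<iota>_def)

lemma linear_kappa: "linear \<kappa>"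
  unfolding \<kappa>_def by (rule linearI) (simp_all add: scaleR_add_left sum.distrib scaleR_sum_right)

lemmas kappa_simps = linear_add[OF linear_kappa] linear_scale[OF linear_kappa] linear_0[OF linear_kappa]
  linear_neg[OF linear_kappa]

lemma iota_eq: "\<iota> e = (\<Sum>i\<in>UNIV. fst e $ i *\<^sub>R w i) + snd e *\<^sub>R e_top"
proof -
  have "fst (\<Sum>i\<in>UNIV. fst e $ i *\<^sub>R w i) = \<kappa> (fst e)" "snd (\<Sum>i\<in>UNIV. fst e $ i *\<^sub>R w i) = 0"
    by (simp_all add: \<kappa>_def fst_sum snd_sum)
  then show ?thesis by (simp add: prod_eq_iff e_top_def)
qed

lemma linear_iota: "linear \<iota>"
  unfolding \<iota>_def by (rule linearI) (simp_all add: kappa_simps)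

lemma norm_iota: "norm (\<iota> e) = norm e"
proof -
  have "\<kappa> a \<bullet> \<kappa> a = a \<bullet> a" for a
  proof -
    have "fst (w i) \<bullet> fst (w j) = (if i = j then 1 else 0)" for i j
      using w_orth[of i j] by (simp add: inner_prod_def)
    then show ?thesis
      by (simp add: \<kappa>_def inner_sum_left inner_sum_right inner_vec_def if_distrib[of "\<lambda>t. _ * t"] cong: if_cong)
  qed
  then show ?thesis by (simp add: norm_eq_sqrt_inner inner_prod_def)
qed

lemma iota_in_W: "\<iota> e \<in> W"
  unfolding iota_eq using subspace_W w_in_W e_top_in_W
  by (intro subspace_add subspace_sum subspace_scale) auto

lemma range_iota: "range \<iota> = W"
proof
  show "W \<subseteq> range \<iota>"
  proof
    fix x assume "x \<in> W"
    from orthonormal_basis_expand[OF basis_W this]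
    have "x = \<iota> (\<chi> i. x \<bullet> w i, snd x)"
      by (simp add: iota_eq UNIV_option_conv sum.reindex add.commute)
    then show "x \<in> range \<iota>" by blast
  qed
qed (use iota_in_W in auto)

lemma continuous_on_kappa: "continuous_on S \<kappa>"
  by (rule continuous_on_linear[OF linear_kappa])

lemma continuous_on_iota: "continuous_on S \<iota>"
  by (rule continuous_on_linear[OF linear_iota])

lemma dil_iota: "dil r (\<iota> e) = \<iota> (r *\<^sub>R fst e, r\<^sup>2 * snd e)"
  by (simp add: prod_eq_iff kappa_simps)

lemma sigma_tr_eq: "sigma_tr W V x y = x \<odot> y \<odot> hinv (\<pi> x)"
  by (simp add: sigma_tr_def)

text \<open>Conjugation by b adds the full bracket of b with the point, hence the last term without
  the factor 1/2. In coordinates the map is a translation combined with a vertical shear, so it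
  preserves Lebesgue measure.\<close>

lemma sigma_tr_iota:
  assumes "b \<in> V"
  shows "sigma_tr W V (\<iota> e0 \<odot> b) (\<iota> e) =
    \<iota> (fst e0 + fst e, snd e0 + snd e + symp (\<kappa> (fst e0)) (\<kappa> (fst e)) / 2 + symp (fst b) (\<kappa> (fst e)))"
proof -
  have b: "\<pi> (\<iota> e0 \<odot> b) = b" using assms by (simp add: projV_hmul iota_in_W)
  show ?thesis unfolding sigma_tr_def b using assms
    by (simp add: prod_eq_iff kappa_simps symp_simps symp_swap[of "\<kappa> (fst e)" "fst b"] field_simps)
qed

lemma sigma_tr_inverse:
  assumes "\<pi> x' = - \<pi> x" "x \<odot> x' = 0"
  shows "sigma_tr W V x (sigma_tr W V x' y) = y"
proof -
  have "hinv (\<pi> x') = \<pi> x" using assms by (simp add: hinv_def)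
  then have "sigma_tr W V x (sigma_tr W V x' y) = x \<odot> (x' \<odot> (y \<odot> (\<pi> x \<odot> hinv (\<pi> x))))"
    by (simp add: sigma_tr_def hmul_assoc del: hmul_hinv_right)
  also have "\<dots> = (x \<odot> x') \<odot> y" by (simp add: hmul_assoc)
  finally show ?thesis using assms by simp
qed

lemma sigma_tr_hinv [simp]: "sigma_tr W V x (sigma_tr W V (hinv x) y) = y"
  "sigma_tr W V (hinv x) (sigma_tr W V x y) = y"
  by (rule sigma_tr_inverse; simp add: projV_hinv)+

lemma sigma_tr_in_W: "y \<in> W \<Longrightarrow> sigma_tr W V x y \<in> W"
proof -
  assume y: "y \<in> W"
  have "\<pi> (x \<odot> y) = \<pi> x" using y by (simp add: projV_hmul)
  then have "sigma_tr W V x y = projW (x \<odot> y)" by (simp add: sigma_tr_def projW_def)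
  then show ?thesis using projW_in_W by simp
qed

end

section \<open>Intrinsic derivative and tangent cone\<close>

lemma tendsto_linear:
  fixes f :: "'a::euclidean_space \<Rightarrow> 'b::real_normed_vector"
  shows "linear f \<Longrightarrow> (g \<longlongrightarrow> a) F \<Longrightarrow> ((\<lambda>x. f (g x)) \<longlongrightarrow> f a) F"
  by (simp add: linear_conv_bounded_linear bounded_linear.tendsto)

context hdist
begin

lemma tendsto_0_if_N:
  assumes "((\<lambda>x. N (g x)) \<longlongrightarrow> 0) F"
  shows "(g \<longlongrightarrow> 0) F"
proof (rule tendstoI)
  fix \<epsilon> :: real assume "\<epsilon> > 0"
  then obtain e where e: "e > 0" "\<And>x. N x < e \<Longrightarrow> norm x < \<epsilon>" using norm_small_if_N_small by blast
  have "\<forall>\<^sub>F x in F. N (g x) < e" using assms e(1) by (rule order_tendstoD)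
  then show "\<forall>\<^sub>F x in F. dist (g x) 0 < \<epsilon>" by eventually_elim (use e in auto)
qed

lemma tendsto_if_d:
  assumes "((\<lambda>x. d (g x) a) \<longlongrightarrow> 0) F"
  shows "(g \<longlongrightarrow> a) F"
proof -
  have "((\<lambda>x. hinv a \<odot> g x) \<longlongrightarrow> 0) F"
    using assms by (intro tendsto_0_if_N) (simp only: d_eq_N)
  then have "((\<lambda>x. a \<odot> (hinv a \<odot> g x)) \<longlongrightarrow> a \<odot> 0) F" by (intro tendsto_intros)
  then show ?thesis by simp
qed

end

context factorization
begin

definition coord :: "'n heis \<Rightarrow> (real^'m) \<times> real" where
  "coord x = (\<chi> i. x \<bullet> w i, snd x)"

lemma iota_coord: "x \<in> W \<Longrightarrow> \<iota> (coord x) = x"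
  using orthonormal_basis_expand[OF basis_W, of x]
  by (simp add: iota_eq coord_def UNIV_option_conv sum.reindex add.commute)

lemma continuous_on_coord: "continuous_on S coord"
  unfolding coord_def by (intro continuous_intros)

lemma iota_split: "\<iota> (a, s) = \<iota> (a, 0) \<odot> (0, s)"
  by (simp add: prod_eq_iff)

end

locale surface = hdist d + factorization W V v w
  for d :: "'n::finite heis \<Rightarrow> 'n heis \<Rightarrow> real" and W V :: "'n heis set"
    and v :: "'k::finite \<Rightarrow> 'n heis" and w :: "'m::finite \<Rightarrow> 'n heis" +
  fixes U \<Sigma> \<Omega> :: "'n heis set" and \<phi> :: "'n heis \<Rightarrow> 'n heis" and f :: "'n heis \<Rightarrow> real^'k"
  assumes openin_U: "openin (top_of_set W) U"
    and phi_V: "\<phi> ` U \<subseteq> V"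
    and Sigma_eq: "\<Sigma> = graph_map \<phi> ` U"
    and uid: "unif_intrinsic_differentiable d W V U \<phi>"
    and def_f: "defining_function d V U \<Sigma> \<Omega> f"
begin

abbreviation "\<Phi> \<equiv> graph_map \<phi>"
abbreviation "\<sigma> u \<equiv> sigma_tr W V (\<Phi> u)"
abbreviation "Df x \<equiv> h_deriv d f x"

lemma U_W: "u \<in> U \<Longrightarrow> u \<in> W" using openin_U openin_subset by fastforce

lemma phi_in_V: "u \<in> U \<Longrightarrow> \<phi> u \<in> V" using phi_V by blast

lemma projV_graph: "u \<in> U \<Longrightarrow> \<pi> (\<Phi> u) = \<phi> u"
  using U_W phi_in_V by (simp add: graph_map_def projV_hmul)

lemma projW_graph: "u \<in> U \<Longrightarrow> projW (\<Phi> u) = u"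
  using U_W phi_in_V by (simp add: graph_map_def projW_hmul)

lemma graph_in_Sigma: "u \<in> U \<Longrightarrow> \<Phi> u \<in> \<Sigma>" using Sigma_eq by simp

lemma eventually_in_U:
  assumes "(g \<longlongrightarrow> u) F" "u \<in> U" "\<And>x. g x \<in> W"
  shows "\<forall>\<^sub>F x in F. g x \<in> U"
proof -
  obtain T where T: "open T" "U = W \<inter> T" using openin_U by (auto simp: openin_open)
  then have "\<forall>\<^sub>F x in F. g x \<in> T" using assms by (auto intro: topological_tendstoD)
  then show ?thesis by eventually_elim (use T assms in auto)
qed

lemma has_Df: "x \<in> \<Sigma> \<Longrightarrow> has_h_derivative d f x (Df x)"
proof -
  assume "x \<in> \<Sigma>"
  then obtain L where "has_h_derivative d f x L" using def_f by (auto simp: defining_function_def C1_h_def)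
  then show ?thesis using h_deriv_eqI by metis
qed

lemma hom_Df: "x \<in> \<Sigma> \<Longrightarrow> h_homomorphism heis_group dil vec_group (*\<^sub>R) (Df x)"
  using has_Df by (simp add: has_h_derivative_def)

lemmas linear_Df = h_homomorphism_vec_groupD(1)[OF hom_Df]
  and Df_e_top = h_homomorphism_vec_groupD(2)[OF hom_Df]
  and Df_dil = h_homomorphism_vec_groupD(3)[OF hom_Df]
  and Df_hmul = h_homomorphism_vec_groupD(4)[OF hom_Df]

lemma f_const: "x \<in> \<Sigma> \<Longrightarrow> y \<in> \<Sigma> \<Longrightarrow> f x = f y"
proof -
  assume xy: "x \<in> \<Sigma>" "y \<in> \<Sigma>"
  obtain x0 where "{y \<in> \<Omega>. f y = f x0} \<inter> {u \<odot> v |u v. u \<in> U \<and> v \<in> V} = \<Sigma>"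
    using def_f by (auto simp: defining_function_def)
  then have "f y = f x0" if "y \<in> \<Sigma>" for y using that by blast
  then show ?thesis using xy by metis
qed

text \<open>Intrinsic differentiability with base point u, the suprema being turned into an
  \<epsilon>-\<delta> bound. As V is abelian and horizontal, its product and dilations appear as
  vector operations.\<close>

definition is_intrinsic_derivative :: "'n heis \<Rightarrow> ('n heis \<Rightarrow> 'n heis) \<Rightarrow> bool" where
  "is_intrinsic_derivative u L \<longleftrightarrow> (\<forall>y\<in>W. L y \<in> V) \<and> (\<forall>y\<in>W. \<forall>y'\<in>W. L (y \<odot> y') = L y + L y') \<and>
     (\<forall>t>0. \<forall>y\<in>W. L (dil t y) = t *\<^sub>R L y) \<and>
     (\<forall>\<epsilon>>0. \<exists>\<delta>>0. \<forall>y\<in>W. \<sigma> u y \<in> U \<and> 0 < N y \<and> N y < \<delta> \<longrightarrow> d (L y) (\<phi> (\<sigma> u y) - \<phi> u) \<le> \<epsilon> * N y)"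

lemma intrinsic_derivative_exists:
  assumes u: "u \<in> U"
  shows "\<exists>L. is_intrinsic_derivative u L"
proof -
  obtain L where L: "h_homomorphism (heis_group\<lparr>carrier := W\<rparr>) dil (heis_group\<lparr>carrier := V\<rparr>) dil L"
    and lim: "((\<lambda>\<delta>. SUP w'\<in>{w' \<in> U. N (hinv u \<odot> w') < \<delta>}.
              SUP y\<in>{y \<in> sigma_tr W V (hinv (\<Phi> w')) ` U. 0 < N y \<and> N y < \<delta>}.
                ennreal (d (L y) (phi_tr W V \<phi> (hinv (\<Phi> w')) y) / N y)) \<longlongrightarrow> 0) (at_right 0)"
    using uid u unfolding unif_intrinsic_differentiable_def by blast
  have hom: "L y \<in> V" "L (y \<odot> y') = L y \<odot> L y'" "t > 0 \<Longrightarrow> L (dil t y) = dil t (L y)"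
    if "y \<in> W" "y' \<in> W" for y y' t
    using L that by (auto simp: h_homomorphism_def hom_def heis_group_def simp del: split_paired_All)
  have "is_intrinsic_derivative u L"
    unfolding is_intrinsic_derivative_def
  proof (intro conjI ballI allI impI)
    show "L y \<in> V" if "y \<in> W" for y using hom that by blast
    show "L (y \<odot> y') = L y + L y'" if "y \<in> W" "y' \<in> W" for y y'
      using hom(2)[OF that] hom(1)[of y] hom(1)[of y'] that by (simp add: hmul_V)
    show "L (dil t y) = t *\<^sub>R L y" if "t > 0" "y \<in> W" for y t
      using hom(3)[of y y t] hom(1)[of y] that by (simp add: dil_V)
    fix \<epsilon> :: real assume \<epsilon>: "\<epsilon> > 0"
    let ?S = "\<lambda>\<delta>. SUP w'\<in>{w' \<in> U. N (hinv u \<odot> w') < \<delta>}.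
              SUP y\<in>{y \<in> sigma_tr W V (hinv (\<Phi> w')) ` U. 0 < N y \<and> N y < \<delta>}.
                ennreal (d (L y) (phi_tr W V \<phi> (hinv (\<Phi> w')) y) / N y)"
    have "\<forall>\<^sub>F \<delta> in at_right 0. ?S \<delta> < ennreal \<epsilon>" using lim \<epsilon> by (intro order_tendstoD) auto
    then obtain b where b: "b > 0" "\<And>\<delta>. 0 < \<delta> \<Longrightarrow> \<delta> < b \<Longrightarrow> ?S \<delta> < ennreal \<epsilon>"
      by (auto simp: eventually_at_right_field)
    show "\<exists>\<delta>>0. \<forall>y\<in>W. \<sigma> u y \<in> U \<and> 0 < N y \<and> N y < \<delta> \<longrightarrow> d (L y) (\<phi> (\<sigma> u y) - \<phi> u) \<le> \<epsilon> * N y"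
    proof (intro exI[of _ "b/2"] conjI ballI impI)
      show "b / 2 > 0" using b by simp
      fix y assume y: "y \<in> W" and yc: "\<sigma> u y \<in> U \<and> 0 < N y \<and> N y < b / 2"
      \<comment> \<open>The point u is admissible in the outer supremum, and y in the inner one,
        being the translate of \<open>\<sigma> u y\<close>.\<close>
      have "y = sigma_tr W V (hinv (\<Phi> u)) (\<sigma> u y)" by simp
      then have yin: "y \<in> {y \<in> sigma_tr W V (hinv (\<Phi> u)) ` U. 0 < N y \<and> N y < b / 2}"
        using yc by (metis (mono_tags, lifting) image_eqI mem_Collect_eq)
      have uin: "u \<in> {w' \<in> U. N (hinv u \<odot> w') < b / 2}" using u b by simp
      have "ennreal (d (L y) (phi_tr W V \<phi> (hinv (\<Phi> u)) y) / N y) \<le> ?S (b / 2)"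
        by (rule SUP_upper2[OF uin], rule SUP_upper[OF yin])
      also have "\<dots> < ennreal \<epsilon>" using b by (intro b) auto
      finally have "d (L y) (phi_tr W V \<phi> (hinv (\<Phi> u)) y) / N y < \<epsilon>"
        using \<epsilon> by (simp add: ennreal_less_iff)
      moreover have "phi_tr W V \<phi> (hinv (\<Phi> u)) y = \<phi> (\<sigma> u y) - \<phi> u"
      proof -
        have "\<phi> (\<sigma> u y) \<in> V" using yc phi_in_V by blast
        moreover have "- \<phi> u \<in> V" using u phi_in_V subspace_V by (simp add: subspace_neg)
        ultimately show ?thesis
          unfolding phi_tr_def projV_hinv projV_graph[OF u] hinv_hinv by (simp add: hmul_V)
      qed
      ultimately show "d (L y) (\<phi> (\<sigma> u y) - \<phi> u) \<le> \<epsilon> * N y"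
        using yc by (simp add: field_simps)
    qed
  qed
  then show ?thesis by blast
qed

definition dphi :: "'n heis \<Rightarrow> 'n heis \<Rightarrow> 'n heis" where
  "dphi u = (SOME L. is_intrinsic_derivative u L)"

lemma dphi: "u \<in> U \<Longrightarrow> is_intrinsic_derivative u (dphi u)"
  unfolding dphi_def using intrinsic_derivative_exists by (rule someI_ex)

lemma dphi_V: "u \<in> U \<Longrightarrow> y \<in> W \<Longrightarrow> dphi u y \<in> V"
  and dphi_hmul: "u \<in> U \<Longrightarrow> y \<in> W \<Longrightarrow> y' \<in> W \<Longrightarrow> dphi u (y \<odot> y') = dphi u y + dphi u y'"
  and dphi_dil: "u \<in> U \<Longrightarrow> t > 0 \<Longrightarrow> y \<in> W \<Longrightarrow> dphi u (dil t y) = t *\<^sub>R dphi u y"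
  using dphi unfolding is_intrinsic_derivative_def by blast+

lemma dphi_approx:
  assumes "u \<in> U" "\<epsilon> > 0"
  obtains \<delta> where "\<delta> > 0" "\<And>y. y \<in> W \<Longrightarrow> \<sigma> u y \<in> U \<Longrightarrow> 0 < N y \<Longrightarrow> N y < \<delta> \<Longrightarrow>
      d (dphi u y) (\<phi> (\<sigma> u y) - \<phi> u) \<le> \<epsilon> * N y"
  using dphi[OF assms(1)] assms(2) unfolding is_intrinsic_derivative_def by metis

lemma
  assumes u: "u \<in> U"
  shows dphi_vertical: "dphi u (0, s) = 0"
    and dphi_add: "x \<in> W \<Longrightarrow> y \<in> W \<Longrightarrow> dphi u (x + y) = dphi u x + dphi u y"
    and dphi_scale: "x \<in> W \<Longrightarrow> dphi u (c *\<^sub>R x) = c *\<^sub>R dphi u x"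
  using h_homomorphism_linear_on[of W "dphi u", OF subspace_W e_top_in_W dphi_hmul[OF u] dphi_dil[OF u]]
  by blast+

lemma linear_dphi_iota: "u \<in> U \<Longrightarrow> linear (\<lambda>e. dphi u (\<iota> e))"
  using linear_iota iota_in_W by (intro linearI) (simp_all add: linear_add linear_scale dphi_add dphi_scale)

lemma dphi_iota: "u \<in> U \<Longrightarrow> dphi u (\<iota> (a, s)) = dphi u (\<iota> (a, 0))"
  by (subst iota_split) (simp add: dphi_hmul dphi_vertical iota_in_W vertical_in_W)

lemma tendsto_dphi:
  assumes "u \<in> U" "(g \<longlongrightarrow> y) F" "\<And>x. g x \<in> W" "y \<in> W"
  shows "((\<lambda>x. dphi u (g x)) \<longlongrightarrow> dphi u y) F"
proof -
  have "((\<lambda>x. coord (g x)) \<longlongrightarrow> coord y) F"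
    using continuous_on_tendsto_compose[OF continuous_on_coord[of UNIV] assms(2)] by simp
  then have "((\<lambda>x. dphi u (\<iota> (coord (g x)))) \<longlongrightarrow> dphi u (\<iota> (coord y))) F"
    by (rule tendsto_linear[OF linear_dphi_iota[OF assms(1)]])
  then show ?thesis using assms by (simp add: iota_coord)
qed

lemma sigma_graph_zero: "u \<in> U \<Longrightarrow> \<sigma> u 0 = u"
  by (simp add: sigma_tr_eq projV_graph, simp add: graph_map_def hmul_assoc)

lemma sigma_inv_self: "u \<in> U \<Longrightarrow> sigma_tr W V (hinv (\<Phi> u)) u = 0"
  using sigma_tr_hinv(2)[of "\<Phi> u" 0] sigma_graph_zero by simp

lemma tendsto_sigma: "(g \<longlongrightarrow> y) F \<Longrightarrow> ((\<lambda>t. sigma_tr W V x (g t)) \<longlongrightarrow> sigma_tr W V x y) F"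
  unfolding sigma_tr_def by (intro tendsto_intros)

text \<open>With y the translate of u' to the origin, \<open>\<phi> u' - \<phi> u\<close> is
  eventually within N y of \<open>dphi u y\<close>, and both of these tend to zero as u' tends to
  u.\<close>

lemma tendsto_phi:
  assumes u: "u \<in> U"
  shows "(\<phi> \<longlongrightarrow> \<phi> u) (at u within U)"
proof -
  \<comment> \<open>The value 0 off \<open>U\<close> keeps \<open>?y\<close> in W everywhere, as
    \<open>tendsto_dphi\<close> demands.\<close>
  let ?y = "\<lambda>u'. if u' \<in> U then sigma_tr W V (hinv (\<Phi> u)) u' else 0"
  have yW: "?y u' \<in> W" for u' 
    by (cases "u' \<in> U") (simp_all add: sigma_tr_in_W U_W subspace_0[OF subspace_W])
  have "((\<lambda>u'. sigma_tr W V (hinv (\<Phi> u)) u') \<longlongrightarrow> 0) (at u within U)"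
    using tendsto_sigma[of "\<lambda>u'. u'" u "at u within U" "hinv (\<Phi> u)"] sigma_inv_self[OF u] by simp
  moreover have "\<forall>\<^sub>F u' in at u within U. sigma_tr W V (hinv (\<Phi> u)) u' = ?y u'"
    by (auto simp: eventually_at_filter)
  ultimately have y0: "(?y \<longlongrightarrow> 0) (at u within U)" by (rule Lim_transform_eventually)
  have N0: "((\<lambda>u'. N (?y u')) \<longlongrightarrow> 0) (at u within U)"
    using tendsto_N[OF y0] by simp
  have "((\<lambda>u'. dphi u (?y u')) \<longlongrightarrow> dphi u 0) (at u within U)"
    using tendsto_dphi[OF u y0 yW] subspace_W by (simp add: subspace_0)
  moreover have "dphi u 0 = 0" using dphi_vertical[OF u, of 0] by (simp add: zero_prod_def)
  ultimately have "((\<lambda>u'. dphi u (?y u')) \<longlongrightarrow> 0) (at u within U)" by metis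
  from tendsto_N[OF this] have L0: "((\<lambda>u'. N (dphi u (?y u'))) \<longlongrightarrow> 0) (at u within U)"
    by (simp only: N_zero)
  obtain \<delta> where \<delta>: "\<delta> > 0" "\<And>y. y \<in> W \<Longrightarrow> \<sigma> u y \<in> U \<Longrightarrow> 0 < N y \<Longrightarrow> N y < \<delta> \<Longrightarrow>
      d (dphi u y) (\<phi> (\<sigma> u y) - \<phi> u) \<le> 1 * N y" using dphi_approx[OF u, of 1] by auto
  have ev: "\<forall>\<^sub>F u' in at u within U. N (\<phi> u' - \<phi> u) \<le> N (dphi u (?y u')) + N (?y u')"
  proof -
    have "\<forall>\<^sub>F u' in at u within U. N (?y u') < \<delta>" using N0 \<delta>(1) by (rule order_tendstoD)
    moreover have "\<forall>\<^sub>F u' in at u within U. u' \<in> U" by (simp add: eventually_at_filter)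
    ultimately show ?thesis
    proof eventually_elim
      case (elim u')
      define y where "y = sigma_tr W V (hinv (\<Phi> u)) u'"
      have y: "?y u' = y" "\<sigma> u y = u'" "y \<in> W" using elim yW[of u'] by (simp_all add: y_def)
      show ?case
      proof (cases "y = 0")
        case True
        then have "u' = u" using y(2) sigma_graph_zero[OF u] by simp
        then show ?thesis by simp
      next
        case False
        then have "d (dphi u y) (\<phi> u' - \<phi> u) \<le> N y" using \<delta>(2)[of y] y elim by simp
        moreover have "N (\<phi> u' - \<phi> u) \<le> d (\<phi> u' - \<phi> u) (dphi u y) + N (dphi u y)"
          using triangle[of "\<phi> u' - \<phi> u" "dphi u y" 0] by (simp add: hnorm_def)
        ultimately show ?thesis unfolding y(1) by (simp add: commute)
      qed
    qed
  qed
  have "((\<lambda>u'. N (dphi u (?y u')) + N (?y u')) \<longlongrightarrow> 0) (at u within U)"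
    using tendsto_add[OF L0 N0] by simp
  then have "((\<lambda>u'. N (\<phi> u' - \<phi> u)) \<longlongrightarrow> 0) (at u within U)"
    by (rule tendsto_sandwich[OF _ ev tendsto_const, rotated]) simp
  then have "((\<lambda>u'. \<phi> u' - \<phi> u) \<longlongrightarrow> 0) (at u within U)" by (rule tendsto_0_if_N)
  then show ?thesis by (simp add: LIM_zero_iff)
qed

lemma continuous_on_phi: "continuous_on U \<phi>"
  using tendsto_phi by (simp add: continuous_on_def)

lemma continuous_on_graph: "continuous_on U \<Phi>"
  unfolding graph_map_def using continuous_on_phi by (intro continuous_intros)

text \<open>A point of the surface, translated so that \<open>\<Phi> u\<close> goes to the origin
  and dilated by 1/r. The parameter is chosen so that, wherever the graph is defined, the W-factor
  of this point is \<open>\<iota> e\<close> at every scale; only the V-factor varies with r.\<close>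

definition rescaled_graph :: "'n heis \<Rightarrow> real \<Rightarrow> (real^'m) \<times> real \<Rightarrow> 'n heis" where
  "rescaled_graph u r e = dil (1 / r) (hinv (\<Phi> u) \<odot> \<Phi> (\<sigma> u (dil r (\<iota> e))))"

definition tangent_graph :: "'n heis \<Rightarrow> (real^'m) \<times> real \<Rightarrow> 'n heis" where
  "tangent_graph u e = \<iota> e \<odot> dphi u (\<iota> e)"

lemma rescaled_graph_eq:
  assumes u: "u \<in> U" and r: "r > 0" and in_U: "\<sigma> u (dil r (\<iota> e)) \<in> U"
  shows "rescaled_graph u r e = \<iota> e \<odot> dil (1 / r) (\<phi> (\<sigma> u (dil r (\<iota> e))) - \<phi> u)"
proof -
  let ?y = "dil r (\<iota> e)"
  have "\<sigma> u ?y = \<Phi> u \<odot> ?y \<odot> hinv (\<phi> u)" by (simp only: sigma_tr_eq projV_graph[OF u])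
  then have "hinv (\<Phi> u) \<odot> \<sigma> u ?y = ?y \<odot> hinv (\<phi> u)" by (simp only: hmul_assoc hmul_hinv_cancel)
  then have "hinv (\<Phi> u) \<odot> (\<sigma> u ?y \<odot> \<phi> (\<sigma> u ?y)) = ?y \<odot> (hinv (\<phi> u) \<odot> \<phi> (\<sigma> u ?y))"
    by (simp only: hmul_assoc[symmetric])
  then have "hinv (\<Phi> u) \<odot> \<Phi> (\<sigma> u ?y) = ?y \<odot> (hinv (\<phi> u) \<odot> \<phi> (\<sigma> u ?y))"
    by (simp only: graph_map_def[of \<phi> "\<sigma> u ?y"])
  also have "hinv (\<phi> u) \<odot> \<phi> (\<sigma> u ?y) = \<phi> (\<sigma> u ?y) - \<phi> u"
    using hmul_V[OF hinv_V[OF phi_in_V[OF u]] phi_in_V[OF in_U]] by (simp add: hinv_def)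
  finally show ?thesis using r by (simp add: rescaled_graph_def dil_hmul)
qed

lemma tendsto_sigma_dil:
  assumes u: "u \<in> U"
  shows "((\<lambda>r. \<sigma> u (dil r (\<iota> e))) \<longlongrightarrow> u) (at_right 0)"
    and "\<forall>\<^sub>F r in at_right 0. \<sigma> u (dil r (\<iota> e)) \<in> U"
proof -
  have "((\<lambda>r. dil r (\<iota> e)) \<longlongrightarrow> dil 0 (\<iota> e)) (at_right 0)" by (intro tendsto_intros)
  moreover have "dil 0 (\<iota> e) = 0" by (simp add: prod_eq_iff)
  ultimately show lim: "((\<lambda>r. \<sigma> u (dil r (\<iota> e))) \<longlongrightarrow> u) (at_right 0)"
    using tendsto_sigma[of "\<lambda>r. dil r (\<iota> e)" 0 _ "\<Phi> u"] sigma_graph_zero[OF u] by simp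
  show "\<forall>\<^sub>F r in at_right 0. \<sigma> u (dil r (\<iota> e)) \<in> U"
    by (rule eventually_in_U[OF lim u]) (intro sigma_tr_in_W dil_W iota_in_W)
qed

text \<open>The common factor \<open>\<iota> e\<close> cancels by left invariance. What remains is
  the error of the intrinsic derivative at a point of norm r N(\<open>\<iota> e\<close>), and the
  dilation by 1/r removes r.\<close>

lemma tendsto_rescaled_graph:
  assumes u: "u \<in> U"
  shows "((\<lambda>r. rescaled_graph u r e) \<longlongrightarrow> tangent_graph u e) (at_right 0)"
proof (rule tendsto_if_d, rule tendstoI)
  fix \<epsilon> :: real assume \<epsilon>: "\<epsilon> > 0"
  \<comment> \<open>The summand 1 covers the case \<open>\<iota> e = 0\<close> and makes the final
    inequality strict.\<close>
  define \<epsilon>' where "\<epsilon>' = \<epsilon> / (N (\<iota> e) + 1)"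
  have Np: "N (\<iota> e) + 1 > 0" by (simp add: add_nonneg_pos)
  have \<epsilon>': "\<epsilon>' > 0" using \<epsilon> Np by (simp add: \<epsilon>'_def)
  obtain \<delta> where \<delta>: "\<delta> > 0" "\<And>y. y \<in> W \<Longrightarrow> \<sigma> u y \<in> U \<Longrightarrow> 0 < N y \<Longrightarrow> N y < \<delta> \<Longrightarrow>
      d (dphi u y) (\<phi> (\<sigma> u y) - \<phi> u) \<le> \<epsilon>' * N y" using dphi_approx[OF u \<epsilon>'] by blast
  have ev1: "\<forall>\<^sub>F r in at_right 0. (0::real) < r" by (rule eventually_at_right_less)
  have "\<forall>\<^sub>F r in at_right 0. r < \<delta> / (N (\<iota> e) + 1)"
    using \<delta>(1) Np by (intro eventually_at_rightI[of 0 "\<delta> / (N (\<iota> e) + 1)"]) auto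
  with ev1 tendsto_sigma_dil(2)[OF u, of e]
  show "\<forall>\<^sub>F r in at_right 0. dist (d (rescaled_graph u r e) (tangent_graph u e)) 0 < \<epsilon>"
  proof eventually_elim
    case (elim r)
    let ?y = "dil r (\<iota> e)"
    have yW: "?y \<in> W" by (intro dil_W iota_in_W)
    have Ny: "N ?y = r * N (\<iota> e)" using elim by (simp add: N_dil)
    have le: "d (dphi u ?y) (\<phi> (\<sigma> u ?y) - \<phi> u) \<le> \<epsilon>' * N ?y"
    proof (cases "\<iota> e = 0")
      case True
      then show ?thesis using dphi_vertical[OF u, of 0] sigma_graph_zero[OF u] by (simp add: zero_prod_def[symmetric])
    next
      case False
      have "r * (N (\<iota> e) + 1) < \<delta>" using elim Np by (simp add: field_simps)
      then have "N ?y < \<delta>" using elim by (simp add: Ny algebra_simps)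
      moreover have "N ?y > 0" using False elim by (simp add: Ny)
      ultimately show ?thesis using \<delta>(2)[OF yW] elim by simp
    qed
    have "d (rescaled_graph u r e) (tangent_graph u e)
        = d (dil (1 / r) (\<phi> (\<sigma> u ?y) - \<phi> u)) (dphi u (\<iota> e))"
      unfolding rescaled_graph_eq[OF u elim(1) elim(2)] tangent_graph_def by (rule d_left)
    also have "dphi u (\<iota> e) = dil (1 / r) (dphi u ?y)"
      using elim dphi_V[OF u iota_in_W, of e] by (simp add: dphi_dil[OF u _ iota_in_W] dil_V subspace_scale[OF subspace_V])
    also have "d (dil (1 / r) (\<phi> (\<sigma> u ?y) - \<phi> u)) (dil (1 / r) (dphi u ?y))
        = 1 / r * d (dphi u ?y) (\<phi> (\<sigma> u ?y) - \<phi> u)"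
      using elim by (subst d_dil) (auto simp: commute)
    also have "\<dots> \<le> 1 / r * (\<epsilon>' * N ?y)" using le elim by (intro mult_left_mono) auto
    also have "\<dots> = \<epsilon>' * N (\<iota> e)" using elim by (simp add: Ny)
    also have "\<dots> < \<epsilon>' * (N (\<iota> e) + 1)" using \<epsilon>' by simp
    also have "\<dots> = \<epsilon>" using Np by (simp add: \<epsilon>'_def)
    finally show ?case by simp
  qed
qed

text \<open>f is constant on the surface, so Df(x) is o(N y) on the increments y from x to points of
  the surface. Multiplying by \<open>r h\<close> gives a bound by \<epsilon> times the norm of the
  dilated increments, and these converge to z.\<close>

lemma tangent_cone_subset_ker:
  assumes x: "x \<in> \<Sigma>" and z: "z \<in> tangent_cone \<Sigma> x"
  shows "Df x z = 0"
proof -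
  obtain r :: "nat \<Rightarrow> real" and X where r: "\<And>h. r h > 0" and X: "\<And>h. X h \<in> \<Sigma>" and Xx: "X \<longlonglongrightarrow> x"
    and lim: "(\<lambda>h. dil (r h) (hinv x \<odot> X h)) \<longlonglongrightarrow> z"
    using z unfolding tangent_cone_def by blast
  let ?y = "\<lambda>h. hinv x \<odot> X h"
  have y0: "?y \<longlonglongrightarrow> 0"
    using tendsto_hmul[OF tendsto_const Xx, of "hinv x"] by simp
  have Df_cont: "(\<lambda>h. Df x (dil (r h) (?y h))) \<longlonglongrightarrow> Df x z"
    by (rule tendsto_linear[OF linear_Df[OF x] lim])
  have "norm (Df x z) \<le> \<epsilon> * N z" if \<epsilon>: "\<epsilon> > 0" for \<epsilon>
  proof -
    have "((\<lambda>w. norm (f (x \<odot> w) - f x - Df x w) / N w) \<longlongrightarrow> 0) (at 0)"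
      using has_Df[OF x] by (simp add: has_h_derivative_def)
    then have "\<forall>\<^sub>F w in at 0. norm (f (x \<odot> w) - f x - Df x w) / N w < \<epsilon>" using \<epsilon> by (rule order_tendstoD)
    then have "\<forall>\<^sub>F w in nhds 0. w \<noteq> 0 \<longrightarrow> norm (f (x \<odot> w) - f x - Df x w) / N w < \<epsilon>"
      by (simp add: eventually_at_filter)
    then have "\<forall>\<^sub>F h in sequentially. ?y h \<noteq> 0 \<longrightarrow> norm (f (x \<odot> ?y h) - f x - Df x (?y h)) / N (?y h) < \<epsilon>"
      using y0 unfolding filterlim_iff by blast
    then have "\<forall>\<^sub>F h in sequentially. norm (Df x (dil (r h) (?y h))) \<le> \<epsilon> * N (dil (r h) (?y h))"
    proof eventually_elim
      case (elim h)
      have "norm (Df x (?y h)) \<le> \<epsilon> * N (?y h)"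
      proof (cases "?y h = 0")
        case True
        then show ?thesis using linear_0[OF linear_Df[OF x]] by simp
      next
        case False
        have "f (x \<odot> ?y h) = f x" using f_const[OF X x] by simp
        then have "norm (Df x (?y h)) / N (?y h) < \<epsilon>" using elim False by simp
        then show ?thesis using False by (simp add: divide_less_eq)
      qed
      then have "r h * norm (Df x (?y h)) \<le> r h * (\<epsilon> * N (?y h))" using r[of h] by (intro mult_left_mono) auto
      then show ?case using r[of h] by (simp add: Df_dil[OF x] N_dil mult.left_commute)
    qed
    then show ?thesis
      using tendsto_norm[OF Df_cont] tendsto_mult[OF tendsto_const tendsto_N[OF lim], of \<epsilon>]
      by (intro tendsto_le[of sequentially]) auto
  qed
  note le = this
  show ?thesis
  proof (rule ccontr)
    assume "Df x z \<noteq> 0"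
    then have pos: "norm (Df x z) > 0" by simp
    have Np: "N z + 1 > 0" by (simp add: add_nonneg_pos)
    have "norm (Df x z) \<le> norm (Df x z) / (N z + 1) * N z" using pos Np by (intro le) simp
    then have "norm (Df x z) * (N z + 1) \<le> norm (Df x z) * N z" using Np by (simp add: field_simps)
    then show False using pos by (simp add: distrib_left)
  qed
qed

lemma tangent_graph_in_cone:
  assumes u: "u \<in> U"
  shows "tangent_graph u e \<in> tangent_cone \<Sigma> (\<Phi> u)"
proof -
  obtain b where b: "b > 0" "\<And>r. 0 < r \<Longrightarrow> r < b \<Longrightarrow> \<sigma> u (dil r (\<iota> e)) \<in> U"
    using tendsto_sigma_dil(2)[OF u, of e] by (auto simp: eventually_at_right_field)
  \<comment> \<open>The 2 in the denominator keeps every scale strictly below b.\<close>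
  define \<rho> where "\<rho> h = b / real (h + 2)" for h
  have \<rho>: "\<rho> h > 0" "\<rho> h < b" for h
    using b(1) by (auto simp: \<rho>_def field_simps intro!: add_pos_nonneg)
  have "(\<lambda>h. b * inverse (real (Suc (h + 1)))) \<longlonglongrightarrow> b * 0"
    by (intro tendsto_intros LIMSEQ_ignore_initial_segment[OF LIMSEQ_inverse_real_of_nat])
  then have "\<rho> \<longlonglongrightarrow> 0" unfolding \<rho>_def by (simp add: divide_inverse)
  then have \<rho>0: "filterlim \<rho> (at_right 0) sequentially"
    using \<rho>(1) less_imp_neq[OF \<rho>(1), symmetric] by (auto simp: filterlim_at intro!: always_eventually)
  let ?X = "\<lambda>h. \<Phi> (\<sigma> u (dil (\<rho> h) (\<iota> e)))"
  have in_U: "\<sigma> u (dil (\<rho> h) (\<iota> e)) \<in> U" for h using \<rho> by (intro b) auto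
  have "(\<lambda>h. \<sigma> u (dil (\<rho> h) (\<iota> e))) \<longlonglongrightarrow> u"
    by (rule filterlim_compose[OF tendsto_sigma_dil(1)[OF u] \<rho>0])
  from continuous_on_tendsto_compose[OF continuous_on_graph this u] have "?X \<longlonglongrightarrow> \<Phi> u"
    by (simp add: in_U)
  moreover have "(\<lambda>h. dil (1 / \<rho> h) (hinv (\<Phi> u) \<odot> ?X h)) \<longlonglongrightarrow> tangent_graph u e"
    using filterlim_compose[OF tendsto_rescaled_graph[OF u] \<rho>0] by (simp add: rescaled_graph_def)
  moreover have "\<forall>h. 1 / \<rho> h > 0 \<and> ?X h \<in> \<Sigma>" using \<rho> in_U graph_in_Sigma by simp
  ultimately show ?thesis
    unfolding tangent_cone_def mem_Collect_eq by (intro exI[of _ "\<lambda>h. 1 / \<rho> h"] exI[of _ ?X] conjI)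
qed

text \<open>Implicit differentiation: the homomorphism Df vanishes on the product of y and
  \<open>dphi u y\<close>, which is a point of the tangent cone.\<close>

lemma Df_dphi:
  assumes u: "u \<in> U" and y: "y \<in> W"
  shows "Df (\<Phi> u) (dphi u y) = - Df (\<Phi> u) y"
proof -
  have "Df (\<Phi> u) (tangent_graph u (coord y)) = 0"
    by (rule tangent_cone_subset_ker[OF graph_in_Sigma[OF u] tangent_graph_in_cone[OF u]])
  then have "Df (\<Phi> u) y + Df (\<Phi> u) (dphi u y) = 0"
    using y by (simp add: tangent_graph_def iota_coord Df_hmul[OF graph_in_Sigma[OF u]])
  then show ?thesis by (simp add: eq_neg_iff_add_eq_0 add.commute)
qed

text \<open>Since the kernel of \<open>Df\<close> contains the graph of the intrinsic derivative, \<open>Df\<close> is already onto when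
  restricted to \<open>V\<close>.\<close>

lemma det_Df_V:
  assumes u: "u \<in> U"
  shows "det (\<chi> i j. Df (\<Phi> u) (v j) $ i) \<noteq> 0"
proof -
  let ?D = "Df (\<Phi> u)" and ?A = "\<chi> i j. Df (\<Phi> u) (v j) $ i"
  note x = graph_in_Sigma[OF u]
  have A: "?A *v c = ?D (\<Sum>j\<in>UNIV. c $ j *\<^sub>R v j)" for c
    by (simp add: linear_sum[OF linear_Df[OF x]] linear_scale[OF linear_Df[OF x]] matrix_vector_mult_def
        vec_eq_iff mult.commute)
  have "\<exists>c. ?A *v c = y" for y
  proof -
    have "surj ?D" using def_f x by (simp add: defining_function_def)
    then obtain z where z: "y = ?D z" by (metis surjD)
    obtain a b where ab: "a \<in> W" "b \<in> V" "z = a \<odot> b" using W_V_all by blast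
    have y: "y = ?D (b - dphi u a)"
      using z ab by (simp add: Df_hmul[OF x] linear_diff[OF linear_Df[OF x]] Df_dphi[OF u])
    have bV: "b - dphi u a \<in> V" using ab dphi_V[OF u] subspace_V by (simp add: subspace_diff)
    define c where "c = (\<chi> j. (b - dphi u a) \<bullet> v j)"
    have c: "b - dphi u a = (\<Sum>j\<in>UNIV. c $ j *\<^sub>R v j)"
      unfolding c_def vec_lambda_beta by (rule orthonormal_basis_expand[OF basis_V bV])
    show ?thesis by (rule exI[of _ c]) (simp only: A y c)
  qed
  then have "surj ((*v) ?A)" by (metis surjI surj_def)
  then have "\<exists>B. ?A ** B = mat 1" by (simp add: matrix_right_invertible_surjective)
  then have "invertible ?A" by (simp add: invertible_right_inverse)
  then show ?thesis by (simp add: invertible_det_nz)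
qed

lemma Df_V_inj:
  assumes u: "u \<in> U" and b: "b \<in> V" "Df (\<Phi> u) b = 0"
  shows "b = 0"
proof -
  let ?A = "\<chi> i j. Df (\<Phi> u) (v j) $ i"
  note x = graph_in_Sigma[OF u]
  define c where "c = (\<chi> j. b \<bullet> v j)"
  have bc: "b = (\<Sum>j\<in>UNIV. c $ j *\<^sub>R v j)" unfolding c_def vec_lambda_beta by (rule orthonormal_basis_expand[OF basis_V b(1)])
  have "?A *v c = Df (\<Phi> u) b"
    unfolding bc by (simp add: linear_sum[OF linear_Df[OF x]] linear_scale[OF linear_Df[OF x]] matrix_vector_mult_def
        vec_eq_iff mult.commute)
  then have "?A *v c = 0" using b by simp
  moreover have "invertible ?A" using det_Df_V[OF u] by (simp add: invertible_det_nz)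
  then have "\<exists>B. B ** ?A = mat 1" by (simp add: invertible_left_inverse)
  then have "\<forall>x. ?A *v x = 0 \<longrightarrow> x = 0" by (simp add: matrix_left_invertible_ker)
  ultimately have "c = 0" by blast
  then show ?thesis using bc by simp
qed

text \<open>Three inclusions in a circle: tangent graph, cone, kernel, tangent graph. For the last
  one, z = a b in the kernel puts b - \<open>dphi u a\<close> into V and into the kernel, so it is 0
  because Df is injective on V.\<close>

lemma tangent_cone_eq:
  assumes u: "u \<in> U"
  shows "tangent_cone \<Sigma> (\<Phi> u) = {z. Df (\<Phi> u) z = 0}" "tangent_cone \<Sigma> (\<Phi> u) = range (tangent_graph u)"
proof -
  note x = graph_in_Sigma[OF u]
  have 1: "range (tangent_graph u) \<subseteq> tangent_cone \<Sigma> (\<Phi> u)" using tangent_graph_in_cone[OF u] by blast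
  have 2: "tangent_cone \<Sigma> (\<Phi> u) \<subseteq> {z. Df (\<Phi> u) z = 0}" using tangent_cone_subset_ker[OF x] by blast
  have 3: "{z. Df (\<Phi> u) z = 0} \<subseteq> range (tangent_graph u)"
  proof clarify
    fix z assume z: "Df (\<Phi> u) z = 0"
    obtain a b where ab: "a \<in> W" "b \<in> V" "z = a \<odot> b" using W_V_all by blast
    have "Df (\<Phi> u) (b - dphi u a) = 0"
      using z ab by (simp add: Df_hmul[OF x] linear_diff[OF linear_Df[OF x]] Df_dphi[OF u] add.commute)
    moreover have "b - dphi u a \<in> V" using ab dphi_V[OF u] subspace_V by (simp add: subspace_diff)
    ultimately have "b - dphi u a = 0" by (intro Df_V_inj[OF u])
    then have "b = dphi u a" by simp
    then have "z = tangent_graph u (coord a)" using ab by (simp add: tangent_graph_def iota_coord)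
    then show "z \<in> range (tangent_graph u)" by blast
  qed
  show "tangent_cone \<Sigma> (\<Phi> u) = {z. Df (\<Phi> u) z = 0}" "tangent_cone \<Sigma> (\<Phi> u) = range (tangent_graph u)"
    using 1 2 3 by blast+
qed

end

section \<open>Hausdorff measure on the tangent cone\<close>

context surface
begin

definition frame_norm :: real where
  "frame_norm = multivector_norm (wedge (case_sum v (case_option e_top w)))"

definition jac_ratio :: "'n heis \<Rightarrow> real" where
  "jac_ratio u = J_H d f (\<Phi> u) / J_V d V f (\<Phi> u)"

lemma tangent_cone_subspace: "u \<in> U \<Longrightarrow> subspace (tangent_cone \<Sigma> (\<Phi> u))"
  unfolding tangent_cone_eq(1)
  using linear_Df[OF graph_in_Sigma]
  by (auto simp: subspace_def linear_0 linear_add linear_scale)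

text \<open>An orthonormal frame adapted to the tangent cone: \<nu> spans the space generated by the
  horizontal gradients, \<tau> the horizontal part of the cone. The dimensions follow by squeezing:
  k gradients span at most k dimensions, while the cone, their orthogonal complement, meets the
  k-dimensional V only in 0.\<close>

lemma tangent_geometry:
  assumes u: "u \<in> U"
  obtains \<nu> :: "'k \<Rightarrow> 'n heis" and \<tau> :: "'m \<Rightarrow> 'n heis" where
    "orthonormal_basis_of (case_sum \<nu> (case_option e_top \<tau>)) UNIV"
    "orthonormal_basis_of \<nu> (span (range (\<lambda>i. grad_H d (\<lambda>y. f y $ i) (\<Phi> u))))"
    "orthonormal_basis_of \<tau> {y \<in> tangent_cone \<Sigma> (\<Phi> u). snd y = 0}"
    "dim (tangent_cone \<Sigma> (\<Phi> u)) = CARD('m) + 1"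
proof -
  note x = graph_in_Sigma[OF u]
  define g where "g i = grad_H d (\<lambda>y. f y $ i) (\<Phi> u)" for i
  have g: "Df (\<Phi> u) z $ i = g i \<bullet> z" "snd (g i) = 0" for z i
    using grad_H[OF has_Df[OF x]] by (simp_all add: g_def)
  let ?T = "tangent_cone \<Sigma> (\<Phi> u)"
  let ?G = "span (range g)"
  have T: "?T = {z. \<forall>i. g i \<bullet> z = 0}" unfolding tangent_cone_eq(1)[OF u] by (simp add: vec_eq_iff g)
  have sT: "subspace ?T" by (rule tangent_cone_subspace[OF u])
  have GT: "x \<bullet> z = 0" if "x \<in> ?G" "z \<in> ?T" for x z
    using that(1) that(2) by (induction rule: span_induct_alt) (auto simp: T inner_add_left)
  have Torth: "?T = {y \<in> UNIV. \<forall>x \<in> ?G. orthogonal x y}"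
  proof (intro antisym subsetI)
    fix y assume "y \<in> {y \<in> UNIV. \<forall>x \<in> ?G. orthogonal x y}"
    then show "y \<in> ?T" using span_base[of _ "range g"] by (auto simp: T orthogonal_def)
  qed (use GT in \<open>auto simp: orthogonal_def\<close>)
  have d1: "dim ?T + dim ?G = DIM('n heis)"
    unfolding Torth using dim_subspace_orthogonal_to_vectors[of ?G UNIV] by simp
  have dimV: "dim V = CARD('k)" by (rule dim_orthonormal_basis[OF basis_V])
  have d2: "dim ?T + dim V \<le> DIM('n heis)"
  proof -
    have "?T \<inter> V = {0}"
    proof
      show "?T \<inter> V \<subseteq> {0}" unfolding tangent_cone_eq(1)[OF u] using Df_V_inj[OF u] by blast
      show "{0} \<subseteq> ?T \<inter> V" using subspace_0[OF sT] subspace_0[OF subspace_V] by simp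
    qed
    then have "dim {x + y |x y. x \<in> ?T \<and> y \<in> V} = dim ?T + dim V"
      using dim_sums_Int[OF sT subspace_V] by simp
    then show ?thesis using dim_subset_UNIV[of "{x + y |x y. x \<in> ?T \<and> y \<in> V}"] by simp
  qed
  have "card (range g) \<le> CARD('k)" by (rule card_image_le) simp
  moreover have "dim (range g) \<le> card (range g)" by (rule dim_le_card') simp
  ultimately have d3: "dim ?G \<le> CARD('k)" by simp
  have dG: "dim ?G = CARD('k)" and dT: "dim ?T = CARD('m) + 1"
    using d1 d2 d3 dimV dim_factors by linarith+
  obtain \<nu> :: "'k \<Rightarrow> 'n heis" where \<nu>: "orthonormal_basis_of \<nu> ?G"
    using orthonormal_basis_of_subspace_exists[OF subspace_span dG] by blast
  let ?T1 = "{y \<in> ?T. snd y = 0}"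
  have sT1: "subspace ?T1" using sT by (auto simp: subspace_def)
  have eT: "e_top \<in> ?T" unfolding T using g(2) by simp
  have "dim {y \<in> ?T. \<forall>x \<in> span {e_top}. orthogonal x y} + dim (span {e_top :: 'n heis}) = dim ?T"
    using eT sT by (intro dim_subspace_orthogonal_to_vectors) (auto intro: span_minimal[THEN subsetD])
  moreover have "{y \<in> ?T. \<forall>x \<in> span {e_top}. orthogonal x y} = ?T1"
    by (auto simp: span_singleton orthogonal_def)
  moreover have "dim (span {e_top :: 'n heis}) = 1"
  proof -
    have "e_top \<noteq> (0 :: 'n heis)" by (simp add: e_top_def zero_prod_def)
    then show ?thesis by (simp add: dim_eq_card_independent independent_insert)
  qed
  ultimately have dT1: "dim ?T1 = CARD('m)" using dT by simp
  obtain \<tau> :: "'m \<Rightarrow> 'n heis" where \<tau>: "orthonormal_basis_of \<tau> ?T1"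
    using orthonormal_basis_of_subspace_exists[OF sT1 dT1] by blast
  have \<tau>T: "\<tau> j \<in> ?T1" for j using \<tau> span_base[of "\<tau> j" "range \<tau>"] by (auto simp: orthonormal_basis_of_def)
  have \<nu>G: "\<nu> j \<in> ?G" for j using \<nu> span_base[of "\<nu> j" "range \<nu>"] by (auto simp: orthonormal_basis_of_def)
  have \<nu>\<tau>: "\<nu> i \<bullet> \<tau> j = 0" for i j using GT[OF \<nu>G[of i], of "\<tau> j"] \<tau>T[of j] by simp
  have \<nu>e: "snd (\<nu> i) = 0" for i using GT[OF \<nu>G[of i] eT] by simp
  have \<tau>e: "snd (\<tau> i) = 0" for i using \<tau>T[of i] by simp
  have \<nu>\<nu>: "\<nu> i \<bullet> \<nu> j = (if i = j then 1 else 0)" and \<tau>\<tau>: "\<tau> i' \<bullet> \<tau> j' = (if i' = j' then 1 else 0)" for i j i' j'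
    using \<nu> \<tau> by (simp_all add: orthonormal_basis_of_def)
  have "orthonormal_basis_of (case_sum \<nu> (case_option e_top \<tau>)) UNIV"
  proof (rule orthonormal_span_eq_UNIV)
    show "case_sum \<nu> (case_option e_top \<tau>) i \<bullet> case_sum \<nu> (case_option e_top \<tau>) j = (if i = j then 1 else 0)" for i j
      using \<nu>\<tau> \<nu>e \<tau>e \<nu>\<nu> \<tau>\<tau> by (auto simp: inner_commute[of "\<tau> _" "\<nu> _"] split: sum.splits option.splits)
    show "CARD('k + 'm option) = DIM('n heis)" using dim_factors by simp
  qed
  then show ?thesis using that \<nu> \<tau> dT unfolding g_def by blast
qed

text \<open>In the isometric coordinates \<open>j\<close> given by \<tau> and \<open>e_top\<close>,
  the tangent graph is a linear map \<open>M\<close> of the horizontal variables combined with a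
  vertical shear. The shear preserves volume, and \<open>jacobian_projection_along\<close> computes
  the absolute determinant of \<open>M\<close>.\<close>

lemma tangent_measure:
  assumes u: "u \<in> U"
  shows "dim (tangent_cone \<Sigma> (\<Phi> u)) = CARD('m) + 1" "0 < frame_norm * jac_ratio u"
    "S \<in> sets borel \<Longrightarrow> emeasure (hausdorff_measure (CARD('m) + 1)) (tangent_cone \<Sigma> (\<Phi> u) \<inter> S) =
      hausdorff_const TYPE((real^'m) \<times> real) * (ennreal (frame_norm * jac_ratio u) * emeasure lborel (tangent_graph u -` S))"
proof -
  note x = graph_in_Sigma[OF u]
  define g where "g i = grad_H d (\<lambda>y. f y $ i) (\<Phi> u)" for i
  have g: "Df (\<Phi> u) z $ i = g i \<bullet> z" "snd (g i) = 0" for z i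
    using grad_H[OF has_Df[OF x]] by (simp_all add: g_def)
  let ?T = "tangent_cone \<Sigma> (\<Phi> u)"
  obtain \<nu> :: "'k \<Rightarrow> 'n heis" and \<tau> :: "'m \<Rightarrow> 'n heis" where
    basis: "orthonormal_basis_of (case_sum \<nu> (case_option e_top \<tau>)) UNIV" and
    \<nu>: "orthonormal_basis_of \<nu> (span (range g))" and
    \<tau>: "orthonormal_basis_of \<tau> {y \<in> ?T. snd y = 0}" and
    dT: "dim ?T = CARD('m) + 1"
    by (rule tangent_geometry[OF u]) (rule that; simp add: g_def[abs_def])
  show "dim ?T = CARD('m) + 1" by (rule dT)
  define l where "l i = dphi u (w i)" for i
  have lV: "l i \<in> V" for i using dphi_V[OF u w_in_W] by (simp add: l_def)
  define D where "D = (\<chi> i j. (w i + l i) \<bullet> \<tau> j)"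
  have Dgl: "g j \<bullet> (w i + l i) = 0" for i j
    using g(1)[of "w i" j] g(1)[of "l i" j] Df_dphi[OF u w_in_W[of i]] by (simp add: inner_add_right l_def)
  have J: "\<bar>det D\<bar> = frame_norm * (multivector_norm (wedge g) / \<bar>det (\<chi> i j. g i \<bullet> v j)\<bar>)"
    unfolding D_def frame_norm_def
  proof (rule jacobian_projection_along[OF basis \<nu>])
    show "v i \<bullet> e_top = 0" for i using v_in_V by simp
    show "w i \<bullet> e_top = 0" for i by simp
    show "l i \<in> span (range v)" for i using lV basis_V by (simp add: orthonormal_basis_of_def)
    show "g j \<bullet> (w i + l i) = 0" for i j by (rule Dgl)
    show "g i \<bullet> e_top = 0" for i using g by simp
    show "det (\<chi> i j. g i \<bullet> v j) \<noteq> 0" using det_Df_V[OF u] by (simp add: g)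
  qed
  have JH: "multivector_norm (wedge g) = J_H d f (\<Phi> u)" by (simp add: J_H_def g_def[abs_def])
  have JV: "\<bar>det (\<chi> i j. g i \<bullet> v j)\<bar> = J_V d V f (\<Phi> u)"
    using J_V_eq[OF has_Df[OF x] basis_V] by (simp add: g)
  have detD: "\<bar>det D\<bar> = frame_norm * jac_ratio u" using J by (simp add: jac_ratio_def JH JV)
  \<comment> \<open>P is the linear part of the tangent graph over horizontal vectors of W; M below
    is P in the coordinates given by \<tau>.\<close>
  define P where "P a = (\<Sum>i\<in>UNIV. a $ i *\<^sub>R (w i + l i))" for a :: "real^'m"
  have P_T1: "P a \<in> {y \<in> ?T. snd y = 0}" for a
  proof -
    have "w i + l i \<in> {y \<in> ?T. snd y = 0}" for i
      using Dgl lV by (simp add: tangent_cone_eq(1)[OF u] vec_eq_iff g)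
    moreover have "subspace {y \<in> ?T. snd y = 0}" using tangent_cone_subspace[OF u] by (auto simp: subspace_def)
    ultimately show ?thesis unfolding P_def by (intro subspace_sum subspace_scale) auto
  qed
  define M where "M a = (\<chi> j. P a \<bullet> \<tau> j)" for a
  have P_M: "P a = (\<Sum>j\<in>UNIV. M a $ j *\<^sub>R \<tau> j)" for a
    unfolding M_def vec_lambda_beta by (rule orthonormal_basis_expand[OF \<tau> P_T1])
  have linP: "linear P" unfolding P_def
    by (rule linearI) (simp_all add: scaleR_add_left sum.distrib scaleR_sum_right)
  have linM: "linear M" unfolding M_def
    by (rule linearI) (simp_all add: vec_eq_iff linear_add[OF linP] linear_scale[OF linP] inner_add_left)
  have P_axis: "P (axis i 1) = w i + l i" for i
    by (simp add: P_def axis_def if_distrib[of "\<lambda>t. t *\<^sub>R _"] cong: if_cong)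
  have "matrix M = transpose D"
    by (simp add: matrix_def transpose_def D_def M_def P_axis vec_eq_iff)
  then have detM: "det (matrix M) = det D" by simp
  have P_eq: "P a = \<iota> (a, 0) + dphi u (\<iota> (a, 0))" for a
  proof -
    have "\<iota> (a, 0) = (\<Sum>i\<in>UNIV. a $ i *\<^sub>R w i)" by (simp add: iota_eq)
    moreover have "dphi u (\<Sum>i\<in>UNIV. a $ i *\<^sub>R w i) = (\<Sum>i\<in>UNIV. a $ i *\<^sub>R l i)"
    proof -
      have "dphi u (\<Sum>i\<in>I. a $ i *\<^sub>R w i) = (\<Sum>i\<in>I. a $ i *\<^sub>R l i)" if "finite I" for I
        using that
      proof (induction I)
        case empty
        then show ?case using dphi_vertical[OF u, of 0] by (simp add: zero_prod_def)
      next
        case (insert i I)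
        have "(\<Sum>i\<in>I. a $ i *\<^sub>R w i) \<in> W" using w_in_W subspace_W by (intro subspace_sum subspace_scale)
        then show ?case using insert w_in_W subspace_W
          by (simp add: dphi_add[OF u] dphi_scale[OF u] subspace_scale l_def)
      qed
      then show ?thesis by simp
    qed
    ultimately show ?thesis by (simp add: P_def scaleR_add_right sum.distrib)
  qed
  have "inj M"
  proof (subst linear_injective_0[OF linM], intro allI impI)
    fix a assume "M a = 0"
    then have "P a = 0" by (simp add: P_M)
    then have eq: "\<iota> (a, 0) = - dphi u (\<iota> (a, 0))" unfolding P_eq by (simp add: eq_neg_iff_add_eq_0)
    have "- dphi u (\<iota> (a, 0)) \<in> V" using dphi_V[OF u iota_in_W] subspace_V by (simp add: subspace_neg)
    then have "\<iota> (a, 0) \<in> W \<inter> V" using eq iota_in_W by (metis IntI)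
    then have "\<iota> (a, 0) = 0" using W_inter_V by blast
    then have "norm (a, 0::real) = 0" using norm_iota[of "(a, 0)"] by simp
    then show "a = 0" by (simp add: prod_eq_iff)
  qed
  then have detM0: "det (matrix M) \<noteq> 0" by (simp add: det_nz_iff_inj linM)
  then show "0 < frame_norm * jac_ratio u" using detM detD by simp
  define j where "j e = (\<Sum>i\<in>UNIV. fst e $ i *\<^sub>R \<tau> i) + snd e *\<^sub>R e_top" for e :: "(real^'m) \<times> real"
  have \<tau>\<tau>: "\<tau> i \<bullet> \<tau> j = (if i = j then 1 else 0)" for i j using \<tau> by (simp add: orthonormal_basis_of_def)
  have \<tau>T: "\<tau> i \<in> {y \<in> ?T. snd y = 0}" for i
    using \<tau> span_base[of "\<tau> i" "range \<tau>"] by (auto simp: orthonormal_basis_of_def)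
  have linj: "linear j" unfolding j_def
    by (rule linearI) (simp_all add: scaleR_add_left sum.distrib scaleR_sum_right scaleR_add_right)
  have eT: "e_top \<in> ?T" unfolding tangent_cone_eq(1)[OF u] using Df_e_top[OF x] by simp
  have normj: "norm (j e) = norm e" for e
  proof -
    have s0: "snd (\<Sum>i\<in>UNIV. fst e $ i *\<^sub>R \<tau> i) = 0" using \<tau>T by (simp add: snd_sum)
    have "j e \<bullet> j e = (\<Sum>i\<in>UNIV. fst e $ i *\<^sub>R \<tau> i) \<bullet> (\<Sum>i\<in>UNIV. fst e $ i *\<^sub>R \<tau> i) + snd e * snd e"
      unfolding j_def using s0 by (simp add: inner_add_left inner_add_right)
    also have "(\<Sum>i\<in>UNIV. fst e $ i *\<^sub>R \<tau> i) \<bullet> (\<Sum>i\<in>UNIV. fst e $ i *\<^sub>R \<tau> i) = fst e \<bullet> fst e"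
      by (simp add: inner_sum_left inner_sum_right \<tau>\<tau> inner_vec_def if_distrib[of "\<lambda>t. _ * t"] cong: if_cong)
    finally show ?thesis by (simp add: norm_eq_sqrt_inner inner_prod_def)
  qed
  have range_j: "range j = ?T"
  proof
    show "range j \<subseteq> ?T" unfolding j_def using \<tau>T eT tangent_cone_subspace[OF u]
      by (auto intro!: subspace_add subspace_sum subspace_scale)
    show "?T \<subseteq> range j"
    proof
      fix z assume z: "z \<in> ?T"
      have "z - snd z *\<^sub>R e_top \<in> {y \<in> ?T. snd y = 0}"
        using z eT tangent_cone_subspace[OF u] by (simp add: subspace_diff subspace_scale)
      from orthonormal_basis_expand[OF \<tau> this]
      have "z - snd z *\<^sub>R e_top = (\<Sum>i\<in>UNIV. (\<chi> i. (z - snd z *\<^sub>R e_top) \<bullet> \<tau> i) $ i *\<^sub>R \<tau> i)"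
        unfolding vec_lambda_beta .
      then have "z = j (\<chi> i. (z - snd z *\<^sub>R e_top) \<bullet> \<tau> i, snd z)" unfolding j_def by (simp only: fst_conv snd_conv diff_eq_eq)
      then show "z \<in> range j" by blast
    qed
  qed
  have jM: "j (M a, s) = (\<kappa> a + fst (dphi u (\<iota> (a, 0))), s)" for a s
  proof -
    have "j (M a, s) = P a + s *\<^sub>R e_top" by (simp add: j_def P_M)
    then show ?thesis unfolding P_eq using dphi_V[OF u iota_in_W, of "(a, 0)"] by (simp add: prod_eq_iff e_top_def)
  qed
  have tg: "tangent_graph u (a, s) = (\<kappa> a + fst (dphi u (\<iota> (a, 0))), s + symp (\<kappa> a) (fst (dphi u (\<iota> (a, 0)))) / 2)" for a s
    using dphi_V[OF u iota_in_W, of "(a, 0)"]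
    by (simp add: tangent_graph_def dphi_iota[OF u, of a s] prod_eq_iff)
  show "emeasure (hausdorff_measure (CARD('m) + 1)) (?T \<inter> S) =
      hausdorff_const TYPE((real^'m) \<times> real) * (ennreal (frame_norm * jac_ratio u) * emeasure lborel (tangent_graph u -` S))"
    if S: "S \<in> sets borel"
  proof -
    have mj: "j \<in> borel_measurable borel"
      by (rule borel_measurable_linear[OF linj])
    have jS: "j -` S \<in> sets borel" by (rule vimage_in_borel[OF mj S])
    have prod: "(\<integral>\<^sup>+e. h e \<partial>lborel) = (\<integral>\<^sup>+s. \<integral>\<^sup>+a. h (a, s) \<partial>lborel \<partial>lborel)"
      if "h \<in> borel_measurable (borel :: ((real^'m) \<times> real) measure)" for h :: "(real^'m) \<times> real \<Rightarrow> ennreal"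
      using lborel_pair.nn_integral_snd[of h] that by (simp add: lborel_prod)
    have mM: "M \<in> borel_measurable borel"
      by (rule borel_measurable_linear[OF linM])
    have cM: "continuous_on X M" for X
      by (rule continuous_on_linear[OF linM])
    have mMs: "(\<lambda>e. (M (fst e), snd e)) \<in> borel_measurable (borel :: ((real^'m) \<times> real) measure)"
      by (intro borel_measurable_continuous_onI continuous_intros continuous_on_compose2[OF cM]) auto
    have ind: "indicator (j -` S) \<in> borel_measurable (borel :: ((real^'m) \<times> real) measure)"
      using jS by simp
    have ind2: "(\<lambda>e. indicator (j -` S) (M (fst e), snd e) :: ennreal) \<in> borel_measurable (borel :: ((real^'m) \<times> real) measure)"
      by (rule measurable_compose[OF mMs ind])
    have "emeasure lborel (j -` S) = (\<integral>\<^sup>+e. indicator (j -` S) e \<partial>lborel)" using jS by simp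
    also have "\<dots> = (\<integral>\<^sup>+s. \<integral>\<^sup>+a. indicator (j -` S) (a, s) \<partial>lborel \<partial>lborel)" by (rule prod[OF ind])
    also have "\<dots> = (\<integral>\<^sup>+s. ennreal \<bar>det D\<bar> * (\<integral>\<^sup>+a. indicator (j -` S) (M a, s) \<partial>lborel) \<partial>lborel)"
    proof (rule nn_integral_cong)
      fix s :: real
      have As: "{a. (a, s) \<in> j -` S} \<in> sets borel"
      proof -
        have "(\<lambda>a. (a, s)) \<in> borel_measurable (borel :: (real^'m) measure)"
          by (intro borel_measurable_continuous_onI continuous_intros)
        from vimage_in_borel[OF measurable_compose[OF this mj] S] show ?thesis by (simp add: vimage_def)
      qed
      have "(\<integral>\<^sup>+a. indicator (j -` S) (a, s) \<partial>lborel) = (\<integral>\<^sup>+a. indicator {a. (a, s) \<in> j -` S} a \<partial>lborel)"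
        by (intro nn_integral_cong) (auto split: split_indicator)
      also have "\<dots> = emeasure lborel {a. (a, s) \<in> j -` S}" using As by simp
      also have "\<dots> = ennreal \<bar>det D\<bar> * emeasure lborel (M -` {a. (a, s) \<in> j -` S})"
        using lborel_linear_vimage[OF linM detM0 As] detM by simp
      also have "emeasure lborel (M -` {a. (a, s) \<in> j -` S}) = (\<integral>\<^sup>+a. indicator (M -` {a. (a, s) \<in> j -` S}) a \<partial>lborel)"
        using vimage_in_borel[OF mM As] by simp
      also have "\<dots> = (\<integral>\<^sup>+a. indicator (j -` S) (M a, s) \<partial>lborel)"
        by (intro nn_integral_cong) (auto split: split_indicator)
      finally show "(\<integral>\<^sup>+a. indicator (j -` S) (a, s) \<partial>lborel) =
          ennreal \<bar>det D\<bar> * (\<integral>\<^sup>+a. indicator (j -` S) (M a, s) \<partial>lborel)" .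
    qed
    also have "\<dots> = (\<integral>\<^sup>+s. \<integral>\<^sup>+a. ennreal \<bar>det D\<bar> * indicator (j -` S) (M a, s) \<partial>lborel \<partial>lborel)"
    proof (intro nn_integral_cong nn_integral_cmult[symmetric])
      fix s :: real
      have "(\<lambda>a. (a, s)) \<in> borel_measurable (borel :: (real^'m) measure)"
        by (intro borel_measurable_continuous_onI continuous_intros)
      from measurable_compose[OF this ind2]
      show "(\<lambda>a. indicator (j -` S) (M a, s) :: ennreal) \<in> borel_measurable lborel" by simp
    qed
    also have "\<dots> = (\<integral>\<^sup>+e. ennreal \<bar>det D\<bar> * indicator (j -` S) (M (fst e), snd e) \<partial>lborel)"
      using prod[of "\<lambda>e. ennreal \<bar>det D\<bar> * indicator (j -` S) (M (fst e), snd e)"] ind2 by simp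
    also have "\<dots> = ennreal \<bar>det D\<bar> * (\<integral>\<^sup>+e. indicator (j -` S) (M (fst e), snd e) \<partial>lborel)"
      using ind2 by (intro nn_integral_cmult) simp
    \<comment> \<open>The product in the tangent graph adds half the symplectic form of its two
      factors to the vertical coordinate; this is the shear at scale r = 1.\<close>
    also have "(\<integral>\<^sup>+e. indicator (j -` S) (M (fst e), snd e) \<partial>lborel)
        = (\<integral>\<^sup>+e. indicator (j -` S) (M (fst e), snd e + symp (\<kappa> (fst e)) (fst (dphi u (\<iota> (fst e, 0)))) / 2) \<partial>lborel)"
    proof -
      have "continuous_on UNIV (\<lambda>a. dphi u (\<iota> (a, 0)))"
        by (rule continuous_on_compose2[OF continuous_on_linear[OF linear_dphi_iota[OF u]]])
           (auto intro!: continuous_intros)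
      then have "(\<lambda>a. symp (\<kappa> a) (fst (dphi u (\<iota> (a, 0)))) / 2) \<in> borel_measurable borel"
        by (intro borel_measurable_continuous_onI continuous_intros continuous_on_kappa) auto
      from nn_integral_lborel_shear[OF ind2 this, of 1 0] show ?thesis by simp
    qed
    also have "\<dots> = (\<integral>\<^sup>+e. indicator (tangent_graph u -` S) e \<partial>lborel)"
    proof (rule nn_integral_cong)
      fix e :: "(real^'m) \<times> real"
      show "indicator (j -` S) (M (fst e), snd e + symp (\<kappa> (fst e)) (fst (dphi u (\<iota> (fst e, 0)))) / 2) =
        (indicator (tangent_graph u -` S) e :: ennreal)"
        using tg[of "fst e" "snd e"] by (simp add: indicator_def jM)
    qed
    also have "\<dots> = emeasure lborel (tangent_graph u -` S)"
    proof -
      have "continuous_on UNIV (\<lambda>e. dphi u (\<iota> e))"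
        by (rule continuous_on_linear[OF linear_dphi_iota[OF u]])
      then have "continuous_on UNIV (tangent_graph u)"
        unfolding tangent_graph_def by (intro continuous_intros continuous_on_iota)
      then have "tangent_graph u -` S \<in> sets borel"
        using S by (intro vimage_in_borel borel_measurable_continuous_onI)
      then show ?thesis by simp
    qed
    finally have L: "emeasure lborel (j -` S) = ennreal \<bar>det D\<bar> * emeasure lborel (tangent_graph u -` S)" .
    have "?T \<inter> S = S \<inter> range j" by (simp add: range_j Int_commute)
    moreover have "DIM((real^'m) \<times> real) = CARD('m) + 1" by simp
    ultimately show ?thesis
      using emeasure_hausdorff_isometry[OF linj normj S] L by (simp add: detD)
  qed
qed

text \<open>Both Jacobians are continuous expressions in finitely many values of Df along the graph,
  and the denominator does not vanish by \<open>det_Df_V\<close>.\<close>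

lemma continuous_on_jac_ratio: "continuous_on U jac_ratio"
  unfolding continuous_on_def
proof
  fix u assume u: "u \<in> U"
  have "continuous_on \<Omega> (h_deriv d f)" using def_f by (simp add: defining_function_def C1_h_def)
  note cont = continuous_on_product_then_coordinatewise[OF this]
  have sub: "\<Phi> ` U \<subseteq> \<Omega>" using def_f Sigma_eq by (auto simp: defining_function_def)
  have lim: "((\<lambda>u. Df (\<Phi> u) z $ i) \<longlongrightarrow> Df (\<Phi> u) z $ i) (at u within U)" for z i
    using continuous_on_compose2[OF cont continuous_on_graph sub, of z] u
    by (intro tendsto_intros) (simp add: continuous_on_def)
  have lim2: "((\<lambda>u. sqrt (det (\<chi> i j. \<Sum>b\<in>Basis. (Df (\<Phi> u) b $ i) * (Df (\<Phi> u) b $ j))) /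
      \<bar>det (\<chi> i j. Df (\<Phi> u) (v j) $ i)\<bar>) \<longlongrightarrow>
     sqrt (det (\<chi> i j. \<Sum>b\<in>Basis. (Df (\<Phi> u) b $ i) * (Df (\<Phi> u) b $ j))) /
      \<bar>det (\<chi> i j. Df (\<Phi> u) (v j) $ i)\<bar>) (at u within U)"
    using det_Df_V[OF u] by (intro tendsto_intros lim) auto
  have eq: "jac_ratio u = sqrt (det (\<chi> i j. \<Sum>b\<in>Basis. (Df (\<Phi> u) b $ i) * (Df (\<Phi> u) b $ j))) /
      \<bar>det (\<chi> i j. Df (\<Phi> u) (v j) $ i)\<bar>" if "u \<in> U" for u
    using J_H_eq[OF has_Df[OF graph_in_Sigma[OF that]]] J_V_eq[OF has_Df[OF graph_in_Sigma[OF that]] basis_V]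
    by (simp add: jac_ratio_def)
  have ev: "\<forall>\<^sub>F u in at u within U. sqrt (det (\<chi> i j. \<Sum>b\<in>Basis. (Df (\<Phi> u) b $ i) * (Df (\<Phi> u) b $ j))) /
      \<bar>det (\<chi> i j. Df (\<Phi> u) (v j) $ i)\<bar> = jac_ratio u"
    using eq[symmetric] unfolding eventually_at_filter by (intro always_eventually) blast
  show "(jac_ratio \<longlongrightarrow> jac_ratio u) (at u within U)"
    using Lim_transform_eventually[OF lim2 ev] unfolding eq[OF u, symmetric] .
qed

end

section \<open>Blow-up and the area formula\<close>

context surface
begin

sublocale ball_metric d "CARD('m) + 2" by (rule ball_metric) simp

definition weight :: "'n heis \<Rightarrow> real" where
  "weight u = frame_norm * jac_ratio u"

lemma weight_pos: "u \<in> U \<Longrightarrow> weight u > 0"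
  using tangent_measure(2) by (simp add: weight_def)

lemma continuous_on_weight: "continuous_on U weight"
  unfolding weight_def using continuous_on_jac_ratio by (intro continuous_intros)

section \<open>The weighted graph measure in coordinates\<close>

lemma U_borel: "U \<in> sets borel"
proof -
  obtain T where T: "open T" "U = W \<inter> T" using openin_U by (auto simp: openin_open)
  then show ?thesis using subspace_W by (simp add: closed_subspace)
qed

lemma graph_vimage_borel:
  assumes B: "B \<in> sets borel"
  shows "{u \<in> U. \<Phi> u \<in> B} \<in> sets borel"
proof -
  have "(\<lambda>u. indicator U u *\<^sub>R \<Phi> u) \<in> borel_measurable borel"
    by (rule borel_measurable_continuous_on_indicator[OF U_borel continuous_on_graph])
  from vimage_in_borel[OF this B] have "U \<inter> (\<lambda>u. indicator U u *\<^sub>R \<Phi> u) -` B \<in> sets borel"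
    using U_borel by auto
  moreover have "U \<inter> (\<lambda>u. indicator U u *\<^sub>R \<Phi> u) -` B = {u \<in> U. \<Phi> u \<in> B}" by auto
  ultimately show ?thesis by simp
qed

definition density_on :: "'n heis set \<Rightarrow> 'n heis \<Rightarrow> ennreal" where
  "density_on B u = (if u \<in> U \<and> \<Phi> u \<in> B then ennreal (weight u) else 0)"

lemma density_on_measurable:
  assumes B: "B \<in> sets borel"
  shows "density_on B \<in> borel_measurable borel"
proof -
  have "(\<lambda>u. indicator U u *\<^sub>R weight u) \<in> borel_measurable borel"
    by (rule borel_measurable_continuous_on_indicator[OF U_borel continuous_on_weight])
  then have "(\<lambda>u. ennreal (indicator U u *\<^sub>R weight u) * indicator {u \<in> U. \<Phi> u \<in> B} u) \<in> borel_measurable borel"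
    using graph_vimage_borel[OF B] by measurable
  moreover have "density_on B = (\<lambda>u. ennreal (indicator U u *\<^sub>R weight u) * indicator {u \<in> U. \<Phi> u \<in> B} u)"
    by (auto simp: density_on_def fun_eq_iff split: split_indicator)
  ultimately show ?thesis by simp
qed

lemma iota_measurable: "\<iota> \<in> borel_measurable borel"
  by (rule borel_measurable_continuous_onI[OF continuous_on_iota])

text \<open>Weighted Lebesgue measure on W pushed to the surface, without the factor
  \<open>hausdorff_const\<close>. Off \<open>U\<close>, where \<Phi> is arbitrary, the map is
  replaced by 0, which makes it Borel; the density vanishes there.\<close>

definition graph_measure :: "'n heis measure" where
  "graph_measure = distr (density lborel (\<lambda>e. density_on UNIV (\<iota> e))) borel (\<lambda>e. indicator U (\<iota> e) *\<^sub>R \<Phi> (\<iota> e))"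

lemma sets_graph_measure: "sets graph_measure = sets borel"
  by (simp add: graph_measure_def)

lemma emeasure_graph_measure:
  assumes B: "B \<in> sets borel"
  shows "emeasure graph_measure B = (\<integral>\<^sup>+e. density_on B (\<iota> e) \<partial>lborel)"
proof -
  have m: "(\<lambda>e. indicator U (\<iota> e) *\<^sub>R \<Phi> (\<iota> e)) \<in> borel_measurable borel"
    using borel_measurable_continuous_on_indicator[OF U_borel continuous_on_graph]
    by (rule measurable_compose[OF iota_measurable])
  have d: "(\<lambda>e. density_on UNIV (\<iota> e)) \<in> borel_measurable borel"
    by (rule measurable_compose[OF iota_measurable density_on_measurable]) simp
  let ?A = "(\<lambda>e. indicator U (\<iota> e) *\<^sub>R \<Phi> (\<iota> e)) -` B"
  have A: "?A \<in> sets borel" by (rule vimage_in_borel[OF m B])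
  have "emeasure graph_measure B = emeasure (density lborel (\<lambda>e. density_on UNIV (\<iota> e))) ?A"
    unfolding graph_measure_def using m B by (subst emeasure_distr) auto
  also have "\<dots> = (\<integral>\<^sup>+e. density_on UNIV (\<iota> e) * indicator ?A e \<partial>lborel)"
    using d A by (intro emeasure_density) auto
  also have "\<dots> = (\<integral>\<^sup>+e. density_on B (\<iota> e) \<partial>lborel)"
    by (intro nn_integral_cong) (auto simp: density_on_def split: split_indicator)
  finally show ?thesis .
qed

text \<open>The integrand after zooming in at \<open>\<Phi> u\<close> with scale r, for the ball
  with centre z and radius \<rho>. The radius is kept apart from the scale because the lower density
  estimate takes it slightly above 1.\<close>

definition kernel :: "'n heis \<Rightarrow> real \<Rightarrow> 'n heis \<Rightarrow> real \<Rightarrow> (real^'m) \<times> real \<Rightarrow> ennreal" where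
  "kernel u r z \<rho> e = (if \<sigma> u (dil r (\<iota> e)) \<in> U \<and> d z (rescaled_graph u r e) \<le> \<rho>
     then ennreal (weight (\<sigma> u (dil r (\<iota> e)))) else 0)"

lemma sigma_dil_iota:
  assumes u: "u \<in> U"
  shows "\<sigma> u (dil r (\<iota> e)) = \<iota> (fst (coord u) + r *\<^sub>R fst e, r\<^sup>2 * snd e +
    (snd (coord u) + (symp (\<kappa> (fst (coord u))) (\<kappa> (r *\<^sub>R fst e)) / 2 + symp (fst (\<phi> u)) (\<kappa> (r *\<^sub>R fst e)))))"
proof -
  have "\<Phi> u = \<iota> (coord u) \<odot> \<phi> u" using iota_coord[OF U_W[OF u]] by (simp add: graph_map_def)
  then show ?thesis using sigma_tr_iota[OF phi_in_V[OF u], of "coord u" "(r *\<^sub>R fst e, r\<^sup>2 * snd e)"]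
    by (simp add: dil_iota add_ac)
qed

text \<open>Left invariance and homogeneity of \<open>d\<close> turn the ball into a condition on
  the rescaled graph, and in coordinates the parametrization is the map of
  \<open>nn_integral_lborel_shear\<close>, whose Jacobian is the power of r. No error term appears
  at any scale.\<close>

lemma
  assumes u: "u \<in> U" and r: "r > 0"
  shows kernel_measurable: "kernel u r z \<rho> \<in> borel_measurable borel"
    and graph_measure_ball: "emeasure graph_measure (cb (\<Phi> u \<odot> dil r z) (\<rho> * r)) =
      ennreal (r ^ (CARD('m) + 2)) * (\<integral>\<^sup>+e. kernel u r z \<rho> e \<partial>lborel)"
proof -
  let ?B = "cb (\<Phi> u \<odot> dil r z) (\<rho> * r)"
  define G where "G a = snd (coord u) + (symp (\<kappa> (fst (coord u))) (\<kappa> (r *\<^sub>R a)) / 2 + symp (fst (\<phi> u)) (\<kappa> (r *\<^sub>R a)))" for a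
  have cG: "continuous_on X G" for X unfolding G_def
    by (intro continuous_intros continuous_on_compose2[OF continuous_on_kappa[of UNIV]]) auto
  have h: "(\<lambda>e. density_on ?B (\<iota> e)) \<in> borel_measurable borel"
    by (rule measurable_compose[OF iota_measurable density_on_measurable]) (rule cb_borel)
  have eq: "kernel u r z \<rho> e = density_on ?B (\<iota> (fst (coord u) + r *\<^sub>R fst e, r\<^sup>2 * snd e + G (fst e)))" for e
  proof -
    let ?s = "\<sigma> u (dil r (\<iota> e))"
    have "d (\<Phi> u \<odot> dil r z) (\<Phi> ?s) = r * d z (rescaled_graph u r e)"
    proof -
      have "\<Phi> ?s = \<Phi> u \<odot> dil r (rescaled_graph u r e)" using r by (simp add: rescaled_graph_def)
      then show ?thesis using r by (simp only: d_left d_dil)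
    qed
    then have "\<Phi> ?s \<in> ?B \<longleftrightarrow> d z (rescaled_graph u r e) \<le> \<rho>" using r by (simp add: mult.commute)
    then show ?thesis
      unfolding kernel_def density_on_def sigma_dil_iota[OF u, symmetric] G_def by (simp add: sigma_dil_iota[OF u])
  qed
  have "(\<lambda>e. (fst (coord u) + r *\<^sub>R fst e, r\<^sup>2 * snd e + G (fst e))) \<in> borel_measurable (borel :: ((real^'m) \<times> real) measure)"
    by (intro borel_measurable_continuous_onI continuous_intros continuous_on_compose2[OF cG[of UNIV]]) auto
  from measurable_compose[OF this h] show "kernel u r z \<rho> \<in> borel_measurable borel" unfolding eq[abs_def] .
  have "emeasure graph_measure ?B = (\<integral>\<^sup>+e. density_on ?B (\<iota> e) \<partial>lborel)"
    by (rule emeasure_graph_measure[OF cb_borel])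
  also have "\<dots> = ennreal (r ^ (CARD('m) + 2)) *
     (\<integral>\<^sup>+e. density_on ?B (\<iota> (fst (coord u) + r *\<^sub>R fst e, r\<^sup>2 * snd e + G (fst e))) \<partial>lborel)"
    by (rule nn_integral_lborel_shear[OF h borel_measurable_continuous_onI[OF cG] r])
  finally show "emeasure graph_measure ?B = ennreal (r ^ (CARD('m) + 2)) * (\<integral>\<^sup>+e. kernel u r z \<rho> e \<partial>lborel)"
    unfolding eq .
qed

text \<open>The W-factor depends continuously on the point, so it is bounded on a compact ball,
  uniformly in the V-factor b.\<close>

lemma iota_bounded_in_balls: "\<exists>R. \<forall>e b. b \<in> V \<longrightarrow> N (\<iota> e \<odot> b) \<le> \<rho> \<longrightarrow> norm e \<le> R"
proof -
  have "compact (projW ` {x. N x \<le> \<rho>})"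
    by (rule compact_continuous_image[OF continuous_on_projW N_ball_compact])
  then obtain R where R: "\<And>y. y \<in> projW ` {x. N x \<le> \<rho>} \<Longrightarrow> norm y \<le> R"
    using compact_imp_bounded bounded_iff by metis
  have "norm e \<le> R" if "b \<in> V" "N (\<iota> e \<odot> b) \<le> \<rho>" for e b
  proof -
    have "\<iota> e = projW (\<iota> e \<odot> b)" using that iota_in_W by (simp add: projW_hmul)
    then have "norm (\<iota> e) \<le> R" using that by (intro R) blast
    then show ?thesis by (simp add: norm_iota)
  qed
  then show ?thesis by blast
qed

lemma weight_locally_bounded:
  assumes u: "u \<in> U"
  obtains \<delta> where "\<delta> > 0" "\<And>y. y \<in> U \<Longrightarrow> norm (y - u) < \<delta> \<Longrightarrow> weight y \<le> weight u + 1"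
proof -
  have "(weight \<longlongrightarrow> weight u) (at u within U)" using continuous_on_weight u by (simp add: continuous_on_def)
  then have "\<forall>\<^sub>F y in at u within U. weight y < weight u + 1" by (rule order_tendstoD) simp
  then obtain \<delta> where \<delta>: "\<delta> > 0" "\<And>y. y \<in> U \<Longrightarrow> y \<noteq> u \<Longrightarrow> dist y u < \<delta> \<Longrightarrow> weight y < weight u + 1"
    unfolding eventually_at by blast
  show ?thesis
  proof (rule that[OF \<delta>(1)])
    show "weight y \<le> weight u + 1" if "y \<in> U" "norm (y - u) < \<delta>" for y
      using \<delta>(2)[of y] that by (cases "y = u") (simp_all add: dist_norm)
  qed
qed

text \<open>The integrable majorant for the limsup form of Fatou's lemma. Where the kernel is
  nonzero, the rescaled point has norm at most N z + \<rho> \<le> 3, so e is bounded; for small r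
  the parameter is then so close to u that the weight exceeds its value at u by at most 1.\<close>

lemma kernel_dominated:
  assumes u: "u \<in> U"
  obtains r0 R where "r0 > 0" "\<And>r z \<rho> e. 0 < r \<Longrightarrow> r < r0 \<Longrightarrow> N z \<le> 1 \<Longrightarrow> \<rho> \<le> 2 \<Longrightarrow>
    kernel u r z \<rho> e \<le> ennreal (weight u + 1) * indicator (cball 0 R) e"
proof -
  obtain R where R: "\<And>e b. b \<in> V \<Longrightarrow> N (\<iota> e \<odot> b) \<le> 3 \<Longrightarrow> norm e \<le> R" using iota_bounded_in_balls by blast
  obtain \<delta> where \<delta>: "\<delta> > 0" "\<And>y. y \<in> U \<Longrightarrow> norm (y - u) < \<delta> \<Longrightarrow> weight y \<le> weight u + 1"
    using weight_locally_bounded[OF u] by blast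
  define l where "l a = symp (\<kappa> (fst (coord u))) (\<kappa> a) / 2 + symp (fst (\<phi> u)) (\<kappa> a)" for a
  have "linear l" unfolding l_def
    by (rule linearI) (simp_all add: kappa_simps symp_simps add_divide_distrib algebra_simps)
  then obtain K where K: "K > 0" "\<And>a. norm (l a) \<le> K * norm a" using linear_bounded_pos by blast
  have R0: "R \<ge> 0" using R[of 0 0] subspace_0[OF subspace_V] linear_0[OF linear_iota] by simp
  \<comment> \<open>The parameter is displaced from u by at most r (R + R + K R): the horizontal
    part, the dilated vertical part with r^2 \<le> r, and the linear vertical term
    \<open>l\<close>.\<close>
  define r0 where "r0 = min 1 (\<delta> / (2 * R + K * R + 1))"
  have pos: "2 * R + K * R + 1 > 0" using R0 K by (simp add: add_nonneg_pos)
  have r0: "r0 > 0" using \<delta> pos by (simp add: r0_def)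
  show ?thesis
  proof (rule that[OF r0])
    fix r z \<rho> e assume r: "0 < r" "r < r0" and z: "N z \<le> 1" and \<rho>: "\<rho> \<le> (2::real)"
    let ?s = "\<sigma> u (dil r (\<iota> e))"
    show "kernel u r z \<rho> e \<le> ennreal (weight u + 1) * indicator (cball 0 R) e"
    proof (cases "?s \<in> U \<and> d z (rescaled_graph u r e) \<le> \<rho>")
      case True
      define b where "b = dil (1 / r) (\<phi> ?s - \<phi> u)"
      have "\<phi> ?s - \<phi> u \<in> V" using True u phi_in_V subspace_V by (simp add: subspace_diff)
      then have bV: "b \<in> V" using subspace_V by (simp add: b_def dil_V subspace_scale)
      have F: "rescaled_graph u r e = \<iota> e \<odot> b" using rescaled_graph_eq[OF u r(1)] True by (simp add: b_def)
      have "N (\<iota> e \<odot> b) \<le> d (\<iota> e \<odot> b) z + N z" using triangle[of "\<iota> e \<odot> b" z 0] by (simp add: hnorm_def)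
      then have eR: "norm e \<le> R" using True z \<rho> F by (intro R[OF bV]) (simp add: commute)
      have fe: "norm (fst e) \<le> R" "\<bar>snd e\<bar> \<le> R"
        using eR norm_fst_le[of "fst e" "snd e"] norm_snd_le[of "snd e" "fst e"] by simp_all
      have "?s - u = \<iota> (r *\<^sub>R fst e, r\<^sup>2 * snd e + r * l (fst e))"
      proof -
        have "?s - u = ?s - \<iota> (coord u)" using iota_coord[OF U_W[OF u]] by simp
        also have "\<dots> = \<iota> (r *\<^sub>R fst e, r\<^sup>2 * snd e + r * l (fst e))"
          unfolding sigma_dil_iota[OF u] linear_diff[OF linear_iota, symmetric]
          by (rule arg_cong[of _ _ \<iota>]) (simp add: prod_eq_iff l_def kappa_simps algebra_simps)
        finally show ?thesis .
      qed
      then have "norm (?s - u) \<le> norm (r *\<^sub>R fst e) + norm (r\<^sup>2 * snd e + r * l (fst e))"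
        using norm_iota norm_Pair_le[of "r *\<^sub>R fst e" "r\<^sup>2 * snd e + r * l (fst e)"] by simp
      also have "\<dots> \<le> r * R + (r * R + r * (K * R))"
      proof (intro add_mono)
        show "norm (r *\<^sub>R fst e) \<le> r * R" using r fe by simp
        have "\<bar>r\<^sup>2 * snd e\<bar> \<le> r * R"
        proof -
          have "r\<^sup>2 \<le> r * 1" unfolding power2_eq_square using r by (intro mult_left_mono) (auto simp: r0_def)
          then have "r\<^sup>2 * \<bar>snd e\<bar> \<le> r * R" using fe r by (intro mult_mono) auto
          then show ?thesis by (simp add: abs_mult)
        qed
        moreover have "\<bar>r * l (fst e)\<bar> \<le> r * (K * R)"
        proof -
          have "\<bar>l (fst e)\<bar> \<le> K * R" 
            using order_trans[OF K(2)[of "fst e"] mult_left_mono[OF fe(1), of K]] K(1) by simp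
          then show ?thesis using r by (simp add: abs_mult)
        qed
        ultimately show "norm (r\<^sup>2 * snd e + r * l (fst e)) \<le> r * R + r * (K * R)"
          using abs_triangle_ineq[of "r\<^sup>2 * snd e" "r * l (fst e)"] by simp
      qed
      also have "\<dots> < r * (2 * R + K * R + 1)" using r by (simp add: algebra_simps)
      also have "\<dots> \<le> \<delta>" using r pos by (simp add: r0_def field_simps)
      finally have "weight ?s \<le> weight u + 1" using True by (intro \<delta>) auto
      then show ?thesis using True eR by (simp add: kernel_def ennreal_leI)
    next
      case False
      then have "kernel u r z \<rho> e = 0" unfolding kernel_def by (rule if_not_P)
      then show ?thesis by simp
    qed
  qed
qed

lemma tendsto_weight_sigma:
  assumes u: "u \<in> U" and \<rho>: "filterlim \<rho> (at_right 0) sequentially"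
  shows "(\<lambda>n. ennreal (weight (\<sigma> u (dil (\<rho> n) (\<iota> e))))) \<longlonglongrightarrow> ennreal (weight u)"
    and "\<forall>\<^sub>F n in sequentially. \<sigma> u (dil (\<rho> n) (\<iota> e)) \<in> U"
    and "(\<lambda>n. rescaled_graph u (\<rho> n) e) \<longlonglongrightarrow> tangent_graph u e"
proof -
  have s: "(\<lambda>n. \<sigma> u (dil (\<rho> n) (\<iota> e))) \<longlonglongrightarrow> u"
    by (rule filterlim_compose[OF tendsto_sigma_dil(1)[OF u] \<rho>])
  show ev: "\<forall>\<^sub>F n in sequentially. \<sigma> u (dil (\<rho> n) (\<iota> e)) \<in> U"
    by (rule eventually_in_U[OF s u]) (intro sigma_tr_in_W dil_W iota_in_W)
  show "(\<lambda>n. ennreal (weight (\<sigma> u (dil (\<rho> n) (\<iota> e))))) \<longlonglongrightarrow> ennreal (weight u)"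
    by (intro tendsto_ennrealI continuous_on_tendsto_compose[OF continuous_on_weight s u ev])
  show "(\<lambda>n. rescaled_graph u (\<rho> n) e) \<longlonglongrightarrow> tangent_graph u e"
    by (rule filterlim_compose[OF tendsto_rescaled_graph[OF u] \<rho>])
qed

text \<open>The spherical factor of the tangent cone read in coordinates of W, up to the factor
  \<open>hausdorff_const\<close>.\<close>

definition tangent_factor :: "'n heis \<Rightarrow> ennreal" where
  "tangent_factor u = (SUP z\<in>hball d 0 1. ennreal (weight u) * emeasure lborel (tangent_graph u -` cb z 1))"

section \<open>Upper and lower densities of the graph measure\<close>

lemma continuous_on_tangent_graph: "u \<in> U \<Longrightarrow> continuous_on S (tangent_graph u)"
  unfolding tangent_graph_def
  by (intro continuous_intros continuous_on_iota continuous_on_linear linear_dphi_iota)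

lemma tangent_vimage_borel: "u \<in> U \<Longrightarrow> S \<in> sets borel \<Longrightarrow> tangent_graph u -` S \<in> sets borel"
  by (intro vimage_in_borel borel_measurable_continuous_onI continuous_on_tangent_graph)

text \<open>A failure produces balls shrinking to \<open>\<Phi> u\<close> whose rescaled centres lie
  in the compact unit ball, hence converge to some z0 along a subsequence. The balls being closed,
  the limsup of the kernels is at most the weighted indicator of the limit ball, and the reverse
  Fatou lemma contradicts the bound on \<open>tangent_factor\<close>.\<close>

lemma tangent_factor_upper:
  assumes u: "u \<in> U" and t: "t > 0" and less: "tangent_factor u < ennreal t"
  shows "\<exists>\<delta>>0. \<forall>y r. 0 < r \<and> r < \<delta> \<and> d y (\<Phi> u) \<le> r \<longrightarrow>
    emeasure graph_measure (cb y r) \<le> ennreal (t * r ^ (CARD('m) + 2))"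
proof (rule ccontr)
  assume neg: "\<not> ?thesis"
  obtain r0 R where r0: "r0 > 0" and dom: "\<And>r z \<rho> e. 0 < r \<Longrightarrow> r < r0 \<Longrightarrow> N z \<le> 1 \<Longrightarrow> \<rho> \<le> 2 \<Longrightarrow>
    kernel u r z \<rho> e \<le> ennreal (weight u + 1) * indicator (cball 0 R) e"
    using kernel_dominated[OF u] by blast
  have "\<exists>y r. 0 < r \<and> r < r0 / real (Suc n) \<and> d y (\<Phi> u) \<le> r \<and> ennreal (t * r ^ (CARD('m) + 2)) < emeasure graph_measure (cb y r)" for n
    using neg r0 by (auto simp: not_le dest!: spec[of _ "r0 / real (Suc n)"])
  then obtain y r where r: "\<And>n. 0 < r n" "\<And>n. r n < r0 / real (Suc n)" and y: "\<And>n. d (y n) (\<Phi> u) \<le> r n"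
    and big: "\<And>n. ennreal (t * r n ^ (CARD('m) + 2)) < emeasure graph_measure (cb (y n) (r n))" by metis
  define z where "z n = dil (1 / r n) (hinv (\<Phi> u) \<odot> y n)" for n
  have y_eq: "y n = \<Phi> u \<odot> dil (r n) (z n)" for n using r(1)[of n] by (simp add: z_def)
  have Nz: "N (z n) \<le> 1" for n
  proof -
    have "N (z n) = 1 / r n * d (y n) (\<Phi> u)" using r(1)[of n] by (simp add: z_def N_dil d_eq_N)
    then show ?thesis using y[of n] r(1)[of n] by simp
  qed
  obtain s z0 where s: "strict_mono s" and z0: "N z0 \<le> 1" and lim: "(z \<circ> s) \<longlonglongrightarrow> z0"
    using N_ball_compact[of 1] Nz unfolding compact_def by (metis (mono_tags, lifting) mem_Collect_eq)
  have "(\<lambda>n. r0 * inverse (real (Suc n))) \<longlonglongrightarrow> r0 * 0"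
    by (intro tendsto_intros LIMSEQ_inverse_real_of_nat)
  then have up0: "(\<lambda>n. r0 / real (Suc n)) \<longlonglongrightarrow> 0" by (simp add: divide_inverse)
  have "r \<longlonglongrightarrow> 0"
    by (rule tendsto_sandwich[OF _ _ tendsto_const up0]) (use less_imp_le[OF r(1)] less_imp_le[OF r(2)] in \<open>auto intro!: always_eventually\<close>)
  then have "filterlim r (at_right 0) sequentially"
    using r(1) less_imp_neq[OF r(1), symmetric] by (auto simp: filterlim_at intro!: always_eventually)
  then have rs: "filterlim (\<lambda>n. r (s n)) (at_right 0) sequentially"
    using filterlim_subseq[OF s] by (rule filterlim_compose)
  have rr0: "r n < r0" for n
  proof -
    have "r0 / real (Suc n) \<le> r0 / 1" using r0 by (intro divide_left_mono) auto
    then show ?thesis using r(2)[of n] by simp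
  qed
  let ?K = "\<lambda>n. kernel u (r (s n)) (z (s n)) 1"
  have K_big: "ennreal t \<le> (\<integral>\<^sup>+e. ?K n e \<partial>lborel)" for n
  proof -
    have ball: "emeasure graph_measure (cb (y (s n)) (r (s n))) =
        ennreal (r (s n) ^ (CARD('m) + 2)) * (\<integral>\<^sup>+e. ?K n e \<partial>lborel)"
      using graph_measure_ball[OF u r(1)[of "s n"], of "z (s n)" 1] unfolding y_eq[symmetric] by simp
    show ?thesis
    proof (rule ccontr)
      assume "\<not> ennreal t \<le> (\<integral>\<^sup>+e. ?K n e \<partial>lborel)"
      then have "ennreal (r (s n) ^ (CARD('m) + 2)) * (\<integral>\<^sup>+e. ?K n e \<partial>lborel)
          \<le> ennreal (r (s n) ^ (CARD('m) + 2)) * ennreal t" by (intro mult_left_mono) auto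
      also have "\<dots> = ennreal (t * r (s n) ^ (CARD('m) + 2))"
        using t r(1)[of "s n"] by (subst ennreal_mult[symmetric]) (auto simp: mult.commute)
      finally show False using big[of "s n"] unfolding ball by simp
    qed
  qed
  have ptw: "limsup (\<lambda>n. ?K n e) \<le> ennreal (weight u) * indicator (tangent_graph u -` cb z0 1) e" for e
  proof (cases "d z0 (tangent_graph u e) \<le> 1")
    case True
    have "limsup (\<lambda>n. ?K n e) \<le> limsup (\<lambda>n. ennreal (weight (\<sigma> u (dil (r (s n)) (\<iota> e)))))"
      by (intro Limsup_mono always_eventually) (simp add: kernel_def)
    also have "\<dots> = ennreal (weight u)"
      by (rule lim_imp_Limsup[OF trivial_limit_sequentially tendsto_weight_sigma(1)[OF u rs]])
    finally show ?thesis using True by simp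
  next
    case False
    have "(\<lambda>n. d (z (s n)) (rescaled_graph u (r (s n)) e)) \<longlonglongrightarrow> d z0 (tangent_graph u e)"
      using lim tendsto_weight_sigma(3)[OF u rs] by (intro tendsto_d) (simp_all add: o_def)
    then have "\<forall>\<^sub>F n in sequentially. 1 < d (z (s n)) (rescaled_graph u (r (s n)) e)"
      using False by (intro order_tendstoD) auto
    then have "\<forall>\<^sub>F n in sequentially. ?K n e \<le> 0" by eventually_elim (simp add: kernel_def)
    then have "limsup (\<lambda>n. ?K n e) \<le> 0" by (rule Limsup_bounded)
    then show ?thesis by (simp add: order_trans)
  qed
  have "ennreal t \<le> limsup (\<lambda>n. \<integral>\<^sup>+e. ?K n e \<partial>lborel)"
    using K_big by (intro le_Limsup always_eventually) auto
  also have "\<dots> \<le> (\<integral>\<^sup>+e. limsup (\<lambda>n. ?K n e) \<partial>lborel)"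
  proof (rule nn_integral_limsup)
    show "?K n \<in> borel_measurable lborel" for n using kernel_measurable[OF u r(1)] by simp
    show "(\<lambda>e. ennreal (weight u + 1) * indicator (cball 0 R) e) \<in> borel_measurable (lborel :: ((real^'m) \<times> real) measure)"
      by (intro borel_measurable_times_ennreal borel_measurable_const borel_measurable_indicator) simp
    show "AE e in lborel. ?K n e \<le> ennreal (weight u + 1) * indicator (cball 0 R) e" for n
      using dom[OF r(1) rr0 Nz] by (intro AE_I2) simp
    show "(\<integral>\<^sup>+e. ennreal (weight u + 1) * indicator (cball 0 R) e \<partial>(lborel :: ((real^'m) \<times> real) measure)) < \<infinity>"
      using emeasure_lborel_cball_finite[of "0 :: (real^'m) \<times> real" R]
      by (subst nn_integral_cmult_indicator) (auto simp: ennreal_mult_less_top)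
  qed
  also have "\<dots> \<le> (\<integral>\<^sup>+e. ennreal (weight u) * indicator (tangent_graph u -` cb z0 1) e \<partial>lborel)"
    by (intro nn_integral_mono ptw)
  also have "\<dots> = ennreal (weight u) * emeasure lborel (tangent_graph u -` cb z0 1)"
    using tangent_vimage_borel[OF u cb_borel] by (intro nn_integral_cmult_indicator) simp
  also have "\<dots> \<le> tangent_factor u"
    unfolding tangent_factor_def using z0 by (intro SUP_upper) (simp add: hball_def hnorm_def commute)
  finally show False using less by simp
qed

text \<open>A boundary point of the unit ball around z may be approached by graph points outside
  that ball, so the kernels are taken with radius \<rho> > 1. The strict inequality for t leaves
  room for the resulting power of \<rho>, and the balls found have radius \<rho> r.\<close>

lemma tangent_factor_lower:
  assumes u: "u \<in> U" and t: "t > 0" and less: "ennreal t < tangent_factor u" and \<delta>: "\<delta> > 0"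
  shows "\<exists>y r. 0 < r \<and> r < \<delta> \<and> d y (\<Phi> u) \<le> r \<and> ennreal (t * r ^ (CARD('m) + 2)) \<le> emeasure graph_measure (cb y r)"
proof -
  obtain z where z: "z \<in> hball d 0 1" and tz: "ennreal t < ennreal (weight u) * emeasure lborel (tangent_graph u -` cb z 1)"
    using less unfolding tangent_factor_def less_SUP_iff by blast
  have Nz: "N z \<le> 1" using z by (simp add: hball_def hnorm_def commute)
  have "ennreal (t * 1 ^ (CARD('m) + 2)) < ennreal (weight u) * emeasure lborel (tangent_graph u -` cb z 1)" using tz by simp
  then obtain \<rho> where \<rho>: "1 < \<rho>" "\<rho> < 2"
    "ennreal (t * \<rho> ^ (CARD('m) + 2)) < ennreal (weight u) * emeasure lborel (tangent_graph u -` cb z 1)"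
    by (rule enlarge_ball[of t 1 _ 2]) auto
  \<comment> \<open>Half of \<delta>, because the final radius \<rho> r is below 2r.\<close>
  define r where "r n = (\<delta> / 2) / real (Suc n)" for n
  have r: "r n > 0" "r n \<le> \<delta> / 2" for n
  proof -
    show "r n > 0" using \<delta> by (simp add: r_def)
    have "(\<delta> / 2) / real (Suc n) \<le> (\<delta> / 2) / 1" using \<delta> by (intro divide_left_mono) auto
    then show "r n \<le> \<delta> / 2" by (simp add: r_def)
  qed
  have "(\<lambda>n. (\<delta> / 2) * inverse (real (Suc n))) \<longlonglongrightarrow> (\<delta> / 2) * 0"
    by (intro tendsto_intros LIMSEQ_inverse_real_of_nat)
  moreover have "r = (\<lambda>n. (\<delta> / 2) * inverse (real (Suc n)))"
    by (rule ext) (simp only: r_def divide_inverse)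
  ultimately have "r \<longlonglongrightarrow> 0" by (simp only: mult_zero_right)
  then have rs: "filterlim r (at_right 0) sequentially"
    using r(1) less_imp_neq[OF r(1), symmetric] by (auto simp: filterlim_at intro!: always_eventually)
  let ?K = "\<lambda>n. kernel u (r n) z \<rho>"
  have ptw: "ennreal (weight u) * indicator (tangent_graph u -` cb z 1) e \<le> liminf (\<lambda>n. ?K n e)" for e
  proof (cases "d z (tangent_graph u e) \<le> 1")
    case True
    have "(\<lambda>n. d z (rescaled_graph u (r n) e)) \<longlonglongrightarrow> d z (tangent_graph u e)"
      using tendsto_weight_sigma(3)[OF u rs] by (intro tendsto_d tendsto_const)
    then have "\<forall>\<^sub>F n in sequentially. d z (rescaled_graph u (r n) e) < \<rho>"
      by (rule order_tendstoD) (use True \<rho> in simp)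
    with tendsto_weight_sigma(2)[OF u rs, of e]
    have "\<forall>\<^sub>F n in sequentially. ennreal (weight (\<sigma> u (dil (r n) (\<iota> e)))) \<le> ?K n e"
      by eventually_elim (simp add: kernel_def)
    then have "liminf (\<lambda>n. ennreal (weight (\<sigma> u (dil (r n) (\<iota> e))))) \<le> liminf (\<lambda>n. ?K n e)"
      by (rule Liminf_mono)
    moreover have "liminf (\<lambda>n. ennreal (weight (\<sigma> u (dil (r n) (\<iota> e))))) = ennreal (weight u)"
      by (rule lim_imp_Liminf[OF trivial_limit_sequentially tendsto_weight_sigma(1)[OF u rs]])
    ultimately show ?thesis using True by simp
  qed simp
  have "ennreal (t * \<rho> ^ (CARD('m) + 2)) < ennreal (weight u) * emeasure lborel (tangent_graph u -` cb z 1)" by (rule \<rho>(3))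
  also have "\<dots> = (\<integral>\<^sup>+e. ennreal (weight u) * indicator (tangent_graph u -` cb z 1) e \<partial>lborel)"
    using tangent_vimage_borel[OF u cb_borel] by (intro nn_integral_cmult_indicator[symmetric]) simp
  also have "\<dots> \<le> (\<integral>\<^sup>+e. liminf (\<lambda>n. ?K n e) \<partial>lborel)" by (intro nn_integral_mono ptw)
  also have "\<dots> \<le> liminf (\<lambda>n. \<integral>\<^sup>+e. ?K n e \<partial>lborel)"
    using kernel_measurable[OF u r(1)] by (intro nn_integral_liminf) simp
  finally have "ennreal (t * \<rho> ^ (CARD('m) + 2)) < liminf (\<lambda>n. \<integral>\<^sup>+e. ?K n e \<partial>lborel)" .
  from less_LiminfD[OF this]
  have "\<forall>\<^sub>F n in sequentially. ennreal (t * \<rho> ^ (CARD('m) + 2)) < (\<integral>\<^sup>+e. ?K n e \<partial>lborel)" .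
  then obtain n where n: "ennreal (t * \<rho> ^ (CARD('m) + 2)) < (\<integral>\<^sup>+e. ?K n e \<partial>lborel)"
    by (auto simp: eventually_sequentially)
  let ?y = "\<Phi> u \<odot> dil (r n) z"
  have "ennreal (t * (\<rho> * r n) ^ (CARD('m) + 2)) = ennreal (r n ^ (CARD('m) + 2)) * ennreal (t * \<rho> ^ (CARD('m) + 2))"
    using r(1)[of n] t \<rho> by (subst ennreal_mult[symmetric]) (simp_all add: power_mult_distrib ac_simps del: power_add power_Suc)
  also have "\<dots> \<le> ennreal (r n ^ (CARD('m) + 2)) * (\<integral>\<^sup>+e. ?K n e \<partial>lborel)" using n by (intro mult_left_mono) auto
  also have "\<dots> = emeasure graph_measure (cb ?y (\<rho> * r n))" by (rule graph_measure_ball[OF u r(1), symmetric])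
  finally have big: "ennreal (t * (\<rho> * r n) ^ (CARD('m) + 2)) \<le> emeasure graph_measure (cb ?y (\<rho> * r n))" .
  have "d ?y (\<Phi> u) = N (dil (r n) z)" by (simp add: d_eq_N)
  also have "\<dots> \<le> r n * 1" unfolding N_dil[OF r(1)] using Nz r(1)[of n] by (intro mult_left_mono) auto
  also have "\<dots> \<le> \<rho> * r n" using \<rho> r(1)[of n] by simp
  finally have "d ?y (\<Phi> u) \<le> \<rho> * r n" .
  moreover have "\<rho> * r n < 2 * r n" using \<rho> r(1)[of n] by simp
  then have "\<rho> * r n < \<delta>" using r(2)[of n] by simp
  moreover have "0 < \<rho> * r n" using \<rho> r(1)[of n] by simp
  ultimately show ?thesis using big by blast
qed

text \<open>Together with \<open>tangent_factor_finite\<close> this meets the hypotheses of the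
  layer decomposition. The centre z = 0 suffices, since the tangent graph passes through the origin
  and a neighbourhood of its parameter stays in the unit ball.\<close>

lemma tangent_factor_pos: "u \<in> U \<Longrightarrow> 0 < tangent_factor u"
proof -
  assume u: "u \<in> U"
  have "open (tangent_graph u -` {x. d 0 x < 1})"
    by (rule open_vimage[OF open_mball continuous_on_tangent_graph[OF u]])
  moreover have "dphi u 0 = 0" using dphi_vertical[OF u, of 0] by (simp add: zero_prod_def)
  then have "tangent_graph u 0 = 0" by (simp add: tangent_graph_def linear_0[OF linear_iota])
  then have "0 \<in> tangent_graph u -` {x. d 0 x < 1}" by simp
  ultimately obtain \<epsilon> where \<epsilon>: "\<epsilon> > 0" "ball 0 \<epsilon> \<subseteq> tangent_graph u -` {x. d 0 x < 1}"
    using Elementary_Metric_Spaces.open_contains_ball by blast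
  have "0 < emeasure lborel (ball (0 :: (real^'m) \<times> real) \<epsilon>)"
    using \<epsilon>(1) by (simp add: emeasure_ball)
  also have "\<dots> \<le> emeasure lborel (tangent_graph u -` cb 0 1)"
    using \<epsilon>(2) tangent_vimage_borel[OF u cb_borel] by (intro emeasure_mono) (auto intro: less_imp_le)
  finally have "0 < ennreal (weight u) * emeasure lborel (tangent_graph u -` cb 0 1)"
    using weight_pos[OF u] by (simp add: ennreal_zero_less_mult_iff)
  also have "\<dots> \<le> tangent_factor u"
    unfolding tangent_factor_def by (intro SUP_upper) (simp add: hball_def)
  finally show ?thesis .
qed

lemma tangent_factor_finite: "u \<in> U \<Longrightarrow> tangent_factor u < top"
proof -
  assume u: "u \<in> U"
  obtain R where R: "\<And>e b. b \<in> V \<Longrightarrow> N (\<iota> e \<odot> b) \<le> 2 \<Longrightarrow> norm e \<le> R" using iota_bounded_in_balls by blast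
  have "tangent_factor u \<le> ennreal (weight u) * emeasure lborel (cball (0 :: (real^'m) \<times> real) R)"
    unfolding tangent_factor_def
  proof (rule SUP_least)
    fix z assume z: "z \<in> hball d 0 1"
    have "tangent_graph u -` cb z 1 \<subseteq> cball 0 R"
    proof
      fix e assume "e \<in> tangent_graph u -` cb z 1"
      then have "d z (tangent_graph u e) \<le> 1" by simp
      then have "N (tangent_graph u e) \<le> 2"
        using triangle[of "tangent_graph u e" z 0] z by (simp add: hnorm_def hball_def commute)
      then show "e \<in> cball 0 R" using R[OF dphi_V[OF u iota_in_W]] by (simp add: tangent_graph_def)
    qed
    then show "ennreal (weight u) * emeasure lborel (tangent_graph u -` cb z 1)
        \<le> ennreal (weight u) * emeasure lborel (cball (0 :: (real^'m) \<times> real) R)"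
      by (intro mult_left_mono emeasure_mono) auto
  qed
  also have "\<dots> < top"
    using emeasure_lborel_cball_finite[of "0 :: (real^'m) \<times> real" R] by (simp add: ennreal_mult_less_top)
  finally show ?thesis .
qed

text \<open>The neighbourhood is a preimage under \<open>projW\<close>, which recovers the parameter
  of a graph point; its parameters stay in a small ball around u, where the weight is
  bounded.\<close>

lemma graph_measure_locally_finite:
  assumes u: "u \<in> U"
  shows "\<exists>S. open S \<and> \<Phi> u \<in> S \<and> emeasure graph_measure S < top"
proof -
  obtain \<delta> where \<delta>: "\<delta> > 0" "\<And>y. y \<in> U \<Longrightarrow> norm (y - u) < \<delta> \<Longrightarrow> weight y \<le> weight u + 1"
    using weight_locally_bounded[OF u] by blast
  let ?S = "projW -` ball u \<delta>"
  have S: "open ?S" by (rule open_vimage[OF open_ball continuous_on_projW])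
  have "emeasure graph_measure ?S = (\<integral>\<^sup>+e. density_on ?S (\<iota> e) \<partial>lborel)"
    using S by (intro emeasure_graph_measure) auto
  also have "\<dots> \<le> (\<integral>\<^sup>+e. ennreal (weight u + 1) * indicator (cball 0 (norm u + \<delta>)) e \<partial>(lborel :: ((real^'m) \<times> real) measure))"
  proof (rule nn_integral_mono)
    fix e :: "(real^'m) \<times> real"
    show "density_on ?S (\<iota> e) \<le> ennreal (weight u + 1) * indicator (cball 0 (norm u + \<delta>)) e"
    proof (cases "\<iota> e \<in> U \<and> \<Phi> (\<iota> e) \<in> ?S")
      case True
      then have "projW (\<Phi> (\<iota> e)) = \<iota> e" by (intro projW_graph) blast
      then have "norm (\<iota> e - u) < \<delta>" using True by (simp add: dist_norm norm_minus_commute)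
      moreover have "norm e \<le> norm u + norm (\<iota> e - u)"
        using norm_triangle_ineq[of u "\<iota> e - u"] by (simp add: norm_iota)
      ultimately show ?thesis using True \<delta>(2)[of "\<iota> e"] by (simp add: density_on_def ennreal_leI)
    qed (auto simp: density_on_def)
  qed
  also have "\<dots> < top"
    using emeasure_lborel_cball_finite[of "0 :: (real^'m) \<times> real" "norm u + \<delta>"]
    by (subst nn_integral_cmult_indicator) (auto simp: ennreal_mult_less_top)
  finally show ?thesis using S u \<delta>(1) by (intro exI[of _ ?S]) (simp add: projW_graph)
qed

section \<open>Both sides expressed through the graph measure\<close>

lemma spherical_factor_tangent_cone:
  assumes u: "u \<in> U"
  shows "spherical_factor d (tangent_cone \<Sigma> (\<Phi> u)) = hausdorff_const TYPE((real^'m) \<times> real) * tangent_factor u"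
proof -
  have "spherical_factor d (tangent_cone \<Sigma> (\<Phi> u)) = (SUP z\<in>hball d 0 1. hausdorff_const TYPE((real^'m) \<times> real) *
      (ennreal (weight u) * emeasure lborel (tangent_graph u -` cb z 1)))"
    unfolding spherical_factor_def tangent_measure(1)[OF u]
    using tangent_measure(3)[OF u cb_borel] by (simp add: hball_def weight_def)
  also have "\<dots> = hausdorff_const TYPE((real^'m) \<times> real) * tangent_factor u"
    unfolding tangent_factor_def by (rule SUP_mult_left_ennreal[symmetric])
  finally show ?thesis .
qed

text \<open>In the isometric coordinates \<iota>, Hausdorff measure on W is Lebesgue measure times
  the same constant that occurs for the tangent cone.\<close>

lemma area_formula_left:
  assumes B: "B \<in> sets borel"
  shows "ennreal frame_norm * (\<integral>\<^sup>+x\<in>{x \<in> U. \<Phi> x \<in> B}. ennreal (jac_ratio x) \<partial>hausdorff_measure (CARD('m) + 1))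
    = hausdorff_const TYPE((real^'m) \<times> real) * emeasure graph_measure B"
proof -
  have c: "frame_norm \<ge> 0" by (simp add: frame_norm_def multivector_norm_def sum_nonneg)
  have q: "jac_ratio x \<ge> 0" if "x \<in> U" for x
    using weight_pos[OF that] c by (simp add: weight_def zero_less_mult_iff)
  have m: "(\<lambda>x. ennreal (jac_ratio x) * indicator {x \<in> U. \<Phi> x \<in> B} x) \<in> borel_measurable borel"
  proof -
    have "(\<lambda>u. indicator U u *\<^sub>R jac_ratio u) \<in> borel_measurable borel"
      by (rule borel_measurable_continuous_on_indicator[OF U_borel continuous_on_jac_ratio])
    then have "(\<lambda>u. ennreal (indicator U u *\<^sub>R jac_ratio u) * indicator {u \<in> U. \<Phi> u \<in> B} u) \<in> borel_measurable borel"
      using graph_vimage_borel[OF B] by measurable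
    moreover have "(\<lambda>x. ennreal (jac_ratio x) * indicator {x \<in> U. \<Phi> x \<in> B} x) =
        (\<lambda>u. ennreal (indicator U u *\<^sub>R jac_ratio u) * indicator {u \<in> U. \<Phi> u \<in> B} u)"
      by (auto simp: fun_eq_iff split: split_indicator)
    ultimately show ?thesis by simp
  qed
  have mh: "(\<lambda>x. ennreal (jac_ratio x) * indicator {x \<in> U. \<Phi> x \<in> B} x) \<in> borel_measurable (hausdorff_measure (CARD('m) + 1))"
    using m by simp
  have "ennreal frame_norm * (\<integral>\<^sup>+x\<in>{x \<in> U. \<Phi> x \<in> B}. ennreal (jac_ratio x) \<partial>hausdorff_measure (CARD('m) + 1))
    = (\<integral>\<^sup>+x. ennreal frame_norm * (ennreal (jac_ratio x) * indicator {x \<in> U. \<Phi> x \<in> B} x) \<partial>hausdorff_measure (CARD('m) + 1))"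
    by (rule nn_integral_cmult[OF mh, symmetric])
  also have "\<dots> = (\<integral>\<^sup>+x. density_on B x * indicator (range \<iota>) x \<partial>hausdorff_measure DIM((real^'m) \<times> real))"
    using c q U_W
    by (auto intro!: nn_integral_cong simp: density_on_def weight_def ennreal_mult range_iota split: split_indicator
        simp del: split_paired_All)
  also have "\<dots> = hausdorff_const TYPE((real^'m) \<times> real) * emeasure graph_measure B"
    unfolding emeasure_graph_measure[OF B]
    by (rule nn_integral_hausdorff_isometry[OF linear_iota norm_iota density_on_measurable[OF B]])
  finally show ?thesis .
qed

lemma spherical_measure_eq: "spherical_measure d (CARD('m) + 2) = sph"
  by (simp add: spherical_measure_def hball_def)

theorem area_formula:
  assumes B: "B \<in> sets borel" and sub: "B \<subseteq> \<Sigma>"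
  shows "ennreal frame_norm * (\<integral>\<^sup>+x\<in>{x \<in> U. \<Phi> x \<in> B}. ennreal (jac_ratio x) \<partial>hausdorff_measure (CARD('m) + 1))
    = (\<integral>\<^sup>+x\<in>B. spherical_factor d (tangent_cone \<Sigma> x) \<partial>spherical_measure d (CARD('m) + 2))"
proof -
  \<comment> \<open>\<open>projW\<close> inverts \<Phi> on the surface, so quantities indexed by
    parameters become functions of the point.\<close>
  have u: "projW x \<in> U" "\<Phi> (projW x) = x" if xB: "x \<in> B" for x
  proof -
    obtain u where "u \<in> U" "x = \<Phi> u" using xB sub Sigma_eq by blast
    then show "projW x \<in> U" "\<Phi> (projW x) = x" using projW_graph[of u] by simp_all
  qed
  let ?\<theta> = "\<lambda>x. tangent_factor (projW x)"
  have \<theta>: "(\<lambda>x. ?\<theta> x * indicator B x) \<in> borel_measurable borel"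
    "emeasure graph_measure B = (\<integral>\<^sup>+x\<in>B. ?\<theta> x \<partial>sph)"
  proof -
    have 1: "0 < ?\<theta> x" if "x \<in> B" for x by (rule tangent_factor_pos[OF u(1)[OF that]])
    have 2: "?\<theta> x < top" if "x \<in> B" for x by (rule tangent_factor_finite[OF u(1)[OF that]])
    have 3: "\<exists>S. open S \<and> x \<in> S \<and> emeasure graph_measure S < top" if "x \<in> B" for x
      using graph_measure_locally_finite[OF u(1)[OF that]] unfolding u(2)[OF that] .
    have 4: "\<exists>\<delta>>0. \<forall>y r. 0 < r \<and> r < \<delta> \<and> d y x \<le> r \<longrightarrow> emeasure graph_measure (cb y r) \<le> ennreal (t * r ^ (CARD('m) + 2))"
      if "x \<in> B" "t > 0" "?\<theta> x < ennreal t" for x t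
      using tangent_factor_upper[OF u(1)[OF that(1)] that(2,3)] unfolding u(2)[OF that(1)] .
    have 5: "\<exists>y r. 0 < r \<and> r < \<delta> \<and> d y x \<le> r \<and> ennreal (t * r ^ (CARD('m) + 2)) \<le> emeasure graph_measure (cb y r)"
      if "x \<in> B" "t > 0" "ennreal t < ?\<theta> x" "\<delta> > 0" for x t \<delta>
      using tangent_factor_lower[OF u(1)[OF that(1)] that(2-4)] unfolding u(2)[OF that(1)] .
    show "(\<lambda>x. ?\<theta> x * indicator B x) \<in> borel_measurable borel"
      by (rule measure_eq_nn_integral_density(1)[OF sets_graph_measure B 1 2 3 4 5])
    show "emeasure graph_measure B = (\<integral>\<^sup>+x\<in>B. ?\<theta> x \<partial>sph)"
      by (rule measure_eq_nn_integral_density(2)[OF sets_graph_measure B 1 2 3 4 5])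
  qed
  have "ennreal frame_norm * (\<integral>\<^sup>+x\<in>{x \<in> U. \<Phi> x \<in> B}. ennreal (jac_ratio x) \<partial>hausdorff_measure (CARD('m) + 1))
      = hausdorff_const TYPE((real^'m) \<times> real) * (\<integral>\<^sup>+x\<in>B. ?\<theta> x \<partial>sph)"
    using area_formula_left[OF B] \<theta>(2) by simp
  also have "\<dots> = (\<integral>\<^sup>+x. hausdorff_const TYPE((real^'m) \<times> real) * (?\<theta> x * indicator B x) \<partial>sph)"
  proof (rule nn_integral_cmult[symmetric])
    show "(\<lambda>x. ?\<theta> x * indicator B x) \<in> borel_measurable sph"
      using \<theta>(1) unfolding measurable_cong_sets[OF sets_sph refl] .
  qed
  also have "\<dots> = (\<integral>\<^sup>+x\<in>B. spherical_factor d (tangent_cone \<Sigma> x) \<partial>sph)"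
  proof (rule nn_integral_cong)
    fix x
    show "hausdorff_const TYPE((real^'m) \<times> real) * (?\<theta> x * indicator B x) =
        spherical_factor d (tangent_cone \<Sigma> x) * indicator B x"
      using u[of x] spherical_factor_tangent_cone[of "projW x"]
      by (cases "x \<in> B") (simp_all add: mult.assoc)
  qed
  finally show ?thesis unfolding spherical_measure_eq .
qed

end

theorem theorem1p1:
  fixes d :: "'n::finite heis \<Rightarrow> 'n heis \<Rightarrow> real"
    and W V U \<Sigma> \<Omega> B :: "'n heis set"
    and \<phi> :: "'n heis \<Rightarrow> 'n heis"
    and f :: "'n heis \<Rightarrow> real^'k::finite"
    and v :: "'k \<Rightarrow> 'n heis"
    and w :: "'m::finite \<Rightarrow> 'n heis"
  assumes "CARD('k) \<le> CARD('n)"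
    and "homogeneous_distance d"
    and "semidirect_factorization W V"
    and "dim V = CARD('k)"
    and "parametrized_H_regular_surface TYPE('k) d W V U \<phi> \<Sigma>"
    and "defining_function d V U \<Sigma> \<Omega> f"
    and "orthonormal_basis_of v V"
    and "orthonormal_basis_of (case_option e_top w) W"
    and "B \<in> sets borel"
    and "B \<subseteq> \<Sigma>"
  shows "ennreal (multivector_norm (wedge (case_sum v (case_option e_top w)))) *
           (\<integral>\<^sup>+x\<in>{x \<in> U. graph_map \<phi> x \<in> B}.
              ennreal (J_H d f (graph_map \<phi> x) / J_V d V f (graph_map \<phi> x))
            \<partial>hausdorff_measure (2 * CARD('n) + 1 - CARD('k)))
         = (\<integral>\<^sup>+x\<in>B. spherical_factor d (tangent_cone \<Sigma> x)
            \<partial>spherical_measure d (2 * CARD('n) + 2 - CARD('k)))"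
proof -
  interpret surface d W V v w U \<Sigma> \<Omega> \<phi> f
    using assms(2,3,5-8) by unfold_locales (auto simp: parametrized_H_regular_surface_def)
  \<comment> \<open>\<open>DIM('n heis)\<close> is 2n + 1, so \<open>dim_factors\<close> reads k + m
    + 1 = 2n + 1 and the natural number subtractions do not truncate.\<close>
  have "2 * CARD('n) + 1 - CARD('k) = CARD('m) + 1" "2 * CARD('n) + 2 - CARD('k) = CARD('m) + 2"
    using dim_factors by simp_all
  then show ?thesis
    using area_formula[OF assms(9,10)] by (simp only: frame_norm_def jac_ratio_def)
qed

end
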